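(* There is a universal constant $\varepsilon_0>0$ and a randomized algorithm that, given query access to an $n$-point metric $w$ with positive integer entries under the promise that the complete graph $G_w$ has a minimum spanning tree all of whose edges have weight $1$, performs $\tilde O(n^{1.5})$ distance queries and with high probability outputs a value $X$ with $\mathsf{TSP}(w)\le X\le(2-\varepsilon_0)\,\mathsf{TSP}(w)$.
   Context: Query access means that the algorithm may query any entry $w(u,v)$ of the $n\times n$ distance matrix. $G_w$ is the complete graph on the $n$ points with edge weights $w$; $\mathsf{TSP}(w)$ is the minimum weight of a Hamiltonian cycle in $G_w$. $\tilde O$ hides polylogarithmic factors in $n$. *)

theory Defs
  imports "HOL-Probability.Probability" "HOL-Combinatorics.Permutations"
begin

section \<open>Metrics on n points\<close>

text \<open>An n-point metric on the points 0..n-1 with positive integer distances.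
  Values outside {0..<n} are irrelevant.\<close>
definition pos_int_metric :: "nat \<Rightarrow> (nat \<Rightarrow> nat \<Rightarrow> nat) \<Rightarrow> bool" where
  "pos_int_metric n w \<longleftrightarrow>
     (\<forall>u<n. w u u = 0) \<and>
     (\<forall>u<n. \<forall>v<n. u \<noteq> v \<longrightarrow> w u v \<ge> 1) \<and>
     (\<forall>u<n. \<forall>v<n. w u v = w v u) \<and>
     (\<forall>u<n. \<forall>v<n. \<forall>x<n. w u v \<le> w u x + w x v)"

section \<open>Spanning trees of the complete graph G_w\<close>

text \<open>Edges of the complete graph on {0..<n} are represented as pairs (u,v) with u < v < n.
  A spanning tree is a connected spanning edge set with exactly n-1 edges.\<close>
definition spanning_tree :: "nat \<Rightarrow> (nat \<times> nat) set \<Rightarrow> bool" where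
  "spanning_tree n T \<longleftrightarrow>
     finite T \<and> (\<forall>(u,v)\<in>T. u < v \<and> v < n) \<and> card T = n - 1 \<and>
     (\<forall>u<n. \<forall>v<n. (u, v) \<in> (T \<union> T\<inverse>)\<^sup>*)"

definition tree_weight :: "(nat \<Rightarrow> nat \<Rightarrow> nat) \<Rightarrow> (nat \<times> nat) set \<Rightarrow> nat" where
  "tree_weight w T = (\<Sum>(u,v)\<in>T. w u v)"

definition minimum_spanning_tree :: "nat \<Rightarrow> (nat \<Rightarrow> nat \<Rightarrow> nat) \<Rightarrow> (nat \<times> nat) set \<Rightarrow> bool" where
  "minimum_spanning_tree n w T \<longleftrightarrow>
     spanning_tree n T \<and> (\<forall>T'. spanning_tree n T' \<longrightarrow> tree_weight w T \<le> tree_weight w T')"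

section \<open>TSP\<close>

text \<open>A Hamiltonian cycle is given by a permutation p of {0..<n}, visiting p 0, ..., p (n-1), p 0.\<close>
definition tour_cost :: "nat \<Rightarrow> (nat \<Rightarrow> nat \<Rightarrow> nat) \<Rightarrow> (nat \<Rightarrow> nat) \<Rightarrow> nat" where
  "tour_cost n w p = (\<Sum>i<n. w (p i) (p ((i + 1) mod n)))"

definition TSP :: "nat \<Rightarrow> (nat \<Rightarrow> nat \<Rightarrow> nat) \<Rightarrow> nat" where
  "TSP n w = Min ((\<lambda>p. tour_cost n w p) ` {p. p permutes {..<n}})"

section \<open>Query algorithms\<close>

text \<open>A deterministic query algorithm (decision tree): either output a real value, or query
  the distance w(u,v) and continue depending on the answer.\<close>
datatype qtree = Output real | Query nat nat "nat \<Rightarrow> qtree"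

primrec run_qtree :: "qtree \<Rightarrow> (nat \<Rightarrow> nat \<Rightarrow> nat) \<Rightarrow> real \<times> nat" where
  "run_qtree (Output x) = (\<lambda>w. (x, 0))"
| "run_qtree (Query u v f) = (\<lambda>w. (let (x, c) = run_qtree (f (w u v)) w in (x, Suc c)))"

definition qt_output :: "qtree \<Rightarrow> (nat \<Rightarrow> nat \<Rightarrow> nat) \<Rightarrow> real" where
  "qt_output t w = fst (run_qtree t w)"

definition qt_queries :: "qtree \<Rightarrow> (nat \<Rightarrow> nat \<Rightarrow> nat) \<Rightarrow> nat" where
  "qt_queries t w = snd (run_qtree t w)"

text \<open>A randomized query algorithm is, for each n, a probability distribution over
  deterministic query algorithms (i.e. random coins fixed in advance).\<close>
type_synonym rand_query_alg = "nat \<Rightarrow> qtree pmf"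

text \<open>The promise: w is an n-point positive integer metric and G_w has an MST all of whose
  edges have weight 1.\<close>
definition promise :: "nat \<Rightarrow> (nat \<Rightarrow> nat \<Rightarrow> nat) \<Rightarrow> bool" where
  "promise n w \<longleftrightarrow> pos_int_metric n w \<and>
     (\<exists>T. minimum_spanning_tree n w T \<and> (\<forall>(u,v)\<in>T. w u v = 1))"

end

theory Submission
  imports Defs "HOL-Library.Sublist" "HOL-Library.Multiset"
begin

text \<open>
  Write \<open>T\<close> for the unit spanning tree and \<open>G\<close> for the graph of unit distances. Since
  \<open>n \<le> TSP \<le> 2n\<close>, it suffices to tell \<open>TSP < (1 + \<epsilon>0) n\<close> from \<open>TSP > (2 - \<epsilon>0) n\<close> and to output
  \<open>(2 - \<epsilon>0) n\<close> or \<open>2n\<close> accordingly.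

  If \<open>TSP > (2 - \<epsilon>0) n\<close>, then no set of pairs covers many tree edges at small cost (otherwise a
  random subset of it would repair the parity of the doubled tree profitably). Hence, after contracting
  a tiny set \<open>Z\<close> of tree edges, \<open>w\<close> is within a factor \<open>23/22\<close> of the tree metric. Let \<open>W\<close> be the set of
  endpoints of \<open>Z\<close>. Outside \<open>W\<close> the graph \<open>G\<close> is the tree, so a vertex is either the root of a subtree
  with more than \<open>n powr (1/4)\<close> vertices, or the end of a bridge of \<open>G\<close> with a small side, or close
  to \<open>W\<close>. This leaves three cases, each of which is impossible for a cheap tour.
  \<^item> Many large subtrees: already the tour through a random sample of about \<open>n powr (3/4)\<close> points is long.
  \<^item> Many dead ends: small sides of bridges on which every tour loses a constant fraction. They are
    recognised locally by searching the side of the bridge.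
  \<^item> Many leaves attached to the few vertices of \<open>W\<close>. They are detected by freezing: in rounds with
    geometrically increasing sampling rates, an active vertex with an active neighbour in the sample
    is frozen. High-degree vertices such as those of \<open>W\<close> freeze early, so that few vertices are frozen
    but many active vertices end up isolated. In an instance with a cheap tour, the isolated vertices
    cannot outnumber the frozen ones, because the neighbours of an isolated vertex on the tour are
    frozen or at distance more than one.

  The membership of a vertex in the active set is computed recursively; in expectation the recursion
  cost grows by a factor 3 per round while the sampling rate grows by a factor 4, which keeps the total
  below \<open>n powr (3/2)\<close>. A majority vote over \<open>O(log n)\<close> runs makes the error at most \<open>1 / n\<close>.
\<close>

section \<open>Walks, tours and Eulerian multigraphs\<close>

text \<open>The obstacle is the set \<open>W\<close>: its few vertices may have degree of order n in
  the unit graph, and a leaf attached to \<open>W\<close> cannot be judged locally, since it may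
  have two unit neighbours in \<open>W\<close> and cost a tour nothing extra. Only a count makes
  such leaves expensive: many vertices whose unit neighbours all lie in a tiny set. Freezing
  exhibits this situation without computing degrees.

  The factor \<open>23/22\<close> has two duties. Below 2 it makes a unit distance use at most one
  uncontracted tree edge, so that unit edges away from \<open>W\<close> are tree edges. Below
  \<open>22/21\<close> it lets the structural surplus of a dead end (a ratio of 2.2 against 2)
  survive as the factor \<open>21/20\<close>. Its distance from 1 sets the 46 in the bound on
  \<open>card Z\<close>.

  Both halves of the freezing process meet the same bound. Up to the middle round about
  \<open>sqrt n\<close> vertices at most are sampled in expectation, and their full rows cost n
  each; afterwards the recursion from one random vertex costs of order \<open>n * 3 ^ k\<close>,
  with \<open>4 ^ k\<close> of order \<open>sqrt n\<close>.\<close>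

fun wcost :: "(nat \<Rightarrow> nat \<Rightarrow> nat) \<Rightarrow> nat list \<Rightarrow> nat" where
  "wcost w (x # y # zs) = w x y + wcost w (y # zs)"
| "wcost w _ = 0"

fun wedges :: "nat list \<Rightarrow> nat set multiset" where
  "wedges (x # y # zs) = add_mset {x, y} (wedges (y # zs))"
| "wedges _ = {#}"

definition edeg :: "nat set multiset \<Rightarrow> nat \<Rightarrow> nat" where
  "edeg E x = size {#e \<in># E. x \<in> e#}"

text \<open>Edges are unordered pairs, so an order of the endpoints has to be fixed; by symmetry of
  the metric the choice is immaterial.\<close>

definition edge_weight :: "(nat \<Rightarrow> nat \<Rightarrow> nat) \<Rightarrow> nat set \<Rightarrow> nat" where
  "edge_weight w e = w (Min e) (Max e)"

lemma wedges_append: "wedges (xs @ x # ys) = wedges (xs @ [x]) + wedges (x # ys)"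
proof (induction xs)
  case (Cons a xs)
  then show ?case by (cases xs) auto
qed simp

lemma size_wedges: "p \<noteq> [] \<Longrightarrow> Suc (size (wedges p)) = length p"
  by (induction p rule: wedges.induct) auto

lemma in_wedges_subset: "e \<in># wedges p \<Longrightarrow> e \<subseteq> set p"
  by (induction p rule: wedges.induct) auto

lemma edeg_add [simp]: "edeg (A + B) x = edeg A x + edeg B x"
  by (simp add: edeg_def)

lemma edeg_add_mset [simp]: "edeg (add_mset e A) x = of_bool (x \<in> e) + edeg A x"
  by (simp add: edeg_def)

lemma edeg_empty [simp]: "edeg {#} x = 0"
  by (simp add: edeg_def)

lemma edeg_diff: "A \<subseteq># B \<Longrightarrow> edeg (B - A) x = edeg B x - edeg A x"
  using edeg_add[of "B - A" A x] by simp

lemma edeg_mono: "A \<subseteq># B \<Longrightarrow> edeg A x \<le> edeg B x"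
  using edeg_add[of "B - A" A x] by simp

section \<open>Euler circuits of connected even multigraphs\<close>

lemma even_edeg_wedges:
  assumes "\<forall>e\<in>#wedges p. card e = 2" "p \<noteq> []"
  shows "even (edeg (wedges p) x + of_bool (hd p = x) + of_bool (last p = x))"
  using assms
proof (induction p rule: wedges.induct)
  case (1 a b zs)
  then have "a \<noteq> b" by auto
  then show ?case using 1 by (auto split: if_splits)
qed auto

lemma closed_trail_exhausting:
  assumes c2: "\<forall>e\<in>#E. card e = 2" and ev: "\<And>x. even (edeg E x)"
  obtains p where "p \<noteq> []" "hd p = a" "last p = a" "wedges p \<subseteq># E"
    "\<forall>e\<in>#E - wedges p. a \<notin> e"
proof -
  define P where "P p \<longleftrightarrow> p \<noteq> [] \<and> hd p = a \<and> wedges p \<subseteq># E" for p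
  have "P [a]" by (simp add: P_def)
  moreover have "\<forall>p. P p \<longrightarrow> length p < Suc (Suc (size E))"
    unfolding P_def less_Suc_eq_le by (metis size_wedges size_mset_mono Suc_le_mono)
  ultimately obtain p where p: "P p" and mx: "\<And>q. P q \<Longrightarrow> length q \<le> length p"
    using ex_has_greatest_nat[of P "[a]" length "Suc (Suc (size E))"] by blast
  define z where "z = last p"
  have no: "\<forall>e\<in>#E - wedges p. z \<notin> e"
  proof (intro ballI notI)
    fix e assume e: "e \<in># E - wedges p" "z \<in> e"
    then have "card e = 2" using c2 by (meson in_diffD)
    then obtain y where y: "e = {z, y}" using e(2)
      by (metis card_2_iff doubleton_eq_iff insertE singletonD)
    have pb: "p = butlast p @ [z]" using p by (simp add: P_def z_def)
    have "wedges (p @ [y]) = wedges p + {#{z, y}#}"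
      using wedges_append[of "butlast p" z "[y]"] pb by (metis append_Cons append_Nil append_assoc wedges.simps(1) wedges.simps(3))
    moreover have "wedges p + {#e#} \<subseteq># E"
      using e p by (metis P_def add.commute add_mset_add_single insert_subset_eq_iff subset_mset.le_diff_conv2 mset_subset_eq_single)
    ultimately have "P (p @ [y])" using p y by (simp add: P_def)
    from mx[OF this] show False by simp
  qed
  have wp: "\<forall>e\<in>#wedges p. card e = 2" using p c2 by (meson P_def mset_subset_eqD)
  have "edeg M z = 0" if "\<forall>e\<in>#M. z \<notin> e" for M
    using that by (induction M) auto
  with no have "edeg (E - wedges p) z = 0" by blast
  then have "edeg E z = edeg (wedges p) z"
    using p edeg_add[of "E - wedges p" "wedges p" z] by (simp add: P_def)
  then have "even (edeg (wedges p) z)" using ev by metis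
  with even_edeg_wedges[OF wp, of z] p have "hd p = z"
    by (auto simp: P_def z_def split: if_splits)
  then have "z = a" using p by (simp add: P_def)
  then show ?thesis using that[of p] p no by (auto simp: P_def z_def)
qed

text \<open>Take a longest closed trail from \<open>a\<close>. If edges are left over, connectivity
  yields one that touches the trail; the leftover edges still have even degrees, so a closed trail
  among them can be spliced in at that vertex.\<close>

lemma euler_circuit:
  assumes c2: "\<forall>e\<in>#E. card e = 2" and ev: "\<And>x. even (edeg E x)"
    and sub: "\<forall>e\<in>#E. e \<subseteq> U" and a: "a \<in> U"
    and conn: "\<And>y. y \<in> U \<Longrightarrow> (a, y) \<in> {(u, v). {u, v} \<in># E}\<^sup>*"
  obtains p where "p \<noteq> []" "hd p = a" "last p = a" "wedges p = E"
proof -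
  define P where "P p \<longleftrightarrow> p \<noteq> [] \<and> hd p = a \<and> last p = a \<and> wedges p \<subseteq># E" for p
  have "P [a]" by (simp add: P_def)
  moreover have "\<forall>p. P p \<longrightarrow> length p < Suc (Suc (size E))"
    unfolding P_def less_Suc_eq_le by (metis size_wedges size_mset_mono Suc_le_mono)
  ultimately obtain p where p: "P p" and mx: "\<And>q. P q \<Longrightarrow> length q \<le> length p"
    using ex_has_greatest_nat[of P "[a]" length "Suc (Suc (size E))"] by blast
  have "E - wedges p = {#}"
  proof (rule ccontr)
    assume ne: "E - wedges p \<noteq> {#}"
    define E' where "E' = E - wedges p"
    have wp: "\<forall>e\<in>#wedges p. card e = 2" using p c2 by (meson P_def mset_subset_eqD)
    have c2': "\<forall>e\<in>#E'. card e = 2" using c2 E'_def by (meson in_diffD)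
    have ev': "even (edeg E' x)" for x
    proof -
      have "even (edeg (wedges p) x)"
        using even_edeg_wedges[OF wp, of x] p by (auto simp: P_def split: if_splits)
      then show ?thesis using ev[of x] p edeg_diff[of "wedges p" E x] edeg_mono[of "wedges p" E x]
        by (simp add: P_def E'_def)
    qed
    \<comment> \<open>Otherwise a path in \<open>E\<close> from \<open>a\<close> to an endpoint of a
      leftover edge would use trail edges only, and the trail would visit that endpoint.\<close>
    have "\<exists>x\<in>set p. \<exists>e\<in>#E'. x \<in> e"
    proof (rule ccontr)
      assume no: "\<not> ?thesis"
      obtain e where e: "e \<in># E'" using ne E'_def by (metis multiset_nonemptyE)
      then obtain y where y: "y \<in> e" using c2' by fastforce
      have yU: "y \<in> U" using e y sub E'_def by (meson in_diffD subsetD)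
      have "(a, y) \<in> {(u, v). {u, v} \<in># E}\<^sup>*" by (rule conn[OF yU])
      then have "y \<in> set p"
      proof (induction rule: rtrancl_induct)
        case base
        then show ?case using p by (metis P_def hd_in_set)
      next
        case (step u v)
        then have "{u, v} \<in># E" by simp
        moreover have "{u, v} \<notin># E'" using no step by auto
        ultimately have "{u, v} \<in># wedges p" using E'_def
          by (metis in_diff_count not_gr_zero count_greater_zero_iff)
        then show ?case using in_wedges_subset by auto
      qed
      then show False using no e y by auto
    qed
    then obtain x e where x: "x \<in> set p" and e: "e \<in># E'" "x \<in> e" by auto
    obtain q where q: "q \<noteq> []" "hd q = x" "last q = x" "wedges q \<subseteq># E'" "\<forall>e\<in>#E' - wedges q. x \<notin> e"
      using closed_trail_exhausting[OF c2' ev'] by blast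
    have "wedges q \<noteq> {#}" using e q(5) by auto
    then have lq: "length q \<ge> 2" using size_wedges[OF q(1)] by (cases "size (wedges q)") auto
    obtain p1 p2 where pp: "p = p1 @ x # p2" using x by (meson split_list)
    obtain q' where q': "q = x # q'" "q' \<noteq> []"
      using lq q(2) by (metis Suc_le_length_iff list.sel(1) list.distinct(1) numeral_2_eq_2)
    have q'': "q' = butlast q' @ [x]" using q' q(3) by (metis append_butlast_last_id last_ConsR)
    define r where "r = p1 @ x # q' @ p2"
    have "wedges r = wedges (p1 @ [x]) + wedges (x # q' @ p2)"
      unfolding r_def by (rule wedges_append)
    also have "wedges (x # q' @ p2) = wedges (x # q') + wedges (x # p2)"
      using wedges_append[of "x # butlast q'" x p2] q'' by (metis append_Cons append_Nil append_assoc)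
    finally have wr: "wedges r = wedges p + wedges q"
      using wedges_append[of p1 x p2] pp q' by (simp add: ac_simps)
    have "wedges r \<subseteq># E"
      using p q(4) unfolding wr E'_def P_def by (simp add: subset_mset.le_diff_conv2 add.commute)
    moreover have "hd r = a" using p unfolding r_def P_def pp by (cases p1) auto
    moreover have "last r = a"
    proof (cases "p2 = []")
      case True
      then show ?thesis using p q'' q' unfolding r_def P_def pp
        by (metis append_Nil2 last_appendR last_snoc list.distinct(1) last_ConsR)
    next
      case False
      then show ?thesis using p unfolding r_def P_def pp by simp
    qed
    ultimately have "P r" by (simp add: P_def r_def)
    from mx[OF this] show False unfolding r_def pp using q' by simp
  qed
  then have "wedges p = E" using p by (metis P_def add.left_neutral subset_mset.diff_add)
  then show ?thesis using that p by (auto simp: P_def)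
qed

section \<open>Shortcutting closed walks by the triangle inequality\<close>

context
  fixes n :: nat and w :: "nat \<Rightarrow> nat \<Rightarrow> nat"
  assumes met: "pos_int_metric n w"
begin

lemma w_sym: "u < n \<Longrightarrow> v < n \<Longrightarrow> w u v = w v u"
  using met by (auto simp: pos_int_metric_def)

lemma w_tri: "u < n \<Longrightarrow> v < n \<Longrightarrow> x < n \<Longrightarrow> w u v \<le> w u x + w x v"
  using met by (auto simp: pos_int_metric_def)

lemma w_pos: "u < n \<Longrightarrow> v < n \<Longrightarrow> u \<noteq> v \<Longrightarrow> 1 \<le> w u v"
  using met by (auto simp: pos_int_metric_def)

lemma w_refl: "u < n \<Longrightarrow> w u u = 0"
  using met by (auto simp: pos_int_metric_def)

lemma wcost_reroute:
  assumes "l \<noteq> []" "set l \<subseteq> {..<n}" "a < n" "y < n"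
  shows "wcost w (a # l) \<le> w a y + wcost w (y # l)"
  using assms w_tri[of a "hd l" y] by (cases l) auto

lemma wcost_subseq:
  assumes "subseq xs zs" "a < n" "b < n" "set zs \<subseteq> {..<n}"
  shows "wcost w (a # xs @ [b]) \<le> wcost w (a # zs @ [b])"
  using assms
proof (induction arbitrary: a rule: list_emb.induct)
  case (list_emb_Nil ys)
  then show ?case
  proof (induction ys arbitrary: a)
    case (Cons y ys)
    have "w a b \<le> w a y + w y b" using Cons.prems by (intro w_tri) auto
    moreover have "w y b \<le> wcost w (y # ys @ [b])" using Cons.IH[of y] Cons.prems by auto
    ultimately show ?case by simp
  qed simp
next
  case (list_emb_Cons xs ys y)
  have sub: "set xs \<subseteq> set ys" using list_emb_Cons(1) by (rule list_emb_set[where P="(=)", THEN subsetI]) auto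
  have "wcost w (a # xs @ [b]) \<le> w a y + wcost w (y # xs @ [b])"
    using list_emb_Cons.prems sub by (intro wcost_reroute) auto
  also have "\<dots> \<le> w a y + wcost w (y # ys @ [b])" using list_emb_Cons by auto
  finally show ?case by simp
next
  case (list_emb_Cons2 x y xs ys)
  then show ?case by auto
qed

lemma subseq_remdups: "subseq (remdups xs) xs"
  by (induction xs) (auto intro: list_emb_Cons)

lemma closed_walk_shortcut:
  assumes "a < n" "set zs \<subseteq> {..<n}" "S \<subseteq> insert a (set zs)"
  obtains xs where "distinct xs" "set xs = S - {a}" "wcost w (a # xs @ [a]) \<le> wcost w (a # zs @ [a])"
proof -
  define xs where "xs = remdups (filter (\<lambda>x. x \<in> S - {a}) zs)"
  have "subseq xs zs" unfolding xs_def
    using subseq_remdups subseq_filter_left subseq_order.order_trans by blast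
  from wcost_subseq[OF this assms(1) assms(1) assms(2)]
  show ?thesis using that[of xs] assms by (auto simp: xs_def)
qed

lemma wcost_wedges:
  assumes "set p \<subseteq> {..<n}"
  shows "wcost w p = (\<Sum>e\<in>#wedges p. edge_weight w e)"
  using assms
proof (induction p rule: wedges.induct)
  case (1 x y zs)
  then have "edge_weight w {x, y} = w x y"
    using w_sym[of x y] by (auto simp: edge_weight_def min_def max_def)
  then show ?case using 1 by simp
qed auto

end

section \<open>Tours as closed lists\<close>

lemma tour_cost_nth:
  "tour_cost n w p = (\<Sum>i<n. w (map p [0..<n] ! i) (map p [0..<n] ! (Suc i mod n)))"
  unfolding tour_cost_def
proof (intro sum.cong refl)
  fix i assume "i \<in> {..<n}"
  then have "i < n" "Suc i mod n < n" by auto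
  then show "w (p i) (p ((i + 1) mod n)) = w (map p [0..<n] ! i) (map p [0..<n] ! (Suc i mod n))"
    by simp
qed

lemma wcost_snoc_sum:
  "xs \<noteq> [] \<Longrightarrow> wcost w (xs @ [b]) = (\<Sum>i<length xs. w (xs ! i) (if Suc i < length xs then xs ! Suc i else b))"
proof (induction xs rule: wedges.induct)
  case (1 x y zs)
  have "(\<Sum>i<length (x # y # zs). w ((x # y # zs) ! i) (if Suc i < length (x # y # zs) then (x # y # zs) ! Suc i else b))
    = w x y + (\<Sum>i<length (y # zs). w ((y # zs) ! i) (if Suc i < length (y # zs) then (y # zs) ! Suc i else b))"
    by (subst (1) length_Cons, subst sum.lessThan_Suc_shift) (simp del: sum.lessThan_Suc cong: if_cong)
  then show ?case using 1 by simp
qed auto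

lemma closed_cost_sum:
  assumes "xs \<noteq> []"
  shows "wcost w (xs @ [hd xs]) = (\<Sum>i<length xs. w (xs ! i) (xs ! (Suc i mod length xs)))"
  unfolding wcost_snoc_sum[OF assms]
  by (intro sum.cong refl) (use assms in \<open>auto simp: hd_conv_nth mod_Suc less_Suc_eq_le not_less\<close>)

lemma tour_cost_eq_wcost:
  "0 < n \<Longrightarrow> tour_cost n w p = wcost w (map p [0..<n] @ [p 0])"
  using closed_cost_sum[of "map p [0..<n]" w] tour_cost_nth[of n w p] by (simp add: hd_map)

lemma TSP_attained: "\<exists>p. p permutes {..<n} \<and> TSP n w = tour_cost n w p"
proof -
  have "finite {p. p permutes {..<n}}" by (simp add: finite_permutations)
  moreover have "{p. p permutes {..<n}} \<noteq> {}" using permutes_id by blast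
  ultimately have "TSP n w \<in> tour_cost n w ` {p. p permutes {..<n}}"
    unfolding TSP_def by (intro Min_in) auto
  then show ?thesis by auto
qed

lemma TSP_le_tour_cost: "p permutes {..<n} \<Longrightarrow> TSP n w \<le> tour_cost n w p"
  unfolding TSP_def by (rule Min_le) (auto simp: finite_permutations)

lemma TSP_le_closed_list:
  assumes "distinct xs" "set xs = {..<n}" "0 < n"
  shows "TSP n w \<le> wcost w (xs @ [hd xs])"
proof -
  have len: "length xs = n" using assms by (metis card_lessThan distinct_card)
  define p where "p i = (if i < n then xs ! i else i)" for i
  have "inj_on p {..<n}" unfolding p_def inj_on_def using assms len by (simp add: nth_eq_iff_index_eq)
  moreover have "p ` {..<n} = {..<n}"
  proof -
    have "p ` {..<n} = (\<lambda>i. xs ! i) ` {..<n}" by (intro image_cong) (auto simp: p_def)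
    also have "\<dots> = set xs" using len by (auto simp: set_conv_nth image_def)
    finally show ?thesis using assms by simp
  qed
  ultimately have "p permutes {..<n}"
    by (intro bij_imp_permutes) (auto simp: bij_betw_def p_def)
  moreover have "map p [0..<n] = xs" by (intro nth_equalityI) (auto simp: p_def len)
  moreover have "p 0 = hd xs" using assms len by (cases xs) (auto simp: p_def)
  ultimately show ?thesis using TSP_le_tour_cost[of p n w] tour_cost_eq_wcost[of n w p] assms by simp
qed

text \<open>Euler circuit plus shortcutting: the bound behind the tree-doubling heuristic, in the
  generality needed for the parity-repaired tree below.\<close>

lemma TSP_le_even_multigraph:
  assumes met: "pos_int_metric n w" and n: "0 < n"
    and c2: "\<forall>e\<in>#E. card e = 2" and ev: "\<And>x. even (edeg E x)"
    and sub: "\<forall>e\<in>#E. e \<subseteq> {..<n}"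
    and conn: "\<And>y. y < n \<Longrightarrow> (0, y) \<in> {(u, v). {u, v} \<in># E}\<^sup>*"
  shows "TSP n w \<le> (\<Sum>e\<in>#E. edge_weight w e)"
\<comment> \<open>The shortcut argument needs a walk with at least one edge; a single point has the
  tour of cost 0.\<close>
proof (cases "n = 1")
  case True
  have "TSP n w \<le> wcost w ([0] @ [hd [0]])"
    by (rule TSP_le_closed_list) (use True in auto)
  then show ?thesis using w_refl[OF met, of 0] True by simp
next
  case False
  obtain p where p: "p \<noteq> []" "hd p = 0" "last p = 0" "wedges p = E"
    using euler_circuit[OF c2 ev sub, of 0] conn n by auto
  have cov: "y \<in> set p" if y: "y < n" for y
    using conn[OF y]
  proof (induction rule: rtrancl_induct)
    case base
    then show ?case using p by (metis hd_in_set)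
  next
    case (step u v)
    then show ?case using in_wedges_subset p by fastforce
  qed
  have lp: "set p \<subseteq> {..<n}"
  proof -
    have "set q \<subseteq> insert (hd q) (\<Union>(set_mset (wedges q)))" if "q \<noteq> []" for q
      using that by (induction q rule: wedges.induct) auto
    then show ?thesis using p sub n by fastforce
  qed
  have "1 \<in> set p" using cov False n by simp
  then have "length p \<ge> 2" using p by (cases p; cases "tl p") auto
  then obtain p' where p': "p = 0 # p'" "p' \<noteq> []"
    using p(2) by (metis Suc_le_length_iff list.sel(1) list.distinct(1) numeral_2_eq_2)
  define zs where "zs = butlast p'"
  have zs: "p = 0 # zs @ [0]" using p' p(3) append_butlast_last_id[of p'] by (simp add: zs_def)
  have "{..<n} \<subseteq> insert 0 (set zs)" using cov zs by auto
  then obtain xs where xs: "distinct xs" "set xs = {..<n} - {0}" "wcost w (0 # xs @ [0]) \<le> wcost w (0 # zs @ [0])"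
    using closed_walk_shortcut[OF met n, of zs "{..<n}"] lp zs by auto
  have "TSP n w \<le> wcost w ((0 # xs) @ [hd (0 # xs)])"
    using xs n by (intro TSP_le_closed_list) auto
  also have "\<dots> \<le> wcost w p" using xs zs by simp
  also have "\<dots> = (\<Sum>e\<in>#E. edge_weight w e)" using wcost_wedges[OF met lp] p by simp
  finally show ?thesis .
qed

section \<open>Unit spanning trees and their contractions\<close>

text \<open>A spanning tree rooted at 0, given by its parent map. \<open>lev\<close> is a potential
  that decreases towards the root and serves as the induction measure.\<close>

locale ptree =
  fixes n :: nat and par :: "nat \<Rightarrow> nat" and lev :: "nat \<Rightarrow> nat"
  assumes n0: "0 < n" and par_0 [simp]: "par 0 = 0" and par_lt: "v < n \<Longrightarrow> par v < n"
    and lev_par: "0 < v \<Longrightarrow> v < n \<Longrightarrow> lev (par v) < lev v"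
begin

lemma tree_induct [consumes 1, case_names root step]:
  assumes "x < n" "P 0" "\<And>x. 0 < x \<Longrightarrow> x < n \<Longrightarrow> P (par x) \<Longrightarrow> P x"
  shows "P x"
  using assms(1)
proof (induction "lev x" arbitrary: x rule: less_induct)
  case less
  then show ?case using assms(2,3) lev_par par_lt by (cases "x = 0") auto
qed

text \<open>An edge of the tree is represented by its lower endpoint; \<open>anc x\<close> is the path from
  \<open>x\<close> to the root \<open>0\<close>, seen as a set of edges.\<close>

definition anc :: "nat \<Rightarrow> nat set" where
  "anc x = {(par ^^ k) x |k. True} - {0}"

definition sub :: "nat \<Rightarrow> nat set" where
  "sub e = {x. x < n \<and> e \<in> anc x}"

definition pth :: "nat \<Rightarrow> nat \<Rightarrow> nat set" where
  "pth x y = (anc x - anc y) \<union> (anc y - anc x)"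

lemma par_pow_0 [simp]: "(par ^^ k) 0 = 0"
  by (induction k) auto

lemma anc_0 [simp]: "anc 0 = {}"
  by (auto simp: anc_def)

lemma anc_step: "0 < x \<Longrightarrow> anc x = insert x (anc (par x))"
proof -
  assume x: "0 < x"
  have "{(par ^^ k) x |k. True} = insert x {(par ^^ k) (par x) |k. True}"
  proof (intro equalityI subsetI)
    fix y assume "y \<in> {(par ^^ k) x |k. True}"
    then obtain k where "y = (par ^^ k) x" by auto
    then show "y \<in> insert x {(par ^^ k) (par x) |k. True}"
      by (cases k) (auto simp: funpow_swap1)
  next
    fix y assume "y \<in> insert x {(par ^^ k) (par x) |k. True}"
    then consider "y = x" | k where "y = (par ^^ k) (par x)" by auto
    then show "y \<in> {(par ^^ k) x |k. True}"
    proof cases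
      case 1
      then have "y = (par ^^ 0) x" by simp
      then show ?thesis by blast
    next
      case 2
      then have "y = (par ^^ Suc k) x" by (simp add: funpow_swap1)
      then show ?thesis by blast
    qed
  qed
  then show ?thesis using x by (auto simp: anc_def)
qed

lemma anc_lev: "x < n \<Longrightarrow> y \<in> anc x \<Longrightarrow> lev y \<le> lev x \<and> 0 < y \<and> y < n"
proof (induction rule: tree_induct)
  case (step x)
  then show ?case using lev_par[of x] by (auto simp: anc_step)
qed auto

lemma anc_bounds: "x < n \<Longrightarrow> y \<in> anc x \<Longrightarrow> 0 < y \<and> y < n"
  using anc_lev by auto

lemma finite_anc: "x < n \<Longrightarrow> finite (anc x)"
  using anc_bounds by (intro finite_subset[of "anc x" "{..<n}"]) auto

lemma finite_pth: "x < n \<Longrightarrow> y < n \<Longrightarrow> finite (pth x y)"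
  by (simp add: pth_def finite_anc)

lemma not_in_anc_par: "0 < x \<Longrightarrow> x < n \<Longrightarrow> x \<notin> anc (par x)"
  using anc_lev[of "par x" x] lev_par[of x] par_lt[of x] by auto

lemma self_in_anc: "0 < x \<Longrightarrow> x \<in> anc x"
  by (simp add: anc_step)

lemma anc_trans: "x < n \<Longrightarrow> y \<in> anc x \<Longrightarrow> anc y \<subseteq> anc x"
proof (induction rule: tree_induct)
  case (step x)
  then show ?case by (auto simp: anc_step)
qed auto

lemma anc_chain: "x < n \<Longrightarrow> y \<in> anc x \<Longrightarrow> z \<in> anc x \<Longrightarrow> y \<in> anc z \<or> z \<in> anc y"
proof (induction rule: tree_induct)
  case (step x)
  then show ?case using self_in_anc[of x] by (auto simp: anc_step)
qed auto

lemma sub_subset: "sub e \<subseteq> {..<n}"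
  by (auto simp: sub_def)

lemma finite_sub: "finite (sub e)"
  using sub_subset by (rule finite_subset) simp

lemma sub_mono: "e \<in> sub v \<Longrightarrow> sub e \<subseteq> sub v"
  using anc_trans by (auto simp: sub_def)

lemma self_in_sub: "0 < v \<Longrightarrow> v < n \<Longrightarrow> v \<in> sub v"
  by (simp add: sub_def self_in_anc)

lemma sub_laminar: "sub u \<inter> sub v \<noteq> {} \<Longrightarrow> u \<in> sub v \<or> v \<in> sub u"
  using anc_chain anc_bounds by (fastforce simp: sub_def)

definition inc :: "nat \<Rightarrow> nat set" where
  "inc x = {e. 0 < e \<and> e < n \<and> x \<in> {e, par e}}"

text \<open>The path from \<open>a\<close> to the root has odd degree exactly at its two ends; for
  \<open>a = 0\<close> the two corrections cancel.\<close>

lemma even_inc_anc: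
  "a < n \<Longrightarrow> even (card (inc x \<inter> anc a) + of_bool (x = a) + of_bool (x = 0))"
proof (induction rule: tree_induct)
  case root
  then show ?case by auto
next
  case (step a)
  have "par a \<noteq> a" using lev_par[of a] step by auto
  moreover have "card (inc x \<inter> anc a) = of_bool (a \<in> inc x) + card (inc x \<inter> anc (par a))"
    using step not_in_anc_par[of a] finite_anc[of "par a"] par_lt[of a]
    by (auto simp: anc_step Int_insert_right)
  moreover have "a \<in> inc x \<longleftrightarrow> x = a \<or> x = par a" using step by (auto simp: inc_def)
  ultimately show ?case using step by (auto split: if_splits)
qed

lemma even_card_symdiff:
  assumes "finite A" "finite B"
  shows "even (card ((A - B) \<union> (B - A))) \<longleftrightarrow> even (card A + card B)"
proof -
  have "card ((A - B) \<union> (B - A)) = card (A - B) + card (B - A)"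
    using assms by (intro card_Un_disjoint) auto
  moreover have "card A = card (A - B) + card (A \<inter> B)" "card B = card (B - A) + card (A \<inter> B)"
    using assms by (metis card_Int_Diff add.commute Int_commute)+
  ultimately show ?thesis by auto
qed

lemma even_inc_pth:
  assumes "a < n" "b < n" "a \<noteq> b"
  shows "even (card (inc x \<inter> pth a b) + of_bool (x \<in> {a, b}))"
proof -
  have "inc x \<inter> pth a b = (inc x \<inter> anc a - inc x \<inter> anc b) \<union> (inc x \<inter> anc b - inc x \<inter> anc a)"
    by (auto simp: pth_def)
  then have "even (card (inc x \<inter> pth a b)) \<longleftrightarrow> even (card (inc x \<inter> anc a) + card (inc x \<inter> anc b))"
    using even_card_symdiff[of "inc x \<inter> anc a" "inc x \<inter> anc b"] finite_anc assms by simp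
  then show ?thesis using even_inc_anc[of a x] even_inc_anc[of b x] assms by (auto split: if_splits)
qed

section \<open>Degree parities of unions of tree paths\<close>

definition pe :: "nat \<times> nat \<Rightarrow> nat set" where
  "pe f = pth (fst f) (snd f)"

text \<open>The symmetric difference of the tree paths of the pairs in \<open>A\<close>, that is,
  the T-join inside the tree for the odd-degree vertices of \<open>A\<close>.\<close>

definition oddcov :: "(nat \<times> nat) set \<Rightarrow> nat set" where
  "oddcov A = {e. odd (card {f \<in> A. e \<in> pe f})}"

definition prs :: "(nat \<times> nat) set" where
  "prs = {(x, y). x < n \<and> y < n \<and> x \<noteq> y}"

lemma finite_prs: "finite prs"
  by (rule finite_subset[of _ "{..<n} \<times> {..<n}"]) (auto simp: prs_def)

lemma pe_bounds: "f \<in> prs \<Longrightarrow> pe f \<subseteq> {1..<n}"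
proof
  fix e assume f: "f \<in> prs" and "e \<in> pe f"
  then have "e \<in> anc (fst f) \<or> e \<in> anc (snd f)" by (auto simp: pe_def pth_def)
  moreover have "fst f < n" "snd f < n" using f by (auto simp: prs_def)
  ultimately have "0 < e \<and> e < n" using anc_bounds by blast
  then show "e \<in> {1..<n}" by simp
qed

lemma oddcov_insert:
  assumes "finite A" "f \<notin> A"
  shows "oddcov (insert f A) = (oddcov A - pe f) \<union> (pe f - oddcov A)"
proof -
  have "{g \<in> insert f A. e \<in> pe g} = (if e \<in> pe f then insert f {g \<in> A. e \<in> pe g} else {g \<in> A. e \<in> pe g})" for e
    by auto
  then show ?thesis using assms by (auto simp: oddcov_def)
qed

lemma oddcov_empty [simp]: "oddcov {} = {}"
  by (simp add: oddcov_def)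

lemma oddcov_bounds: "A \<subseteq> prs \<Longrightarrow> oddcov A \<subseteq> {1..<n}"
proof
  fix e assume A: "A \<subseteq> prs" and "e \<in> oddcov A"
  then have "{f \<in> A. e \<in> pe f} \<noteq> {}" by (force simp: oddcov_def)
  then show "e \<in> {1..<n}" using A pe_bounds by blast
qed

lemma even_inc_oddcov:
  assumes "A \<subseteq> prs"
  shows "even (card (inc x \<inter> oddcov A) + card {f \<in> A. x \<in> {fst f, snd f}})"
proof -
  have "finite A" using assms finite_prs finite_subset by blast
  then show ?thesis using assms
  proof (induction A rule: finite_induct)
    case (insert f A)
    have fin: "finite (inc x)" by (simp add: inc_def)
    have "inc x \<inter> oddcov (insert f A) = (inc x \<inter> oddcov A - inc x \<inter> pe f) \<union> (inc x \<inter> pe f - inc x \<inter> oddcov A)"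
      using oddcov_insert insert by blast
    then have 1: "even (card (inc x \<inter> oddcov (insert f A))) \<longleftrightarrow> even (card (inc x \<inter> oddcov A) + card (inc x \<inter> pe f))"
      using even_card_symdiff[of "inc x \<inter> oddcov A" "inc x \<inter> pe f"] fin by simp
    have 2: "even (card (inc x \<inter> pe f) + of_bool (x \<in> {fst f, snd f}))"
      using even_inc_pth[of "fst f" "snd f" x] insert.prems by (auto simp: prs_def pe_def)
    have "{g \<in> insert f A. x \<in> {fst g, snd g}} = (if x \<in> {fst f, snd f} then insert f {g \<in> A. x \<in> {fst g, snd g}} else {g \<in> A. x \<in> {fst g, snd g}})"
      by auto
    then have 3: "card {g \<in> insert f A. x \<in> {fst g, snd g}} = of_bool (x \<in> {fst f, snd f}) + card {g \<in> A. x \<in> {fst g, snd g}}"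
      using insert.hyps by auto
    show ?case using 1 2 3 insert by auto
  qed simp
qed

lemma sum_Pow_insert:
  fixes g :: "'a set \<Rightarrow> 'b::comm_monoid_add"
  assumes "finite F" "f \<notin> F"
  shows "sum g (Pow (insert f F)) = (\<Sum>A\<in>Pow F. g A + g (insert f A))"
proof -
  have "sum g (Pow (insert f F)) = sum g (Pow F) + sum g (insert f ` Pow F)"
    unfolding Pow_insert using assms by (intro sum.union_disjoint) auto
  also have "sum g (insert f ` Pow F) = (\<Sum>A\<in>Pow F. g (insert f A))"
    using assms by (subst sum.reindex) (auto simp: inj_on_def o_def)
  finally show ?thesis by (simp add: sum.distrib)
qed

text \<open>Adding a pair whose path contains \<open>e\<close> flips the membership of
  \<open>e\<close>, so the subsets of \<open>F\<close> split into equal halves as soon as one such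
  pair exists. The factor 2 on the left avoids a division in the integers.\<close>

lemma sum_oddcov:
  assumes "finite F"
  shows "(\<Sum>A\<in>Pow F. 2 * of_bool (e \<in> oddcov A)) = (2::int) ^ card F * of_bool (e \<in> (\<Union>f\<in>F. pe f))"
  using assms
proof (induction F rule: finite_induct)
  case (insert f F)
  have fin: "A \<in> Pow F \<Longrightarrow> finite A \<and> f \<notin> A" for A using insert finite_subset by blast
  show ?case
  proof (cases "e \<in> pe f")
    case True
    have "2 * of_bool (e \<in> oddcov A) + 2 * of_bool (e \<in> oddcov (insert f A)) = (2::int)" if "A \<in> Pow F" for A
      using oddcov_insert[of A f] fin[OF that] True by (auto simp: of_bool_def)
    then have "(\<Sum>A\<in>Pow (insert f F). 2 * of_bool (e \<in> oddcov A)) = (\<Sum>A\<in>Pow F. (2::int))"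
      unfolding sum_Pow_insert[OF insert.hyps] by (intro sum.cong refl)
    then show ?thesis using insert True by (simp add: card_Pow)
  next
    case False
    have "2 * of_bool (e \<in> oddcov A) + 2 * of_bool (e \<in> oddcov (insert f A)) = (2 * (2 * of_bool (e \<in> oddcov A)) :: int)"
      if "A \<in> Pow F" for A
      using oddcov_insert[of A f] fin[OF that] False by (auto simp: of_bool_def)
    then have "(\<Sum>A\<in>Pow (insert f F). 2 * of_bool (e \<in> oddcov A)) = (\<Sum>A\<in>Pow F. 2 * (2 * of_bool (e \<in> oddcov A)) :: int)"
      unfolding sum_Pow_insert[OF insert.hyps] by (intro sum.cong refl)
    also have "\<dots> = 2 * (2 ^ card F * of_bool (e \<in> (\<Union>f\<in>F. pe f)))"
      using insert.IH by (simp only: sum_distrib_left[symmetric])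
    finally show ?thesis using insert False by (auto simp: of_bool_def)
  qed
qed simp

lemma sum_Pow_weights:
  assumes "finite F"
  shows "(\<Sum>A\<in>Pow F. 2 * (\<Sum>f\<in>A. g f)) = (2::int) ^ card F * (\<Sum>f\<in>F. g f)"
  using assms
proof (induction F rule: finite_induct)
  case (insert f F)
  have fin: "A \<in> Pow F \<Longrightarrow> finite A \<and> f \<notin> A" for A using insert finite_subset by blast
  have "(\<Sum>A\<in>Pow (insert f F). 2 * (\<Sum>f\<in>A. g f)) = (\<Sum>A\<in>Pow F. 2 * (2 * (\<Sum>f\<in>A. g f)) + 2 * g f)"
    using insert fin by (subst sum_Pow_insert) (auto intro!: sum.cong)
  also have "\<dots> = 2 * (2 ^ card F * (\<Sum>f\<in>F. g f)) + 2 ^ card F * (2 * g f)"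
    using insert by (simp add: sum.distrib sum_distrib_left[symmetric] card_Pow)
  finally show ?case using insert by (simp add: algebra_simps)
qed simp

lemma edeg_image: "finite I \<Longrightarrow> edeg (image_mset g (mset_set I)) x = card {i \<in> I. x \<in> g i}"
proof (induction I rule: finite_induct)
  case (insert i I)
  have "{j \<in> insert i I. x \<in> g j} = (if x \<in> g i then insert i {j \<in> I. x \<in> g j} else {j \<in> I. x \<in> g j})" by auto
  then show ?case using insert by auto
qed simp

end

section \<open>Tours from the doubled tree, and contraction\<close>

locale utree = ptree +
  fixes w :: "nat \<Rightarrow> nat \<Rightarrow> nat"
  assumes met: "pos_int_metric n w" and unit: "0 < v \<Longrightarrow> v < n \<Longrightarrow> w v (par v) = 1"
begin

text \<open>Double the tree, delete one copy of every edge in \<open>oddcov A\<close> and add the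
  pairs of \<open>A\<close>. Since \<open>oddcov A\<close> and \<open>A\<close> have the same degree
  parities, all degrees stay even, and the remaining full copy of the tree keeps the graph
  connected.\<close>

lemma TSP_le_oddcov:
  assumes A: "A \<subseteq> prs"
  shows "int (TSP n w) \<le> 2 * (int n - 1) - card (oddcov A) + (\<Sum>f\<in>A. int (w (fst f) (snd f)))"
proof -
  have finA: "finite A" using A finite_prs finite_subset by blast
  define te where "te e = {e, par e}" for e
  define N where "N = {e \<in> {1..<n}. e \<notin> oddcov A}"
  define E where "E = image_mset te (mset_set {1..<n}) + image_mset te (mset_set N)
    + image_mset (\<lambda>f. {fst f, snd f}) (mset_set A)"
  have finN: "finite N" by (simp add: N_def)
  have pne: "e \<noteq> par e" if "e \<in> {1..<n}" for e using lev_par[of e] that by auto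
  have "TSP n w \<le> (\<Sum>e\<in>#E. edge_weight w e)"
  proof (rule TSP_le_even_multigraph[OF met n0])
    show "\<forall>e\<in>#E. card e = 2"
      using pne A finA finN by (force simp: E_def te_def N_def prs_def card_insert_if)
    show "\<forall>e\<in>#E. e \<subseteq> {..<n}"
      using par_lt A finA finN by (auto simp: E_def te_def N_def prs_def)
    show "even (edeg E x)" for x
    proof -
      have 1: "{e \<in> {1..<n}. x \<in> te e} = inc x" by (auto simp: inc_def te_def)
      have 2: "{e \<in> N. x \<in> te e} = inc x - oddcov A" by (auto simp: inc_def te_def N_def)
      have "card (inc x) = card (inc x - oddcov A) + card (inc x \<inter> oddcov A)"
        by (metis card_Int_Diff add.commute finite_subset finite_atLeastLessThan 1 mem_Collect_eq subsetI)
      then show ?thesis using even_inc_oddcov[OF A, of x] finA finN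
        unfolding E_def edeg_add edeg_image[OF finA] edeg_image[OF finN] edeg_image[OF finite_atLeastLessThan] 1 2
        by auto
    qed
    show "(0, y) \<in> {(u, v). {u, v} \<in># E}\<^sup>*" if "y < n" for y
      using that
    proof (induction rule: tree_induct)
      case (step x)
      then have "{par x, x} \<in># E" by (auto simp: E_def te_def insert_commute)
      then show ?case using step by (meson rtrancl.rtrancl_into_rtrancl case_prodI mem_Collect_eq)
    qed simp
  qed
  also have "(\<Sum>e\<in>#E. edge_weight w e) = (\<Sum>e\<in>{1..<n}. edge_weight w (te e)) + (\<Sum>e\<in>N. edge_weight w (te e))
      + (\<Sum>f\<in>A. edge_weight w {fst f, snd f})"
    by (simp add: E_def sum_unfold_sum_mset image_mset.compositionality o_def)
  also have "(\<Sum>e\<in>{1..<n}. edge_weight w (te e)) = n - 1"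
  proof -
    have "edge_weight w (te e) = 1" if "e \<in> {1..<n}" for e
      using that unit[of e] w_sym[OF met, of e "par e"] par_lt[of e]
      by (auto simp: edge_weight_def te_def min_def max_def)
    then show ?thesis by simp
  qed
  also have "(\<Sum>e\<in>N. edge_weight w (te e)) = card N"
  proof -
    have "edge_weight w (te e) = 1" if "e \<in> N" for e
      using that unit[of e] w_sym[OF met, of e "par e"] par_lt[of e]
      by (auto simp: edge_weight_def te_def min_def max_def N_def)
    then show ?thesis by simp
  qed
  also have "(\<Sum>f\<in>A. edge_weight w {fst f, snd f}) = (\<Sum>f\<in>A. w (fst f) (snd f))"
    using A w_sym[OF met] by (intro sum.cong) (auto simp: edge_weight_def min_def max_def prs_def)
  finally have "TSP n w \<le> n - 1 + card N + (\<Sum>f\<in>A. w (fst f) (snd f))" .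
  moreover have "card N + card (oddcov A) = n - 1"
  proof -
    have "{1..<n} = N \<union> oddcov A" "N \<inter> oddcov A = {}" using oddcov_bounds[OF A] by (auto simp: N_def)
    then have "card {1..<n} = card N + card (oddcov A)"
      using finN oddcov_bounds[OF A] by (metis card_Un_disjoint finite_atLeastLessThan finite_subset)
    then show ?thesis by simp
  qed
  ultimately have "int (TSP n w) \<le> int (n - 1 + card N + (\<Sum>f\<in>A. w (fst f) (snd f)))"
    "int (card N) = int n - 1 - int (card (oddcov A))" using n0 by (simp_all only: of_nat_le_iff)
  then show ?thesis using n0 by (simp add: of_nat_diff)
qed

text \<open>Averaging over all \<open>A \<subseteq> F\<close>: a covered tree edge lies in \<open>oddcov A\<close> for exactly
  half of the \<open>A\<close>.\<close>

lemma TSP_le_cover_advantage: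
  assumes F: "F \<subseteq> prs"
  shows "2 * int (TSP n w) \<le> 4 * (int n - 1) - card (\<Union>f\<in>F. pe f) + (\<Sum>f\<in>F. int (w (fst f) (snd f)))"
proof -
  have finF: "finite F" using F finite_prs finite_subset by blast
  define cov where "cov = (\<Union>f\<in>F. pe f)"
  define h where "h A = 2 * int (card (oddcov A)) - 2 * (\<Sum>f\<in>A. int (w (fst f) (snd f)))" for A
  have covb: "cov \<subseteq> {1..<n}" using F pe_bounds by (auto simp: cov_def)
  have card_b: "int (card S) = (\<Sum>e\<in>{1..<n}. of_bool (e \<in> S))" if "S \<subseteq> {1..<n}" for S
  proof -
    have "{Suc 0..<n} \<inter> S = S" using that by auto
    then show ?thesis by simp
  qed
  have "(\<Sum>A\<in>Pow F. 2 * int (card (oddcov A))) = (\<Sum>A\<in>Pow F. \<Sum>e\<in>{1..<n}. 2 * of_bool (e \<in> oddcov A))"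
  proof (intro sum.cong refl)
    fix A assume "A \<in> Pow F"
    then have "oddcov A \<subseteq> {1..<n}" using F oddcov_bounds by auto
    from card_b[OF this] show "2 * int (card (oddcov A)) = (\<Sum>e\<in>{1..<n}. 2 * of_bool (e \<in> oddcov A))"
      by (simp only: sum_distrib_left)
  qed
  also have "\<dots> = (\<Sum>e\<in>{1..<n}. \<Sum>A\<in>Pow F. 2 * of_bool (e \<in> oddcov A))" by (rule sum.swap)
  also have "\<dots> = 2 ^ card F * int (card cov)"
    by (simp only: sum_oddcov[OF finF] cov_def[symmetric] card_b[OF covb] sum_distrib_left)
  finally have "(\<Sum>A\<in>Pow F. h A) = 2 ^ card F * (int (card cov) - (\<Sum>f\<in>F. int (w (fst f) (snd f))))"
    unfolding h_def by (simp add: sum_subtractf sum_Pow_weights[OF finF] algebra_simps)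
  moreover have "\<exists>A\<in>Pow F. h A \<ge> c" if "(\<Sum>A\<in>Pow F. h A) = 2 ^ card F * c" for c
  proof (rule ccontr)
    assume "\<not> ?thesis"
    then have "(\<Sum>A\<in>Pow F. h A) < (\<Sum>A\<in>Pow F. c)" using finF by (intro sum_strict_mono) (auto simp: not_le)
    then show False using that finF by (simp add: card_Pow)
  qed
  ultimately obtain A where A: "A \<subseteq> F" "h A \<ge> int (card cov) - (\<Sum>f\<in>F. int (w (fst f) (snd f)))" by blast
  then have "A \<subseteq> prs" using F by blast
  from TSP_le_oddcov[OF this] A(2) show ?thesis unfolding h_def cov_def by linarith
qed

text \<open>A maximiser \<open>F\<close> of \<open>|cov F| - (23/22) w(F)\<close> covers few edges, and by maximality no single
  further pair covers more than \<open>23/22\<close> times its weight.\<close>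

lemma tree_metric_contraction:
  assumes "(2 - \<epsilon>) * real n < real (TSP n w)"
  obtains Z where "Z \<subseteq> {1..<n}" "real (card Z) \<le> 46 * \<epsilon> * real n"
    "\<And>x y. x < n \<Longrightarrow> y < n \<Longrightarrow> real (card (pth x y - Z)) \<le> 23/22 * real (w x y)"
proof -
  define wt where "wt F = (\<Sum>f\<in>F. real (w (fst f) (snd f)))" for F :: "(nat \<times> nat) set"
  define cov where "cov F = (\<Union>f\<in>F. pe f)" for F
  define g where "g F = real (card (cov F)) - 23/22 * wt F" for F
  have "finite (g ` Pow prs)" "g ` Pow prs \<noteq> {}" using finite_prs by auto
  then have "Max (g ` Pow prs) \<in> g ` Pow prs" and mx0: "\<And>F'. F' \<subseteq> prs \<Longrightarrow> g F' \<le> Max (g ` Pow prs)"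
    by auto
  then obtain F where F: "F \<subseteq> prs" and "Max (g ` Pow prs) = g F" by auto
  with mx0 have mx: "\<And>F'. F' \<subseteq> prs \<Longrightarrow> g F' \<le> g F" by metis
  have finF: "finite F" using F finite_prs finite_subset by blast
  have covb: "cov F \<subseteq> {1..<n}" using F pe_bounds by (auto simp: cov_def)
  then have fc: "finite (cov F)" using finite_subset by blast
  have "g {} \<le> g F" by (rule mx) simp
  then have g0: "23/22 * wt F \<le> card (cov F)" by (simp add: g_def wt_def cov_def)
  have "2 * real (TSP n w) \<le> 4 * (real n - 1) - card (cov F) + wt F"
  proof -
    have "real_of_int (2 * int (TSP n w)) \<le> real_of_int (4 * (int n - 1) - card (cov F) + (\<Sum>f\<in>F. int (w (fst f) (snd f))))"
      using TSP_le_cover_advantage[OF F] unfolding cov_def of_int_le_iff .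
    then show ?thesis by (simp add: wt_def)
  qed
  \<comment> \<open>Since \<open>wt F\<close> is at most \<open>22/23 * card (cov F)\<close>, the
    previous inequality gives
    \<open>card (cov F) / 23 <= 4 * n - 2 * TSP < 2 * \<epsilon> * n\<close>.\<close>
  then have "real (card (cov F)) \<le> 46 * \<epsilon> * real n" using assms g0 by (simp add: algebra_simps)
  moreover have "real (card (pth x y - cov F)) \<le> 23/22 * real (w x y)" if "x < n" "y < n" for x y
  proof (cases "x = y \<or> (x, y) \<in> F")
    case True
    then have e: "pth x y - cov F = {}" by (auto simp: pth_def cov_def pe_def)
    show ?thesis unfolding e by simp
  next
    case False
    then have F': "insert (x, y) F \<subseteq> prs" using F that by (auto simp: prs_def)
    have "cov (insert (x, y) F) = cov F \<union> (pth x y - cov F)" by (auto simp: cov_def pe_def)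
    then have "card (cov (insert (x, y) F)) = card (cov F) + card (pth x y - cov F)"
      using fc finite_pth[OF that] by (subst card_Un_disjoint[symmetric]) auto
    moreover have "wt (insert (x, y) F) = wt F + w x y" using finF False by (simp add: wt_def)
    ultimately show ?thesis using mx[OF F'] by (simp add: g_def algebra_simps)
  qed
  ultimately show ?thesis using that[of "cov F"] covb by auto
qed

end

text \<open>Root \<open>T\<close> at 0: \<open>lev\<close> is the distance from 0 in
  \<open>T\<close>, and the parent of \<open>v\<close> is its predecessor on a shortest walk from
  0.\<close>

lemma promise_imp_utree:
  assumes "promise n w" "0 < n"
  obtains par lev where "utree n par lev w"
proof -
  obtain T where T: "minimum_spanning_tree n w T" "\<forall>(u,v)\<in>T. w u v = 1" and met: "pos_int_metric n w"
    using assms by (auto simp: promise_def)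
  define G where "G = T \<union> T\<inverse>"
  have st: "spanning_tree n T" using T by (simp add: minimum_spanning_tree_def)
  have GT: "u < n \<and> v < n \<and> w u v = 1" if "(u, v) \<in> G" for u v
  proof -
    have "(u, v) \<in> T \<or> (v, u) \<in> T" using that by (auto simp: G_def)
    then have "u < n \<and> v < n \<and> (w u v = 1 \<or> w v u = 1)"
      using st T(2) by (fastforce simp: spanning_tree_def)
    then show ?thesis using w_sym[OF met] by metis
  qed
  define lev where "lev v = (LEAST k. (0, v) \<in> G ^^ k)" for v
  have ex: "\<exists>k. (0, v) \<in> G ^^ k" if "v < n" for v
  proof -
    have "(0, v) \<in> G\<^sup>*" using st that assms by (auto simp: spanning_tree_def G_def)
    then show ?thesis by (meson rtrancl_imp_relpow)
  qed
  have "\<exists>u. (u, v) \<in> G \<and> lev u < lev v" if vn: "0 < v" "v < n" for v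
  proof -
    have L: "(0, v) \<in> G ^^ lev v" unfolding lev_def using ex[OF vn(2)] by (rule LeastI_ex)
    then obtain k where k: "lev v = Suc k" using vn by (cases "lev v") auto
    then obtain u where u: "(0, u) \<in> G ^^ k" "(u, v) \<in> G" using L by auto
    have "lev u \<le> k" unfolding lev_def using u(1) by (rule Least_le)
    then show ?thesis using u k by auto
  qed
  then obtain f where f: "\<And>v. 0 < v \<Longrightarrow> v < n \<Longrightarrow> (f v, v) \<in> G \<and> lev (f v) < lev v" by metis
  define par where "par v = (if v = 0 then 0 else f v)" for v
  have "utree n par lev w"
    using f GT met assms w_sym[OF met] by unfold_locales (auto simp: par_def, metis GT)
  then show ?thesis by (rule that)
qed

section \<open>Dead ends\<close>

definition cnext :: "nat \<Rightarrow> nat \<Rightarrow> nat" where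
  "cnext n i = Suc i mod n"

text \<open>Twice the part of a tour charged to \<open>X\<close>, where every tour edge splits its weight evenly
  between its two endpoints.\<close>

definition tshare :: "nat \<Rightarrow> (nat \<Rightarrow> nat \<Rightarrow> nat) \<Rightarrow> (nat \<Rightarrow> nat) \<Rightarrow> nat set \<Rightarrow> nat" where
  "tshare n w p X = (\<Sum>i<n. (of_bool (p i \<in> X) + of_bool (p (cnext n i) \<in> X)) * w (p i) (p (cnext n i)))"

text \<open>\<open>X\<close> is the side of \<open>v\<close> of a bridge \<open>{v, u}\<close> of the unit-weight graph, and every tour exceeds the
  bound \<open>|X|\<close> on its cost charged to \<open>X\<close> by a factor of at least \<open>1 + 1/20\<close>.\<close>

definition dead_side :: "nat \<Rightarrow> (nat \<Rightarrow> nat \<Rightarrow> nat) \<Rightarrow> nat \<Rightarrow> nat \<Rightarrow> nat \<Rightarrow> nat set \<Rightarrow> bool" where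
  "dead_side n w \<sigma> v u X \<longleftrightarrow> v \<in> X \<and> X \<subseteq> {..<n} \<and> u < n \<and> u \<notin> X \<and> w v u = 1 \<and> card X \<le> \<sigma> \<and>
     (\<forall>x\<in>X. (v, x) \<in> {(a, b). a \<in> X \<and> b \<in> X \<and> w a b = 1}\<^sup>*) \<and>
     (\<forall>x\<in>X. \<forall>z<n. z \<notin> X \<longrightarrow> w x z = 1 \<longrightarrow> x = v \<and> z = u) \<and>
     (\<forall>p. p permutes {..<n} \<longrightarrow> 21 * card X \<le> 10 * tshare n w p X)"

definition dead :: "nat \<Rightarrow> (nat \<Rightarrow> nat \<Rightarrow> nat) \<Rightarrow> nat \<Rightarrow> nat \<Rightarrow> bool" where
  "dead n w \<sigma> v \<longleftrightarrow> (\<exists>u X. dead_side n w \<sigma> v u X)"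

definition crossing :: "nat \<Rightarrow> (nat \<Rightarrow> nat) \<Rightarrow> nat set \<Rightarrow> nat set" where
  "crossing n p Y = {i. i < n \<and> (p i \<in> Y) \<noteq> (p (cnext n i) \<in> Y)}"

lemma cnext_if: "i < n \<Longrightarrow> cnext n i = (if Suc i = n then 0 else Suc i)"
  by (simp add: cnext_def)

lemma cnext_lt: "i < n \<Longrightarrow> cnext n i < n"
  by (simp add: cnext_def)

lemma perm_lt: "p permutes {..<n} \<Longrightarrow> i < n \<Longrightarrow> p i < n"
  using permutes_in_image[of p "{..<n}" i] by simp

lemma bij_cnext: "bij_betw (cnext n) {..<n} {..<n}"
proof -
  have "inj_on (cnext n) {..<n}"
    by (rule inj_onI) (auto simp: cnext_def mod_Suc split: if_splits)
  moreover have "cnext n ` {..<n} \<subseteq> {..<n}" using cnext_lt by auto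
  ultimately show ?thesis unfolding bij_betw_def by (metis card_image card_lessThan card_subset_eq finite_lessThan)
qed

lemma cyclic_closed:
  assumes "i0 < n" "P i0" "\<And>i. i < n \<Longrightarrow> P i \<Longrightarrow> P (cnext n i)" "j < n"
  shows "P j"
proof -
  have up: "P k" if "i \<le> k" "k < n" "P i" for i k
    using that(1,2)
  proof (induction k rule: dec_induct)
    case base
    then show ?case using that by simp
  next
    case (step m)
    then have "P (cnext n m)" using assms(3) by simp
    then show ?case using step by (simp add: cnext_def)
  qed
  have "P (n - 1)" using up[of i0 "n - 1"] assms by simp
  then have "P (cnext n (n - 1))" using assms by (intro assms(3)) auto
  then have "P 0" using assms(1) by (simp add: cnext_def)
  then show ?thesis using up[of 0 j] assms by simp
qed

lemma card_crossing_ge: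
  assumes p: "p permutes {..<n}" and Y: "Y \<noteq> {}" "Y \<subset> {..<n}"
  shows "2 \<le> card (crossing n p Y)"
proof -
  have surj: "\<exists>i<n. p i = y" if "y < n" for y
    using permutes_image[OF p] that by (metis imageE lessThan_iff)
  obtain a b where a: "a < n" "p a \<in> Y" and b: "b < n" "p b \<notin> Y"
    using Y surj by (metis lessThan_iff psubsetE subset_eq subsetI ex_in_conv)
  have "\<exists>i<n. p i \<in> Y \<and> p (cnext n i) \<notin> Y"
    using cyclic_closed[of a n "\<lambda>i. p i \<in> Y" b] a b by blast
  moreover have "\<exists>i<n. p i \<notin> Y \<and> p (cnext n i) \<in> Y"
    using cyclic_closed[of b n "\<lambda>i. p i \<notin> Y" a] a b by blast
  ultimately obtain i j where "i < n" "j < n" "p i \<in> Y" "p (cnext n i) \<notin> Y" "p j \<notin> Y" "p (cnext n j) \<in> Y"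
    by auto
  then have "{i, j} \<subseteq> crossing n p Y" "i \<noteq> j" by (auto simp: crossing_def)
  moreover have "finite (crossing n p Y)" by (simp add: crossing_def)
  ultimately show ?thesis by (metis card_2_iff card_mono)
qed

section \<open>Unit edges after contracting \<open>Z\<close>\<close>

locale ctree = utree +
  fixes Z :: "nat set"
  assumes Z: "Z \<subseteq> {1..<n}"
    and contr: "x < n \<Longrightarrow> y < n \<Longrightarrow> real (card (pth x y - Z)) \<le> 23/22 * real (w x y)"
begin

definition W :: "nat set" where
  "W = Z \<union> par ` Z"

text \<open>These are the leaves hanging on \<open>W\<close>, not the high-degree vertices
  themselves. The argument charges no tour loss to them, because all their unit neighbours lie in
  \<open>W\<close> and there may be several.\<close>

definition hub :: "nat set" where
  "hub = {v. 0 < v \<and> v < n \<and> v \<notin> W \<and> par v \<in> W \<and> (\<forall>c. 0 < c \<longrightarrow> c < n \<longrightarrow> par c \<noteq> v)}"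

lemma finite_Z: "finite Z"
  using Z finite_subset by blast

lemma finite_W: "finite W"
  by (simp add: W_def finite_Z)

lemma W_lt: "W \<subseteq> {..<n}"
  using Z par_lt by (auto simp: W_def)

lemma card_W: "card W \<le> 2 * card Z"
  using card_Un_le[of Z "par ` Z"] card_image_le[OF finite_Z, of par] by (simp add: W_def)

lemma finite_hub: "finite hub"
  by (simp add: hub_def)

text \<open>Two uncontracted edges on the path would force \<open>2 <= 23/22\<close>.\<close>

lemma unit_pth:
  assumes "x < n" "y < n" "w x y = 1" "e \<in> pth x y - Z" "e' \<in> pth x y - Z"
  shows "e = e'"
proof (rule ccontr)
  assume "e \<noteq> e'"
  then have "card {e, e'} = 2" by simp
  moreover have "card {e, e'} \<le> card (pth x y - Z)"
    using assms finite_pth by (intro card_mono) auto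
  moreover have "real (card (pth x y - Z)) \<le> 23/22" using contr[of x y] assms by simp
  ultimately show False by simp
qed

lemma child_towards:
  "y < n \<Longrightarrow> u = 0 \<or> u \<in> anc y \<Longrightarrow> u \<noteq> y \<Longrightarrow> \<exists>c. 0 < c \<and> c < n \<and> par c = u \<and> c \<in> anc y"
proof (induction rule: tree_induct)
  case (step y)
  show ?case
  proof (cases "par y = u")
    case True
    then show ?thesis using step self_in_anc by auto
  next
    case False
    then show ?thesis using step by (auto simp: anc_step)
  qed
qed auto

lemma child_not_anc: "0 < c \<Longrightarrow> c < n \<Longrightarrow> c \<notin> anc (par c)"
  by (rule not_in_anc_par)

lemma pth_end:
  assumes "x < n" "y < n" "x \<noteq> y"
  obtains e where "e \<in> pth x y" "e = x \<or> par e = x"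
proof (cases "x = 0 \<or> x \<in> anc y")
  case True
  then obtain c where "0 < c" "c < n" "par c = x" "c \<in> anc y" using child_towards[of y x] assms by auto
  then show ?thesis using that[of c] child_not_anc[of c] by (auto simp: pth_def)
next
  case False
  then show ?thesis using that[of x] self_in_anc[of x] by (auto simp: pth_def)
qed

lemma pth_commute: "pth x y = pth y x"
  by (auto simp: pth_def)

lemma not_W_end: "x \<notin> W \<Longrightarrow> e = x \<or> par e = x \<Longrightarrow> e \<notin> Z"
  by (auto simp: W_def)

text \<open>The path between two vertices outside \<open>W\<close> starts and ends with uncontracted
  edges; by \<open>unit_pth\<close> these are one and the same edge.\<close>

lemma unit_not_W:
  assumes "x < n" "y < n" "x \<noteq> y" "w x y = 1" "x \<notin> W" "y \<notin> W"
  shows "par x = y \<or> par y = x"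
proof -
  obtain e where e: "e \<in> pth x y" "e = x \<or> par e = x" using pth_end assms by blast
  obtain e' where e': "e' \<in> pth y x" "e' = y \<or> par e' = y" using pth_end assms by metis
  have "e = e'" using unit_pth[of x y e e'] e e' assms not_W_end pth_commute by auto
  then show ?thesis using e e' assms by auto
qed

lemma hub_nbrs:
  assumes "v \<in> hub" "y < n" "y \<noteq> v" "w v y = 1"
  shows "y \<in> W"
proof (rule ccontr)
  assume "y \<notin> W"
  then have "par v = y \<or> par y = v" using assms by (intro unit_not_W) (auto simp: hub_def)
  then show False using assms \<open>y \<notin> W\<close> par_0 by (cases "y = 0") (auto simp: hub_def)
qed

text \<open>A unit edge leaving \<open>sub v\<close> has \<open>v\<close> as the only uncontracted
  edge on its path. If it did not join \<open>v\<close> to \<open>par v\<close>, the path would go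
  on beyond \<open>v\<close> or beyond \<open>par v\<close> by an edge at that vertex, which is
  uncontracted because the vertex avoids \<open>W\<close>.\<close>

lemma bridge:
  assumes v: "0 < v" "v < n" "v \<notin> W" "par v \<notin> W" and x: "x \<in> sub v" and y: "y < n" "y \<notin> sub v" and 1: "w x y = 1"
  shows "x = v \<and> y = par v"
proof -
  have xn: "x < n" and vx: "v \<in> anc x" using x by (auto simp: sub_def)
  have vy: "v \<notin> anc y" using y by (auto simp: sub_def)
  have vp: "v \<in> pth x y - Z" using vx vy v by (auto simp: pth_def W_def)
  have xv: "x = v"
  proof (rule ccontr)
    assume "x \<noteq> v"
    then obtain c where c: "0 < c" "c < n" "par c = v" "c \<in> anc x" using child_towards[of x v] vx xn by auto
    have "c \<notin> anc y" using vy anc_trans[of y c] c y self_in_anc[of c] anc_step[of c] self_in_anc[of v] v by auto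
    then have "c \<in> pth x y - Z" using c v by (auto simp: pth_def W_def)
    then have "c = v" using unit_pth[OF xn y(1) 1] vp by blast
    then show False using c lev_par[of c] by auto
  qed
  moreover have "y = par v"
  proof (rule ccontr)
    assume "y \<noteq> par v"
    then obtain e where e: "e \<in> pth (par v) y" "e = par v \<or> par e = par v"
      using pth_end[of "par v" y] par_lt[OF v(2)] y by auto
    have "v \<notin> anc (par v)" using v by (simp add: not_in_anc_par)
    then have "e \<noteq> v" using e vy by (auto simp: pth_def)
    then have "e \<in> pth x y" using e v by (auto simp: xv pth_def anc_step)
    then have "e \<in> pth x y - Z" using e v not_W_end by auto
    then have "e = v" using unit_pth[OF xn y(1) 1] vp by blast
    then show False using \<open>e \<noteq> v\<close> by simp
  qed
  ultimately show ?thesis by simp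
qed

lemma sub_connected:
  assumes v: "0 < v" "v < n" and x: "x \<in> sub v"
  shows "(v, x) \<in> {(a, b). a \<in> sub v \<and> b \<in> sub v \<and> w a b = 1}\<^sup>*"
proof -
  have "x < n" using x by (simp add: sub_def)
  then show ?thesis using x
  proof (induction rule: tree_induct)
    case root
    then show ?case by (simp add: sub_def)
  next
    case (step x)
    show ?case
    proof (cases "x = v")
      case False
      then have "par x \<in> sub v" using step par_lt by (auto simp: sub_def anc_step)
      moreover have "w (par x) x = 1" using unit[of x] step w_sym[OF met, of x "par x"] par_lt by auto
      ultimately show ?thesis using step by (auto intro: rtrancl.rtrancl_into_rtrancl)
    qed simp
  qed
qed

end

section \<open>The loss of a tour on one subtree\<close>

locale ctour = ctree +
  fixes v :: nat and p :: "nat \<Rightarrow> nat"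
  assumes v: "0 < v" "v < n" "v \<notin> W" and p: "p permutes {..<n}"
begin

abbreviation "X \<equiv> sub v"

text \<open>The cost of the cut at \<open>e\<close>, weighted to match \<open>tshare\<close>: a
  crossing inside \<open>X\<close> counts twice and one that leaves \<open>X\<close> once. The
  minimum is 2, and \<open>val e - 2\<close> is the excess exploited below.\<close>

definition val :: "nat \<Rightarrow> nat" where
  "val e = (\<Sum>i\<in>crossing n p (sub e). of_bool (p i \<in> X) + of_bool (p (cnext n i) \<in> X))"

definition B :: "nat set" where
  "B = {e \<in> X. val e < 3}"

lemma p_lt: "i < n \<Longrightarrow> p i < n"
  using perm_lt[OF p] .

lemma X_pos: "e \<in> X \<Longrightarrow> 0 < e \<and> e < n"
  using v by (cases "e = 0") (auto simp: sub_def)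

lemma sub_proper: "0 < e \<Longrightarrow> e < n \<Longrightarrow> sub e \<noteq> {} \<and> sub e \<subset> {..<n}"
proof -
  assume e: "0 < e" "e < n"
  have "0 \<notin> sub e" by (simp add: sub_def)
  then show ?thesis using e sub_subset[of e] self_in_sub[of e] n0 by blast
qed

lemma finite_crossing: "finite (crossing n p Y)"
  by (simp add: crossing_def)

lemma card_crossing_sub: "e \<in> X \<Longrightarrow> 2 \<le> card (crossing n p (sub e))"
  using card_crossing_ge[OF p, of "sub e"] sub_proper[of e] X_pos[of e] by auto

lemma coeff_ge: "e \<in> X \<Longrightarrow> i \<in> crossing n p (sub e) \<Longrightarrow> 1 \<le> (of_bool (p i \<in> X) + of_bool (p (cnext n i) \<in> X) :: nat)"
  using sub_mono[of e v] by (auto simp: crossing_def)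

lemma val_ge_card: "e \<in> X \<Longrightarrow> card (crossing n p (sub e)) \<le> val e"
  unfolding val_def card_eq_sum by (intro sum_mono coeff_ge)

lemma val_ge_2: "e \<in> X \<Longrightarrow> 2 \<le> val e"
  using val_ge_card card_crossing_sub le_trans by blast

text \<open>At least two crossings exist, so a value of 2 leaves weight one for each; a crossing
  inside \<open>X\<close> would weigh two.\<close>

lemma B_no_inner:
  assumes "e \<in> B" "i \<in> crossing n p (sub e)"
  shows "\<not> (p i \<in> X \<and> p (cnext n i) \<in> X)"
proof
  assume both: "p i \<in> X \<and> p (cnext n i) \<in> X"
  have e: "e \<in> X" "val e < 3" using assms by (auto simp: B_def)
  let ?C = "crossing n p (sub e)"
  have "val e = 2 + (\<Sum>i\<in>?C - {i}. of_bool (p i \<in> X) + of_bool (p (cnext n i) \<in> X))"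
    unfolding val_def using both assms(2) finite_crossing by (subst sum.remove[of _ i]) auto
  moreover have "(\<Sum>i\<in>?C - {i}. of_bool (p i \<in> X) + of_bool (p (cnext n i) \<in> X)) \<ge> (\<Sum>i\<in>?C - {i}. 1::nat)"
    using coeff_ge[OF e(1)] by (intro sum_mono) auto
  moreover have "card (?C - {i}) \<ge> 1" using card_crossing_sub[OF e(1)] assms(2) finite_crossing by simp
  ultimately show False using e(2) by simp
qed

definition Bch :: "nat \<Rightarrow> nat set" where
  "Bch e = {c \<in> B. par c = e}"

lemma finite_Bch: "finite (Bch e)"
  using finite_sub[of v] by (simp add: Bch_def B_def)

text \<open>A subtree in \<open>B\<close> is a single piece of the tour entered and left from outside \<open>X\<close>, so its two
  exits also cross the parent edge, and the rest of the parent's subtree needs two more.\<close>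

lemma val_parent:
  assumes e: "e \<in> X"
  shows "2 * card (Bch e) + 2 \<le> val e"
proof -
  define Y where "Y = sub e - (\<Union>c\<in>Bch e. sub c)"
  have eb: "0 < e" "e < n" using X_pos[OF e] by auto
  have ch: "0 < c \<and> c < n \<and> c \<in> X \<and> c \<in> B \<and> par c = e \<and> sub c \<subseteq> sub e" if "c \<in> Bch e" for c
  proof -
    have c: "c \<in> X" "c \<in> B" "par c = e" using that by (auto simp: Bch_def B_def)
    then have "0 < c" "c < n" using X_pos by auto
    moreover have "c \<in> sub e" using c \<open>0 < c\<close> \<open>c < n\<close> eb self_in_anc[of e] by (simp add: sub_def anc_step)
    ultimately show ?thesis using c sub_mono by blast
  qed
  have "e \<notin> sub c" if "c \<in> Bch e" for c
    using ch[OF that] child_not_anc[of c] by (auto simp: sub_def)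
  then have eY: "e \<in> Y" using self_in_sub[OF eb] by (auto simp: Y_def)
  have "Y \<subset> {..<n}" using sub_proper[OF eb] by (auto simp: Y_def)
  then have cY: "2 \<le> card (crossing n p Y)" using card_crossing_ge[OF p] eY by blast
  have eX: "sub e \<subseteq> X" using e sub_mono by blast
  have sibl: "sub c \<inter> sub c' = {}" if cc: "c \<in> Bch e" "c' \<in> Bch e" "c \<noteq> c'" for c c'
  proof (rule ccontr)
    assume "sub c \<inter> sub c' \<noteq> {}"
    then have "c \<in> sub c' \<or> c' \<in> sub c" by (rule sub_laminar)
    then have "c' \<in> anc c \<or> c \<in> anc c'" by (auto simp: sub_def)
    then have "c' \<in> anc e \<or> c \<in> anc e" using ch[OF cc(1)] ch[OF cc(2)] cc(3) anc_step by auto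
    then show False using ch[OF cc(1)] ch[OF cc(2)] child_not_anc by metis
  qed
  have cr1: "(p i \<in> sub c \<and> p (cnext n i) \<notin> X) \<or> (p i \<notin> X \<and> p (cnext n i) \<in> sub c)"
    if c: "c \<in> Bch e" and i: "i \<in> crossing n p (sub c)" for c i
  proof -
    have "\<not> (p i \<in> X \<and> p (cnext n i) \<in> X)" using B_no_inner ch[OF c] i by blast
    moreover have "sub c \<subseteq> X" using ch[OF c] eX by blast
    ultimately show ?thesis using i by (auto simp: crossing_def)
  qed
  \<comment> \<open>A step between \<open>Y\<close> and a child subtree in \<open>B\<close> would be
    an inner crossing of that subtree, which \<open>B_no_inner\<close> excludes.\<close>
  have crY: "(p i \<in> Y \<and> p (cnext n i) \<notin> sub e) \<or> (p i \<notin> sub e \<and> p (cnext n i) \<in> Y)"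
    if i: "i \<in> crossing n p Y" for i
  proof (rule ccontr)
    assume neg: "\<not> ?thesis"
    have "\<exists>c\<in>Bch e. i \<in> crossing n p (sub c) \<and> p i \<in> sub e \<and> p (cnext n i) \<in> sub e"
      using i neg by (auto simp: crossing_def Y_def)
    then show False using B_no_inner ch eX by blast
  qed
  have sub1: "crossing n p (sub c) \<subseteq> crossing n p (sub e)" if "c \<in> Bch e" for c
    using cr1[OF that] ch[OF that] eX by (fastforce simp: crossing_def)
  have sub2: "crossing n p Y \<subseteq> crossing n p (sub e)"
  proof
    fix i assume i: "i \<in> crossing n p Y"
    have "Y \<subseteq> sub e" by (auto simp: Y_def)
    then show "i \<in> crossing n p (sub e)" using crY[OF i] i by (auto simp: crossing_def)
  qed
  have disj: "crossing n p (sub c) \<inter> crossing n p (sub c') = {}"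
    if "c \<in> Bch e" "c' \<in> Bch e" "c \<noteq> c'" for c c'
  proof (rule ccontr)
    assume "\<not> ?thesis"
    then obtain i where "i \<in> crossing n p (sub c)" "i \<in> crossing n p (sub c')" by auto
    then show False using cr1[OF that(1)] cr1[OF that(2)] sibl[OF that] ch[OF that(1)] ch[OF that(2)] eX by blast
  qed
  have disjY: "(\<Union>c\<in>Bch e. crossing n p (sub c)) \<inter> crossing n p Y = {}"
  proof (rule ccontr)
    assume "\<not> ?thesis"
    then obtain i c where "c \<in> Bch e" "i \<in> crossing n p (sub c)" "i \<in> crossing n p Y" by auto
    then show False using cr1[of c i] eX by (auto simp: crossing_def Y_def)
  qed
  have "2 * card (Bch e) = (\<Sum>c\<in>Bch e. 2)" by simp
  also have "\<dots> \<le> (\<Sum>c\<in>Bch e. card (crossing n p (sub c)))"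
    using ch card_crossing_sub by (intro sum_mono) auto
  also have "\<dots> = card (\<Union>c\<in>Bch e. crossing n p (sub c))"
    using finite_Bch finite_crossing disj by (intro card_UN_disjoint[symmetric]) auto
  finally have "2 * card (Bch e) + 2 \<le> card (\<Union>c\<in>Bch e. crossing n p (sub c)) + card (crossing n p Y)"
    using cY by simp
  also have "\<dots> = card ((\<Union>c\<in>Bch e. crossing n p (sub c)) \<union> crossing n p Y)"
    using finite_Bch finite_crossing disjY by (intro card_Un_disjoint[symmetric]) auto
  also have "\<dots> \<le> card (crossing n p (sub e))" using sub1 sub2 finite_crossing by (intro card_mono) auto
  also have "\<dots> \<le> val e" using val_ge_card[OF e] .
  finally show ?thesis .
qed

text \<open>Exchange of summation: a tour step crosses the cut at \<open>e\<close> exactly if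
  \<open>e\<close> lies on its tree path, and outside \<open>Z\<close> that path has at most
  \<open>23/22\<close> times the weight of the step many edges.\<close>

lemma sum_val_le: "22 * (\<Sum>e\<in>X - Z. real (val e)) \<le> 23 * real (tshare n w p X)"
proof -
  define k where "k i = real (of_bool (p i \<in> X) + of_bool (p (cnext n i) \<in> X))" for i
  have "(\<Sum>e\<in>X - Z. real (val e)) = (\<Sum>e\<in>X - Z. \<Sum>i<n. k i * of_bool (i \<in> crossing n p (sub e)))"
  proof (intro sum.cong refl)
    fix e
    have "(\<Sum>i<n. k i * of_bool (i \<in> crossing n p (sub e))) = (\<Sum>i\<in>crossing n p (sub e). k i)"
    proof -
      have "crossing n p (sub e) \<subseteq> {..<n}" by (auto simp: crossing_def)
      then show ?thesis by (simp add: Int_absorb1 flip: sum.inter_restrict)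
    qed
    then show "real (val e) = (\<Sum>i<n. k i * of_bool (i \<in> crossing n p (sub e)))"
      by (simp add: val_def k_def)
  qed
  also have "\<dots> = (\<Sum>i<n. \<Sum>e\<in>X - Z. k i * of_bool (i \<in> crossing n p (sub e)))" by (rule sum.swap)
  also have "\<dots> \<le> (\<Sum>i<n. k i * (23/22 * real (w (p i) (p (cnext n i)))))"
  proof (rule sum_mono)
    fix i assume i: "i \<in> {..<n}"
    then have a: "p i < n" "p (cnext n i) < n" using p_lt cnext_lt by auto
    have "(\<Sum>e\<in>X - Z. k i * of_bool (i \<in> crossing n p (sub e))) = k i * card {e \<in> X - Z. i \<in> crossing n p (sub e)}"
      using finite_sub[of v] by (simp add: sum_distrib_left[symmetric] Int_def conj_commute)
    also have "\<dots> \<le> k i * (23/22 * real (w (p i) (p (cnext n i))))"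
    proof (rule mult_left_mono)
      have "{e \<in> X - Z. i \<in> crossing n p (sub e)} \<subseteq> pth (p i) (p (cnext n i)) - Z"
        using a by (auto simp: crossing_def sub_def pth_def)
      then have "card {e \<in> X - Z. i \<in> crossing n p (sub e)} \<le> card (pth (p i) (p (cnext n i)) - Z)"
        using finite_pth[OF a] by (intro card_mono) auto
      then show "real (card {e \<in> X - Z. i \<in> crossing n p (sub e)}) \<le> 23/22 * real (w (p i) (p (cnext n i)))"
        using contr[OF a] by linarith
    qed (simp add: k_def)
    finally show "(\<Sum>e\<in>X - Z. k i * of_bool (i \<in> crossing n p (sub e))) \<le> k i * (23/22 * real (w (p i) (p (cnext n i))))" .
  qed
  also have "\<dots> = 23/22 * real (tshare n w p X)"
    unfolding tshare_def k_def of_nat_sum sum_distrib_left by (intro sum.cong refl) simp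
  finally show ?thesis by simp
qed

lemma child_exists: "card X \<ge> 2 \<Longrightarrow> \<exists>c. 0 < c \<and> c < n \<and> par c = v"
proof -
  assume "card X \<ge> 2"
  then have "\<not> card X \<le> Suc 0" by simp
  then obtain x where "x \<in> X" "x \<noteq> v" using finite_sub[of v] by (metis card_le_Suc0_iff_eq)
  then show ?thesis using child_towards[of x v] by (auto simp: sub_def)
qed

text \<open>A charging argument. A vertex outside \<open>B\<close> has excess itself. A vertex of
  \<open>B\<close> whose parent lies in \<open>X\<close> outside \<open>W\<close> is charged to the
  parent, which by \<open>val_parent\<close> has excess 2 per such child. Any other vertex of
  \<open>B\<close> has a child, and \<open>val_parent\<close> forces that child out of
  \<open>B\<close>. The three classes have at most \<open>G\<close>, \<open>G / 2\<close> and
  \<open>G\<close> members, whence the ratio 5/2.\<close>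

lemma gain:
  assumes "card X \<ge> 2"
  shows "2 * card (X - (W \<union> hub)) \<le> 5 * (\<Sum>e\<in>X - Z. val e - 2)"
proof -
  define G where "G = (\<Sum>e\<in>X - Z. val e - 2)"
  have finX: "finite X" by (rule finite_sub)
  have ZW: "Z \<subseteq> W" by (auto simp: W_def)
  define Q where "Q = X - (W \<union> hub)"
  define Qb where "Qb = {q \<in> Q \<inter> B. q \<noteq> v \<and> par q \<notin> W}"
  define Qc where "Qc = {q \<in> Q \<inter> B. q = v \<or> par q \<in> W}"
  have ch_in: "c \<in> X - Z" if "0 < c" "c < n" "par c = q" "q \<in> Q" for c q
  proof -
    have "v \<in> anc q" "q \<notin> W" using that by (auto simp: Q_def sub_def)
    then show ?thesis using that by (auto simp: sub_def anc_step W_def)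
  qed
  have a: "card (Q - B) \<le> G"
  proof -
    have "card (Q - B) = (\<Sum>e\<in>Q - B. 1)" by simp
    also have "\<dots> \<le> (\<Sum>e\<in>Q - B. val e - 2)" by (rule sum_mono) (auto simp: Q_def B_def)
    also have "\<dots> \<le> G" unfolding G_def using finX ZW by (intro sum_mono2) (auto simp: Q_def)
    finally show ?thesis .
  qed
  have b: "2 * card Qb \<le> G"
  proof -
    have par_in: "par q \<in> X - Z" if "q \<in> Qb" for q
    proof -
      have q: "v \<in> anc q" "q \<noteq> v" "par q \<notin> W" "q < n" using that by (auto simp: Qb_def Q_def sub_def)
      then have "0 < q" using X_pos that by (auto simp: Qb_def Q_def)
      then show ?thesis using q par_lt ZW by (auto simp: sub_def anc_step)
    qed
    have "Qb \<subseteq> (\<Union>e\<in>X - Z. Bch e)" using par_in by (auto simp: Bch_def Qb_def)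
    then have "card Qb \<le> card (\<Union>e\<in>X - Z. Bch e)" using finX finite_Bch by (intro card_mono) auto
    also have "\<dots> \<le> (\<Sum>e\<in>X - Z. card (Bch e))" using finX by (intro card_UN_le) auto
    finally have "2 * card Qb \<le> (\<Sum>e\<in>X - Z. 2 * card (Bch e))" by (simp add: sum_distrib_left[symmetric])
    also have "\<dots> \<le> G" unfolding G_def using val_parent by (intro sum_mono) fastforce
    finally show ?thesis .
  qed
  have c: "card Qc \<le> G"
  proof -
    have "\<exists>c. 0 < c \<and> c < n \<and> par c = q" if "q \<in> Qc" for q
    proof (cases "q = v")
      case True
      then show ?thesis using child_exists[OF assms] by simp
    next
      case False
      then have "q \<notin> hub" "par q \<in> W" "q \<notin> W" "q \<in> X" using that by (auto simp: Qc_def Q_def)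
      then show ?thesis using X_pos by (auto simp: hub_def)
    qed
    then obtain f where f: "\<And>q. q \<in> Qc \<Longrightarrow> 0 < f q \<and> f q < n \<and> par (f q) = q" by metis
    have fX: "f q \<in> X - Z" if "q \<in> Qc" for q
      using ch_in f that by (auto simp: Qc_def)
    have fB: "1 \<le> val (f q) - 2" if "q \<in> Qc" for q
    proof (rule ccontr)
      assume "\<not> ?thesis"
      then have "f q \<in> Bch q" using fX[OF that] f[OF that] by (auto simp: Bch_def B_def)
      then have "1 \<le> card (Bch q)" using finite_Bch by (metis One_nat_def Suc_leI card_gt_0_iff empty_iff)
      moreover have "q \<in> X" "val q < 3" using that by (auto simp: Qc_def B_def)
      ultimately show False using val_parent[of q] by simp
    qed
    have "inj_on f Qc" using f by (metis inj_onI)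
    have "card Qc \<le> (\<Sum>q\<in>Qc. val (f q) - 2)" using fB sum_mono[of Qc "\<lambda>_. 1::nat"] by fastforce
    also have "\<dots> = (\<Sum>e\<in>f ` Qc. val e - 2)" using \<open>inj_on f Qc\<close> by (simp add: sum.reindex)
    also have "\<dots> \<le> G" unfolding G_def using fX finX by (intro sum_mono2) auto
    finally show ?thesis .
  qed
  have "Q \<subseteq> (Q - B) \<union> Qb \<union> Qc" by (auto simp: Qb_def Qc_def)
  then have "card Q \<le> card ((Q - B) \<union> Qb \<union> Qc)"
    using finX by (intro card_mono) (auto simp: Q_def Qb_def Qc_def)
  also have "\<dots> \<le> card (Q - B) + card Qb + card Qc"
    by (meson card_Un_le add_right_mono le_trans)
  finally show ?thesis using a b c by (simp add: G_def Q_def)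
qed

text \<open>Both tour edges at \<open>v\<close> can be units only if both lead to
  \<open>par v\<close>, which is impossible on at least three points.\<close>

lemma tshare_singleton:
  assumes "X = {v}" "par v \<notin> W" "3 \<le> n"
  shows "3 \<le> tshare n w p X"
proof -
  let ?C = "crossing n p {v}"
  have "2 \<le> card ?C" using card_crossing_ge[OF p, of "{v}"] v sub_proper[of v] assms by auto
  then obtain i j where ij: "i \<in> ?C" "j \<in> ?C" "i \<noteq> j"
    by (metis card_le_Suc0_iff_eq finite_crossing not_less_eq_eq numeral_2_eq_2)
  define W' where "W' i = w (p i) (p (cnext n i))" for i
  have W1: "1 \<le> W' i" if "i \<in> ?C" for i
    using w_pos[OF met, of "p i" "p (cnext n i)"] that p_lt cnext_lt by (auto simp: crossing_def W'_def)
  have Wu: "{p i, p (cnext n i)} = {v, par v}" if "i \<in> ?C" "W' i = 1" for i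
  proof -
    have l: "i < n" "p i < n" "p (cnext n i) < n" using that p_lt cnext_lt by (auto simp: crossing_def)
    show ?thesis
    proof (cases "p i = v")
      case True
      then have "p (cnext n i) = par v"
        using bridge[of v v "p (cnext n i)"] that l assms v by (auto simp: crossing_def W'_def)
      then show ?thesis using True by simp
    next
      case False
      then have pv: "p (cnext n i) = v" using that by (auto simp: crossing_def)
      then have "w v (p i) = 1" using that w_sym[OF met, of v "p i"] l by (simp add: W'_def)
      then have "p i = par v" using bridge[of v v "p i"] l assms v False by auto
      then show ?thesis using pv by auto
    qed
  qed
  have "\<not> (W' i = 1 \<and> W' j = 1)"
  proof
    assume both: "W' i = 1 \<and> W' j = 1"
    have injp: "inj p" using p by (rule permutes_inj)
    have l: "i < n" "j < n" using ij by (auto simp: crossing_def)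
    have pv: "par v \<noteq> v" using lev_par[of v] v by auto
    \<comment> \<open>The two steps would go from \<open>v\<close> to \<open>par v\<close> and
      straight back, closing the tour after two points.\<close>
    have "(p i = v \<and> p (cnext n i) = par v \<and> p j = par v \<and> p (cnext n j) = v) \<or>
          (p j = v \<and> p (cnext n j) = par v \<and> p i = par v \<and> p (cnext n i) = v)"
      using Wu[of i] Wu[of j] both ij injp pv by (auto simp: doubleton_eq_iff inj_eq) (metis injp inj_eq)+
    then have "cnext n i = j \<and> cnext n j = i" using injp by (metis inj_eq)
    then show False using l ij(3) assms(3) by (auto simp: cnext_if split: if_splits)
  qed
  then have "3 \<le> W' i + W' j" using W1 ij by (metis One_nat_def add_mono le_antisym not_less_eq_eq numeral_3_eq_3 plus_1_eq_Suc add_Suc_right Suc_1 le_neq_implies_less Suc_leI add.commute)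
  also have "\<dots> = (\<Sum>k\<in>{i, j}. W' k)" using ij by simp
  also have "\<dots> \<le> (\<Sum>k\<in>{i, j}. (of_bool (p k \<in> X) + of_bool (p (cnext n k) \<in> X)) * W' k)"
    using ij assms by (intro sum_mono) (auto simp: crossing_def)
  also have "\<dots> \<le> tshare n w p X" unfolding tshare_def W'_def
    using ij by (intro sum_mono2) (auto simp: crossing_def)
  finally show ?thesis .
qed

text \<open>With \<open>x\<close>, \<open>u\<close>, \<open>h\<close> counting all vertices of
  \<open>X\<close>, those in \<open>W\<close> and those in \<open>hub\<close>, the sum of
  \<open>val\<close> is at least \<open>2 * (x - u) + 2/5 * (x - u - h)\<close>, that is
  \<open>12/5 * x - 2/5 * (6 * u + h)\<close>. The hypothesis \<open>few\<close> is tuned to these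
  coefficients and leaves \<open>11/5 * x\<close>. Finally \<open>22 * 11/5 = 48.4\<close> exceeds
  \<open>23 * 21/10 = 48.3\<close>.\<close>

lemma tshare_ge:
  assumes "par v \<notin> W" "3 \<le> n" and few: "2 * (card (hub \<inter> X) + 6 * card (W \<inter> X)) \<le> card X"
  shows "21 * card X \<le> 10 * tshare n w p X"
proof (cases "card X \<ge> 2")
  case False
  moreover have "v \<in> X" using v by (simp add: self_in_sub)
  ultimately have "X = {v}" using finite_sub[of v]
    by (metis card_le_Suc0_iff_eq empty_iff insertI1 insert_absorb not_less_eq_eq numeral_2_eq_2 subsetI subset_singleton_iff)
  then show ?thesis using tshare_singleton assms by simp
next
  case True
  have finX: "finite X" by (rule finite_sub)
  define x where "x = real (card X)"
  define u where "u = real (card (W \<inter> X))"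
  define h where "h = real (card (hub \<inter> X))"
  define G where "G = real (\<Sum>e\<in>X - Z. val e - 2)"
  have "real (2 * (card (hub \<inter> X) + 6 * card (W \<inter> X))) \<le> real (card X)"
    using few by (simp only: of_nat_le_iff)
  then have few': "2 * h + 12 * u \<le> x" unfolding x_def u_def h_def by simp
  have "real (card (X - (W \<union> hub))) \<ge> x - u - h"
  proof -
    have "X = (X - (W \<union> hub)) \<union> ((W \<inter> X) \<union> (hub \<inter> X))" by auto
    then have "card X \<le> card (X - (W \<union> hub)) + card ((W \<inter> X) \<union> (hub \<inter> X))" by (metis card_Un_le)
    also have "card ((W \<inter> X) \<union> (hub \<inter> X)) \<le> card (W \<inter> X) + card (hub \<inter> X)" by (rule card_Un_le)
    finally show ?thesis unfolding x_def u_def h_def by linarith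
  qed
  moreover have "2 * real (card (X - (W \<union> hub))) \<le> 5 * G"
    using gain[OF True] unfolding G_def by linarith
  ultimately have g: "2 * (x - u - h) \<le> 5 * G" by argo
  have "(\<Sum>e\<in>X - Z. real (val e)) = 2 * real (card (X - Z)) + G"
  proof -
    have "(\<Sum>e\<in>X - Z. real (val e)) = (\<Sum>e\<in>X - Z. 2 + real (val e - 2))"
      using val_ge_2 by (intro sum.cong) (auto simp: of_nat_diff)
    then show ?thesis by (simp add: G_def sum.distrib)
  qed
  moreover have "real (card (X - Z)) \<ge> x - u"
  proof -
    have "X \<subseteq> (X - Z) \<union> (W \<inter> X)" by (auto simp: W_def)
    then have "card X \<le> card (X - Z) + card (W \<inter> X)"
      by (meson card_Un_le card_mono finX finite_Diff finite_Int finite_UnI le_trans)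
    then show ?thesis unfolding x_def u_def by linarith
  qed
  ultimately have "22 * (2 * (x - u) + 2/5 * (x - u - h)) \<le> 23 * real (tshare n w p X)"
    using sum_val_le g by argo
  moreover have "0 \<le> x" by (simp add: x_def)
  ultimately have "21 * x \<le> 10 * real (tshare n w p X)" using few' by argo
  then show ?thesis unfolding x_def by linarith
qed

end

context ctree
begin

lemma type2_dead:
  assumes v: "0 < v" "v < n" "v \<notin> W" "par v \<notin> W" and "3 \<le> n" "card (sub v) \<le> \<sigma>"
    and few: "2 * (card (hub \<inter> sub v) + 6 * card (W \<inter> sub v)) \<le> card (sub v)"
  shows "dead n w \<sigma> v"
proof -
  have "dead_side n w \<sigma> v (par v) (sub v)"
    unfolding dead_side_def
  proof (intro conjI allI impI ballI)
    show "par v \<notin> sub v" using v not_in_anc_par by (simp add: sub_def)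
    show "\<And>x z. x \<in> sub v \<Longrightarrow> z < n \<Longrightarrow> z \<notin> sub v \<Longrightarrow> w x z = 1 \<Longrightarrow> x = v"
      "\<And>x z. x \<in> sub v \<Longrightarrow> z < n \<Longrightarrow> z \<notin> sub v \<Longrightarrow> w x z = 1 \<Longrightarrow> z = par v"
      using bridge v by blast+
    fix p assume "p permutes {..<n}"
    then interpret ctour n par lev w Z v p using v by unfold_locales auto
    show "21 * card (sub v) \<le> 10 * tshare n w p (sub v)" using tshare_ge assms by blast
  qed (use assms self_in_sub sub_subset par_lt unit sub_connected in auto)
  then show ?thesis by (auto simp: dead_def)
qed

end

section \<open>Structure of instances with an expensive tour\<close>

lemma wcost_append: "wcost w (xs @ x # ys) = wcost w (xs @ [x]) + wcost w (x # ys)"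
proof (induction xs)
  case (Cons a xs)
  then show ?case by (cases xs) auto
qed simp

lemma wcost_sum: "wcost (\<lambda>x y. \<Sum>e\<in>I. f e x y) l = (\<Sum>e\<in>I. wcost (f e) l)"
  by (induction l rule: wedges.induct) (auto simp: sum.distrib)

lemma wcost_change:
  "l \<noteq> [] \<Longrightarrow> s (hd l) \<noteq> s (last l) \<Longrightarrow> 1 \<le> wcost (\<lambda>x y. of_bool (s x \<noteq> (s y :: bool))) l"
  by (induction l rule: wedges.induct) (auto split: if_splits)

lemma wcost_visit:
  assumes "s a \<noteq> s x" "s b \<noteq> s x" "x \<in> set xs"
  shows "2 \<le> wcost (\<lambda>x y. of_bool (s x \<noteq> (s y :: bool))) (a # xs @ [b])"
proof -
  obtain ys zs where xs: "xs = ys @ x # zs" using assms(3) by (meson split_list)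
  have "1 \<le> wcost (\<lambda>x y. of_bool (s x \<noteq> s y)) ((a # ys) @ [x])"
    using assms by (intro wcost_change) auto
  moreover have "1 \<le> wcost (\<lambda>x y. of_bool (s x \<noteq> s y)) (x # zs @ [b])"
    using assms by (intro wcost_change) auto
  ultimately show ?thesis
    using wcost_append[of "\<lambda>x y. of_bool (s x \<noteq> s y)" "a # ys" x "zs @ [b]"] xs by simp
qed

section \<open>Counting vertices by the size and position of their subtrees\<close>

context ctree
begin

text \<open>\<open>sub 0\<close> is empty in this encoding, so the root is added by hand.\<close>

definition big :: "nat \<Rightarrow> nat set" where
  "big \<sigma> = {v. v < n \<and> (v = 0 \<or> \<sigma> < card (sub v))}"

definition type2 :: "nat \<Rightarrow> nat set" where
  "type2 \<sigma> = {v. 0 < v \<and> v < n \<and> v \<notin> W \<and> par v \<notin> W \<and> card (sub v) \<le> \<sigma>}"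

text \<open>Below every big edge outside \<open>Z\<close> the walk has a point, so it crosses that
  cut at least twice, while a step crosses at most \<open>23/22\<close> times its weight many of
  these cuts. The 44 is \<open>2 * 22\<close>, and the \<open>- 1\<close> accounts for the
  root.\<close>

lemma tour_S_lower:
  assumes xs: "set xs \<subseteq> {..<n}" and hit: "\<And>v. v \<in> big \<sigma> - {0} \<Longrightarrow> sub v \<inter> set xs \<noteq> {}"
  shows "44 * (real (card (big \<sigma>)) - 1 - real (card Z)) \<le> 23 * real (wcost w (0 # xs @ [0]))"
proof -
  let ?l = "0 # xs @ [0]"
  define f where "f e x y = (of_bool ((e \<in> anc x) \<noteq> (e \<in> anc y)) :: nat)" for e x y
  define J where "J = big \<sigma> - {0} - Z"
  have finb: "finite (big \<sigma>)" by (simp add: big_def)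
  have "(\<Sum>e\<in>J. 2) \<le> (\<Sum>e\<in>J. wcost (f e) ?l)"
  proof (rule sum_mono)
    fix e assume "e \<in> J"
    then obtain x where "x \<in> set xs" "e \<in> anc x" using hit[of e] by (auto simp: J_def sub_def)
    then show "2 \<le> wcost (f e) ?l" unfolding f_def by (intro wcost_visit[of "\<lambda>x. e \<in> anc x" 0 x 0]) auto
  qed
  also have "\<dots> = wcost (\<lambda>x y. \<Sum>e\<in>J. f e x y) ?l" by (rule wcost_sum[symmetric])
  finally have 1: "2 * card J \<le> wcost (\<lambda>x y. \<Sum>e\<in>J. f e x y) ?l" by simp
  have step: "22 * (\<Sum>e\<in>J. f e x y) \<le> 23 * w x y" if "x < n" "y < n" for x y
  proof -
    have "(\<Sum>e\<in>J. f e x y) = card {e \<in> J. (e \<in> anc x) \<noteq> (e \<in> anc y)}"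
      using finb by (simp add: f_def J_def Int_def)
    also have "\<dots> \<le> card (pth x y - Z)" using finite_pth[OF that] by (intro card_mono) (auto simp: J_def pth_def)
    finally have "22 * real (\<Sum>e\<in>J. f e x y) \<le> 23 * real (w x y)" using contr[OF that] by linarith
    then show ?thesis by linarith
  qed
  have "22 * wcost (\<lambda>x y. \<Sum>e\<in>J. f e x y) l \<le> 23 * wcost w l" if "set l \<subseteq> {..<n}" for l
    using that
  proof (induction l rule: wedges.induct)
    case (1 x y zs)
    then show ?case using step[of x y] by simp
  qed auto
  from this[of ?l] have "22 * wcost (\<lambda>x y. \<Sum>e\<in>J. f e x y) ?l \<le> 23 * wcost w ?l" using xs n0 by simp
  with 1 have "44 * card J \<le> 23 * wcost w ?l" by linarith
  then have "44 * real (card J) \<le> 23 * real (wcost w ?l)"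
    by (metis of_nat_le_iff of_nat_mult of_nat_numeral)
  moreover have "real (card J) \<ge> real (card (big \<sigma>)) - 1 - real (card Z)"
  proof -
    have "big \<sigma> \<subseteq> J \<union> ({0} \<union> Z)" by (auto simp: J_def)
    then have "card (big \<sigma>) \<le> card (J \<union> ({0} \<union> Z))" using finb finite_Z by (intro card_mono) (auto simp: J_def)
    also have "\<dots> \<le> card J + card ({0} \<union> Z)" by (rule card_Un_le)
    also have "card ({0} \<union> Z) \<le> 1 + card Z" using card_Un_le[of "{0}" Z] by simp
    finally show ?thesis by linarith
  qed
  ultimately show ?thesis by argo
qed

text \<open>Each of these vertices has a child; choosing one is injective. The child lies in
  \<open>W\<close>, or its parent avoids \<open>W\<close> and its subtree is again small.\<close>

lemma card_type3:
  "card {v. 0 < v \<and> v < n \<and> v \<notin> W \<and> par v \<in> W \<and> card (sub v) \<le> \<sigma> \<and> v \<notin> hub} \<le> card W + card (type2 \<sigma>)"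
  (is "card ?T \<le> _")
proof -
  have "\<exists>c. 0 < c \<and> c < n \<and> par c = v" if "v \<in> ?T" for v using that unfolding hub_def by blast
  then have "\<forall>v\<in>?T. \<exists>c. 0 < c \<and> c < n \<and> par c = v" by blast
  from bchoice[OF this] obtain f where f: "\<And>v. v \<in> ?T \<Longrightarrow> 0 < f v \<and> f v < n \<and> par (f v) = v" by blast
  have "inj_on f ?T" by (rule inj_on_inverseI[of _ par]) (use f in blast)
  moreover have "f ` ?T \<subseteq> W \<union> type2 \<sigma>"
  proof
    fix c assume "c \<in> f ` ?T"
    then obtain v where v: "v \<in> ?T" "c = f v" by auto
    then have c: "0 < c" "c < n" "par c = v" using f by auto
    have "c \<in> sub v" using c v self_in_anc[of v] by (auto simp: sub_def anc_step)
    then have "card (sub c) \<le> card (sub v)" using sub_mono finite_sub by (intro card_mono) auto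
    then show "c \<in> W \<union> type2 \<sigma>" using c v by (auto simp: type2_def)
  qed
  moreover have "finite (W \<union> type2 \<sigma>)" using finite_W by (simp add: type2_def)
  ultimately have "card ?T \<le> card (W \<union> type2 \<sigma>)" by (rule card_inj_on_le)
  then show ?thesis using card_Un_le le_trans by blast
qed

text \<open>A vertex of \<open>type2\<close> that is not dead has a subtree in which
  \<open>W\<close> and \<open>hub\<close> are dense. The maximal subtrees of this kind are disjoint
  by laminarity, so the density bounds can be summed over them.\<close>

lemma card_undetected:
  assumes "3 \<le> n"
  shows "card (type2 \<sigma>) \<le> card {v. v < n \<and> dead n w \<sigma> v} + 2 * card hub + 12 * card W"
proof -
  define U where "U = {v \<in> type2 \<sigma>. card (sub v) < 2 * (card (hub \<inter> sub v) + 6 * card (W \<inter> sub v))}"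
  define M where "M = {v \<in> U. \<forall>u\<in>U. v \<in> sub u \<longrightarrow> u = v}"
  have finU: "finite U" by (simp add: U_def type2_def)
  have Ub: "0 < v \<and> v < n" if "v \<in> U" for v using that by (auto simp: U_def type2_def)
  have top: "\<exists>m\<in>M. v \<in> sub m" if "v \<in> U" for v
  proof -
    define T where "T = {u \<in> U. v \<in> sub u}"
    have "v \<in> T" using that Ub self_in_sub by (auto simp: T_def)
    \<comment> \<open>All candidates lie on the path from \<open>v\<close> to the root, so one of
      least level has the largest subtree.\<close>
    then obtain m where m: "m \<in> T" "\<And>u. u \<in> T \<Longrightarrow> lev m \<le> lev u"
      using ex_has_least_nat[of "\<lambda>u. u \<in> T" v lev] by auto
    have "u = m" if u: "u \<in> U" "m \<in> sub u" for u
    proof (rule ccontr)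
      assume "u \<noteq> m"
      have mb: "0 < m" "m < n" using m Ub by (auto simp: T_def)
      have "u \<in> T" using u m(1) sub_mono[of m u] by (auto simp: T_def)
      moreover have "u \<in> anc (par m)" using u mb \<open>u \<noteq> m\<close> by (auto simp: sub_def anc_step)
      then have "lev u < lev m" using anc_lev[of "par m" u] par_lt[of m] lev_par[of m] mb by auto
      ultimately show False using m(2) by fastforce
    qed
    then have "m \<in> M" using m by (auto simp: M_def T_def)
    then show ?thesis using m by (auto simp: T_def)
  qed
  have disj: "sub m \<inter> sub m' = {}" if "m \<in> M" "m' \<in> M" "m \<noteq> m'" for m m'
    using sub_laminar[of m m'] that by (auto simp: M_def)
  have finM: "finite M" using finU by (simp add: M_def)
  have part: "(\<Sum>m\<in>M. card (A \<inter> sub m)) \<le> card A" if "finite A" for A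
  proof -
    have "(\<Sum>m\<in>M. card (A \<inter> sub m)) = card (\<Union>m\<in>M. A \<inter> sub m)"
      using finM disj that by (intro card_UN_disjoint[symmetric]) auto
    also have "\<dots> \<le> card A" using that by (intro card_mono) auto
    finally show ?thesis .
  qed
  have "U \<subseteq> (\<Union>m\<in>M. sub m)" using top by auto
  then have "card U \<le> card (\<Union>m\<in>M. sub m)" using finM finite_sub by (intro card_mono) auto
  also have "\<dots> \<le> (\<Sum>m\<in>M. card (sub m))" using finM by (rule card_UN_le)
  also have "\<dots> \<le> (\<Sum>m\<in>M. 2 * card (hub \<inter> sub m) + 12 * card (W \<inter> sub m))"
    by (rule sum_mono) (auto simp: M_def U_def)
  also have "\<dots> = 2 * (\<Sum>m\<in>M. card (hub \<inter> sub m)) + 12 * (\<Sum>m\<in>M. card (W \<inter> sub m))"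
    by (simp add: sum.distrib sum_distrib_left)
  also have "\<dots> \<le> 2 * card hub + 12 * card W"
    using part[OF finite_hub] part[OF finite_W] by linarith
  finally have cU: "card U \<le> 2 * card hub + 12 * card W" .
  have "type2 \<sigma> \<subseteq> {v. v < n \<and> dead n w \<sigma> v} \<union> U"
  proof
    fix v assume v: "v \<in> type2 \<sigma>"
    then show "v \<in> {v. v < n \<and> dead n w \<sigma> v} \<union> U"
      using type2_dead[of v \<sigma>] assms by (auto simp: type2_def U_def not_less)
  qed
  then have "card (type2 \<sigma>) \<le> card ({v. v < n \<and> dead n w \<sigma> v} \<union> U)"
    using finU by (intro card_mono) auto
  also have "\<dots> \<le> card {v. v < n \<and> dead n w \<sigma> v} + card U" by (rule card_Un_le)
  finally show ?thesis using cU by simp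
qed

text \<open>Apart from \<open>big\<close>, \<open>W\<close> and \<open>hub\<close> there are
  \<open>type2\<close> and at most \<open>card W + card (type2 \<sigma>)\<close> further vertices.
  Inserting \<open>card_undetected\<close> twice gives \<open>26 = 2 + 2 * 12\<close> and
  \<open>5 = 1 + 2 * 2\<close>.\<close>

lemma vertex_count:
  assumes "3 \<le> n"
  shows "n \<le> card (big \<sigma>) + 26 * card W + 2 * card {v. v < n \<and> dead n w \<sigma> v} + 5 * card hub"
proof -
  let ?T = "{v. 0 < v \<and> v < n \<and> v \<notin> W \<and> par v \<in> W \<and> card (sub v) \<le> \<sigma> \<and> v \<notin> hub}"
  have fin: "finite (big \<sigma>)" "finite (type2 \<sigma>)" "finite ?T" by (simp_all add: big_def type2_def)
  have "{..<n} \<subseteq> big \<sigma> \<union> (W \<union> (type2 \<sigma> \<union> (?T \<union> hub)))" by (auto simp: big_def type2_def not_less)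
  then have "card {..<n} \<le> card (big \<sigma> \<union> (W \<union> (type2 \<sigma> \<union> (?T \<union> hub))))"
    using fin finite_W finite_hub by (intro card_mono) auto
  also have "\<dots> \<le> card (big \<sigma>) + (card W + (card (type2 \<sigma>) + (card ?T + card hub)))"
    by (meson card_Un_le add_left_mono le_trans)
  finally show ?thesis using card_type3[of \<sigma>] card_undetected[OF assms, of \<sigma>] by simp
qed

end

section \<open>Structure of instances with a cheap tour\<close>

lemma sum_perm:
  assumes "p permutes {..<n}" "A \<subseteq> {..<n}"
  shows "(\<Sum>i<n. of_bool (p i \<in> A)) = card A" "(\<Sum>i<n. of_bool (p (cnext n i) \<in> A)) = card A"
proof -
  have "(\<Sum>i<n. of_bool (p i \<in> A)) = (\<Sum>j<n. of_bool (j \<in> A) :: nat)"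
    using sum.permute[OF assms(1), of "\<lambda>j. of_bool (j \<in> A)"] unfolding o_def by (rule sym)
  also have "\<dots> = card A" using assms(2) by (simp add: Int_absorb1)
  finally show a: "(\<Sum>i<n. of_bool (p i \<in> A)) = card A" .
  have "(\<Sum>i<n. of_bool (p (cnext n i) \<in> A)) = (\<Sum>i<n. of_bool (p i \<in> A) :: nat)"
    by (rule sum.reindex_bij_betw[OF bij_cnext])
  then show "(\<Sum>i<n. of_bool (p (cnext n i) \<in> A)) = card A" using a by simp
qed

lemma tshare_additive:
  assumes "finite X"
  shows "tshare n w p X = (\<Sum>x\<in>X. tshare n w p {x})"
proof -
  have "of_bool (a \<in> X) = (\<Sum>x\<in>X. of_bool (a \<in> {x}) :: nat)" for a
    using assms by (simp add: of_bool_def)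
  then have "tshare n w p X = (\<Sum>i<n. \<Sum>x\<in>X. (of_bool (p i \<in> {x}) + of_bool (p (cnext n i) \<in> {x})) * w (p i) (p (cnext n i)))"
    unfolding tshare_def by (simp only: sum.distrib[symmetric] sum_distrib_right)
  also have "\<dots> = (\<Sum>x\<in>X. tshare n w p {x})" unfolding tshare_def by (rule sum.swap)
  finally show ?thesis .
qed

section \<open>What a fixed tour must pay for dead ends and isolated vertices\<close>

locale good_tour = utree +
  fixes p :: "nat \<Rightarrow> nat"
  assumes p: "p permutes {..<n}" and n2: "2 \<le> n"
begin

lemma tour_cost_cnext: "tour_cost n w p = (\<Sum>i<n. w (p i) (p (cnext n i)))"
  by (simp add: tour_cost_def cnext_def)

lemma tour_edge_pos: "i < n \<Longrightarrow> 1 \<le> w (p i) (p (cnext n i))"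
proof -
  assume i: "i < n"
  have "cnext n i \<noteq> i" using i n2 by (simp add: cnext_if)
  then have "p (cnext n i) \<noteq> p i" using permutes_inj[OF p] by (simp add: inj_eq)
  then show ?thesis using w_pos[OF met] perm_lt[OF p] cnext_lt i by metis
qed

lemma tour_cost_ge: "n \<le> tour_cost n w p"
  unfolding tour_cost_cnext using tour_edge_pos sum_mono[of "{..<n}" "\<lambda>_. 1::nat"] by fastforce

lemma tshare_vertex: "x < n \<Longrightarrow> 2 \<le> tshare n w p {x}"
proof -
  assume x: "x < n"
  have "2 = (\<Sum>i<n. of_bool (p i \<in> {x}) + of_bool (p (cnext n i) \<in> {x}) :: nat)"
    using sum_perm[OF p, of "{x}"] x by (simp add: sum.distrib)
  also have "\<dots> \<le> tshare n w p {x}" unfolding tshare_def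
  proof (rule sum_mono)
    fix i assume "i \<in> {..<n}"
    then have "1 \<le> w (p i) (p (cnext n i))" using tour_edge_pos by simp
    then show "of_bool (p i \<in> {x}) + of_bool (p (cnext n i) \<in> {x})
      \<le> (of_bool (p i \<in> {x}) + of_bool (p (cnext n i) \<in> {x})) * w (p i) (p (cnext n i))" by simp
  qed
  finally show ?thesis .
qed

lemma unit_cut:
  assumes "Y \<noteq> {}" "Y \<subset> {..<n}"
  obtains x z where "x \<in> Y" "z < n" "z \<notin> Y" "w x z = 1"
proof (cases "0 \<in> Y")
  case True
  obtain y where y: "y < n" "y \<notin> Y" using assms by auto
  have "\<exists>x. 0 < x \<and> x < n \<and> x \<notin> Y \<and> par x \<in> Y"
  proof (rule ccontr)
    assume neg: "\<not> ?thesis"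
    have "y \<in> Y" if "y < n" for y using that
    proof (induction rule: tree_induct)
      case root
      show ?case by (rule True)
    next
      case (step x)
      then show ?case using neg by blast
    qed
    then show False using y by auto
  qed
  then obtain x where x: "0 < x" "x < n" "x \<notin> Y" "par x \<in> Y" by auto
  then have "w (par x) x = 1" using unit[of x] w_sym[OF met, of x "par x"] par_lt by auto
  then show ?thesis using that x by blast
next
  case False
  obtain y where y: "y < n" "y \<in> Y" using assms by auto
  have "\<exists>x. 0 < x \<and> x < n \<and> x \<in> Y \<and> par x \<notin> Y"
  proof (rule ccontr)
    assume neg: "\<not> ?thesis"
    have "y \<notin> Y" if "y < n" for y using that
    proof (induction rule: tree_induct)
      case root
      show ?case by (rule False)
    next
      case (step x)
      then show ?case using neg by blast
    qed
    then show False using y by auto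
  qed
  then show ?thesis using that unit par_lt by blast
qed

lemma conn_crossing:
  assumes "(v, x) \<in> R\<^sup>*" "P v \<noteq> P x"
  shows "\<exists>a b. (a, b) \<in> R \<and> P a \<noteq> (P b :: bool)"
  using assms by (induction rule: rtrancl_induct) metis+

text \<open>\<open>X\<close> is connected by unit edges and only partly contained in
  \<open>X'\<close>, so one of its edges leaves \<open>X'\<close>; the only such edge is the bridge
  of \<open>X'\<close>.\<close>

lemma side_exit:
  assumes d: "dead_side n w \<sigma> v u X" "dead_side n w \<sigma> v' u' X'"
    and "X \<inter> X' \<noteq> {}" "\<not> X \<subseteq> X'"
  shows "v' \<in> X \<and> u' \<in> X"
proof -
  let ?R = "{(a, b). a \<in> X \<and> b \<in> X \<and> w a b = 1}"
  obtain s t where st: "s \<in> X" "s \<in> X'" "t \<in> X" "t \<notin> X'" using assms by auto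
  have "(v, s) \<in> ?R\<^sup>*" "(v, t) \<in> ?R\<^sup>*" using d(1) st by (auto simp: dead_side_def)
  then have "\<exists>a b. (a, b) \<in> ?R \<and> (a \<in> X') \<noteq> (b \<in> X')"
    using st conn_crossing[of v s ?R "\<lambda>x. x \<in> X'"] conn_crossing[of v t ?R "\<lambda>x. x \<in> X'"] by (cases "v \<in> X'") auto
  then obtain a b where ab: "a \<in> X" "b \<in> X" "w a b = 1" "(a \<in> X') \<noteq> (b \<in> X')" by auto
  have lt: "a < n" "b < n" using ab d by (auto simp: dead_side_def)
  then have "w b a = 1" using ab w_sym[OF met, of a b] by simp
  then have "(a = v' \<and> b = u') \<or> (b = v' \<and> a = u')" using ab d(2) lt unfolding dead_side_def by blast
  then show ?thesis using ab by auto
qed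

text \<open>If two sides overlapped properly, each would contain the bridge of the other, and no
  unit edge would leave their union. But by size the union misses a vertex, and the unit graph is
  connected.\<close>

lemma sides_laminar:
  assumes d: "dead_side n w \<sigma> v u X" "dead_side n w \<sigma> v' u' X'" and \<sigma>: "2 * \<sigma> < n"
  shows "X \<inter> X' = {} \<or> X \<subseteq> X' \<or> X' \<subseteq> X"
proof (rule ccontr)
  assume neg: "\<not> ?thesis"
  have a: "v' \<in> X" "u' \<in> X" using side_exit[OF d] neg by auto
  have b: "v \<in> X'" "u \<in> X'" using side_exit[OF d(2,1)] neg by auto
  have sub: "X \<union> X' \<subseteq> {..<n}" using d by (auto simp: dead_side_def)
  have "card (X \<union> X') \<le> card X + card X'" by (rule card_Un_le)
  also have "\<dots> < n"
  proof -
    have "card X \<le> \<sigma>" "card X' \<le> \<sigma>" using d by (simp_all add: dead_side_def)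
    then show ?thesis using \<sigma> by linarith
  qed
  finally have "card (X \<union> X') \<noteq> n" by simp
  then have "X \<union> X' \<noteq> {..<n}" using card_lessThan by metis
  then have "X \<union> X' \<subset> {..<n}" "X \<union> X' \<noteq> {}" using sub a by auto
  then obtain x z where xz: "x \<in> X \<union> X'" "z < n" "z \<notin> X \<union> X'" "w x z = 1" by (metis unit_cut)
  have "x \<in> X \<Longrightarrow> z = u" "x \<in> X' \<Longrightarrow> z = u'" using xz d unfolding dead_side_def by blast+
  then show False using xz a b by auto
qed

text \<open>The maximal sides are disjoint, so their losses add up: the tour pays at least
  \<open>21/20\<close> per vertex on them and at least 1 per vertex elsewhere.\<close>

lemma card_dead_le:
  assumes \<sigma>: "2 * \<sigma> < n"
  shows "card {v. v < n \<and> dead n w \<sigma> v} \<le> 20 * (tour_cost n w p - n)"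
proof -
  define F where "F = {X. \<exists>v u. dead_side n w \<sigma> v u X}"
  define M where "M = {X \<in> F. \<forall>Y\<in>F. X \<subseteq> Y \<longrightarrow> Y = X}"
  have Fsub: "X \<subseteq> {..<n}" if "X \<in> F" for X using that by (auto simp: F_def dead_side_def)
  have finF: "finite F" using Fsub by (intro finite_subset[of F "Pow {..<n}"]) auto
  have finM: "finite M" using finF by (simp add: M_def)
  have finX: "finite X" if "X \<in> M" for X using that Fsub finite_subset by (fastforce simp: M_def)
  have disj: "X \<inter> Y = {}" if XY: "X \<in> M" "Y \<in> M" "X \<noteq> Y" for X Y
  proof -
    obtain v u v' u' where "dead_side n w \<sigma> v u X" "dead_side n w \<sigma> v' u' Y"
      using XY by (auto simp: M_def F_def)
    from sides_laminar[OF this \<sigma>] show ?thesis using XY by (auto simp: M_def)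
  qed
  define U where "U = \<Union>M"
  have Usub: "U \<subseteq> {..<n}" using Fsub by (auto simp: U_def M_def)
  then have finU: "finite U" using finite_subset by blast
  have "{v. v < n \<and> dead n w \<sigma> v} \<subseteq> U"
  proof
    fix v assume "v \<in> {v. v < n \<and> dead n w \<sigma> v}"
    then obtain u X where d: "dead_side n w \<sigma> v u X" by (auto simp: dead_def)
    then have "X \<in> F" "v \<in> X" by (auto simp: F_def dead_side_def)
    then obtain Y where "Y \<in> F" "X \<subseteq> Y" "\<forall>Y'\<in>F. Y \<subseteq> Y' \<longrightarrow> Y = Y'"
      using finite_has_maximal2[OF finF] by blast
    then show "v \<in> U" using \<open>v \<in> X\<close> by (auto simp: U_def M_def)
  qed
  then have cd: "card {v. v < n \<and> dead n w \<sigma> v} \<le> card U" using finU by (rule card_mono[rotated])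
  have cU: "card U = (\<Sum>X\<in>M. card X)" unfolding U_def using finX disj
    by (intro card_Union_disjoint) (auto simp: pairwise_def disjnt_def)
  have "(\<Sum>x\<in>U. tshare n w p {x}) = (\<Sum>X\<in>M. \<Sum>x\<in>X. tshare n w p {x})"
    unfolding U_def using finX disj by (intro sum.Union_disjoint[unfolded o_def]) auto
  also have "\<dots> = (\<Sum>X\<in>M. tshare n w p X)"
    by (rule sum.cong[OF refl], rule tshare_additive[symmetric], erule finX)
  finally have sU: "(\<Sum>x\<in>U. tshare n w p {x}) = (\<Sum>X\<in>M. tshare n w p X)" .
  have "21 * card X \<le> 10 * tshare n w p X" if "X \<in> M" for X
  proof -
    obtain v u where "dead_side n w \<sigma> v u X" using \<open>X \<in> M\<close> by (auto simp: M_def F_def)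
    then show ?thesis using p unfolding dead_side_def by blast
  qed
  then have "21 * card U \<le> 10 * (\<Sum>x\<in>U. tshare n w p {x})"
    unfolding sU cU sum_distrib_left by (rule sum_mono)
  moreover have "2 * card ({..<n} - U) \<le> (\<Sum>x\<in>{..<n} - U. tshare n w p {x})"
    using sum_mono[of "{..<n} - U" "\<lambda>_. 2::nat" "\<lambda>x. tshare n w p {x}"] tshare_vertex by auto
  moreover have "(\<Sum>x\<in>{..<n} - U. tshare n w p {x}) + (\<Sum>x\<in>U. tshare n w p {x}) = 2 * tour_cost n w p"
  proof -
    have "(\<Sum>x\<in>{..<n} - U. tshare n w p {x}) + (\<Sum>x\<in>U. tshare n w p {x}) = tshare n w p {..<n}"
      using Usub by (simp add: tshare_additive[of "{..<n}"] sum.subset_diff add.commute)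
    also have "\<dots> = (\<Sum>i<n. 2 * w (p i) (p (cnext n i)))"
      unfolding tshare_def using perm_lt[OF p] cnext_lt by (intro sum.cong refl) auto
    finally show ?thesis by (simp add: tour_cost_cnext sum_distrib_left)
  qed
  moreover have "card ({..<n} - U) + card U = n"
    using Usub finU by (metis card_lessThan card_mono card_Diff_subset finite_lessThan le_add_diff_inverse2)
  ultimately have "card U \<le> 20 * (tour_cost n w p - n)" using tour_cost_ge by linarith
  then show ?thesis using cd by simp
qed

text \<open>Count endpoints of tour steps. A unit step from an isolated vertex ends outside
  \<open>A\<close>, and a longer step pays for its two endpoints with its own excess. Every vertex
  is an endpoint twice.\<close>

lemma isolated_le:
  assumes A: "A \<subseteq> {..<n}"
  shows "card {v \<in> A. \<forall>u\<in>A. w v u \<noteq> 1} \<le> card ({..<n} - A) + (tour_cost n w p - n)"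
proof -
  define I where "I = {v \<in> A. \<forall>u\<in>A. w v u \<noteq> 1}"
  define Fz where "Fz = {..<n} - A"
  let ?c = "\<lambda>S i. of_bool (p i \<in> S) + of_bool (p (cnext n i) \<in> S) :: nat"
  have "(\<Sum>i<n. ?c I i) \<le> (\<Sum>i<n. ?c Fz i + 2 * (w (p i) (p (cnext n i)) - 1))"
  proof (rule sum_mono)
    fix i assume "i \<in> {..<n}"
    then have l: "p i < n" "p (cnext n i) < n" and w1: "1 \<le> w (p i) (p (cnext n i))"
      using perm_lt[OF p] cnext_lt tour_edge_pos by auto
    show "?c I i \<le> ?c Fz i + 2 * (w (p i) (p (cnext n i)) - 1)"
    proof (cases "w (p i) (p (cnext n i)) = 1")
      case True
      then have "w (p (cnext n i)) (p i) = 1" using w_sym[OF met] l by metis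
      then show ?thesis using True l by (auto simp: I_def Fz_def)
    next
      case False
      have "?c I i \<le> 2" by simp
      then show ?thesis using False w1 by linarith
    qed
  qed
  then have le: "(\<Sum>i<n. ?c I i) \<le> (\<Sum>i<n. ?c Fz i) + 2 * (\<Sum>i<n. w (p i) (p (cnext n i)) - 1)"
    by (simp only: sum.distrib[of _ _ "{..<n}"] sum_distrib_left)
  have dbl: "(\<Sum>i<n. ?c S i) = 2 * card S" if "S \<subseteq> {..<n}" for S
    unfolding sum.distrib sum_perm[OF p that] by simp
  have "(\<Sum>i<n. w (p i) (p (cnext n i)) - 1) = tour_cost n w p - n"
    using tour_edge_pos unfolding tour_cost_cnext by (subst sum_subtractf_nat) auto
  moreover have "I \<subseteq> {..<n}" "Fz \<subseteq> {..<n}" using A by (auto simp: I_def Fz_def)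
  ultimately have "2 * card I \<le> 2 * card Fz + 2 * (tour_cost n w p - n)"
    using le dbl[of I] dbl[of Fz] by simp
  then show ?thesis by (simp add: I_def Fz_def)
qed

text \<open>The tour is rotated to start at 0 before it is shortcut, because the sampled test fixes
  0 as the base point.\<close>

lemma tour_on_subset:
  assumes S: "S \<subseteq> {..<n}"
  obtains xs where "distinct xs" "set xs = S - {0}" "wcost w (0 # xs @ [0]) \<le> tour_cost n w p"
proof -
  have sp: "set (map p [0..<n]) = {..<n}" using permutes_image[OF p] by (simp add: atLeast0LessThan)
  then have "0 \<in> set (map p [0..<n])" using n0 by simp
  then obtain as bs where ab: "map p [0..<n] = as @ 0 # bs" by (meson split_list)
  have p0: "p 0 = hd (as @ [0])"
  proof -
    have "p 0 = hd (map p [0..<n])" using n0 by (simp add: hd_map)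
    then show ?thesis unfolding ab by (cases as) auto
  qed
  have "tour_cost n w p = wcost w (as @ 0 # bs @ [hd (as @ [0])])"
    using tour_cost_eq_wcost[OF n0, of w p] ab p0 by simp
  also have "\<dots> = wcost w (0 # (bs @ as) @ [0])"
  proof (cases as)
    case (Cons a as')
    then show ?thesis using wcost_append[of w as 0 "bs @ [a]"] wcost_append[of w "0 # bs" a "as' @ [0]"] by simp
  qed simp
  finally have c: "tour_cost n w p = wcost w (0 # (bs @ as) @ [0])" .
  have "set (bs @ as) \<subseteq> {..<n}" "S \<subseteq> insert 0 (set (bs @ as))" proof -
    have e: "insert 0 (set (bs @ as)) = {..<n}" using sp[unfolded ab] by (simp add: Un_commute)
    show "set (bs @ as) \<subseteq> {..<n}" using e by (metis subset_insertI)
    show "S \<subseteq> insert 0 (set (bs @ as))" unfolding e by (rule S)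
  qed
  then obtain xs where "distinct xs" "set xs = S - {0}" "wcost w (0 # xs @ [0]) \<le> wcost w (0 # (bs @ as) @ [0])"
    by (rule closed_walk_shortcut[OF met n0])
  then show ?thesis using that c by simp
qed

end

lemma TSP_ge:
  assumes "pos_int_metric n w" "2 \<le> n" "promise n w"
  shows "n \<le> TSP n w"
proof -
  obtain par lev where "utree n par lev w" using promise_imp_utree assms by (metis gr0I not_numeral_le_zero)
  then interpret utree n par lev w .
  obtain p where t: "p permutes {..<n}" "TSP n w = tour_cost n w p" using TSP_attained by blast
  then interpret good_tour n par lev w p using assms by unfold_locales auto
  show ?thesis using tour_cost_ge t by simp
qed

section \<open>Expectations over finitely supported distributions\<close>

abbreviation ex :: "'a pmf \<Rightarrow> ('a \<Rightarrow> real) \<Rightarrow> real" where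
  "ex M f \<equiv> measure_pmf.expectation M f"

lemma ex_mono:
  assumes "finite (set_pmf M)" "\<And>x. x \<in> set_pmf M \<Longrightarrow> f x \<le> g x"
  shows "ex M f \<le> ex M g"
  using assms by (intro integral_mono_AE integrable_measure_pmf_finite) (auto simp: AE_measure_pmf_iff)

lemma ex_cong: "(\<And>x. x \<in> set_pmf M \<Longrightarrow> f x = g x) \<Longrightarrow> ex M f = ex M g"
  by (intro integral_cong_AE) (auto simp: AE_measure_pmf_iff)

lemma ex_add: "finite (set_pmf M) \<Longrightarrow> ex M (\<lambda>x. f x + g x) = ex M f + ex M g"
  by (intro Bochner_Integration.integral_add integrable_measure_pmf_finite)

lemma ex_sum: "finite (set_pmf M) \<Longrightarrow> ex M (\<lambda>x. \<Sum>i\<in>I. f i x) = (\<Sum>i\<in>I. ex M (f i))"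
  by (intro Bochner_Integration.integral_sum integrable_measure_pmf_finite)

lemma ex_cmult: "ex M (\<lambda>x. c * f x) = c * ex M f"
  by simp

lemma ex_bind:
  assumes "finite (set_pmf M)" "\<And>x. x \<in> set_pmf M \<Longrightarrow> finite (set_pmf (N x))"
  shows "ex (bind_pmf M N) f = ex M (\<lambda>x. ex (N x) f)"
  using assms by (subst pmf_expectation_bind[of "set_pmf M"], simp, simp, simp, subst integral_measure_pmf[of "set_pmf M"]) auto

lemma prob_ex: "measure_pmf.prob M {x. P x} = ex M (\<lambda>x. of_bool (P x))"
proof -
  have "ex M (\<lambda>x. of_bool (P x)) = ex M (indicat_real {x. P x})"
    by (intro Bochner_Integration.integral_cong) (auto simp: indicator_def)
  then show ?thesis by simp
qed

lemma prob_markov: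
  assumes "finite (set_pmf M)" "\<And>x. x \<in> set_pmf M \<Longrightarrow> 0 \<le> f x" "\<And>x. x \<in> set_pmf M \<Longrightarrow> P x \<Longrightarrow> t \<le> f x" "0 < t"
  shows "measure_pmf.prob M {x. P x} \<le> ex M f / t"
proof -
  have "measure_pmf.prob M {x. P x} \<le> ex M (\<lambda>x. 1 / t * f x)"
    unfolding prob_ex using assms by (intro ex_mono) (auto simp: field_simps)
  also have "\<dots> = ex M f / t" by simp
  finally show ?thesis .
qed

section \<open>Random subsets\<close>

definition rset :: "nat \<Rightarrow> real \<Rightarrow> nat set pmf" where
  "rset n p = map_pmf (\<lambda>f. {v. v < n \<and> f v}) (Pi_pmf {..<n} False (\<lambda>_. bernoulli_pmf p))"

lemma set_rset: "set_pmf (rset n p) \<subseteq> Pow {..<n}"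
  by (auto simp: rset_def)

lemma finite_rset: "finite (set_pmf (rset n p))"
  using set_rset finite_subset by (metis finite_Pow_iff finite_lessThan)

lemma rset_prod:
  assumes p: "0 \<le> p" "p \<le> 1" and f: "\<And>x b. 0 \<le> f x b"
  shows "ex (rset n p) (\<lambda>R. \<Prod>x<n. f x (x \<in> R)) = (\<Prod>x<n. f x True * p + f x False * (1 - p))"
proof -
  have "ex (rset n p) (\<lambda>R. \<Prod>x<n. f x (x \<in> R)) = ex (Pi_pmf {..<n} False (\<lambda>_. bernoulli_pmf p)) (\<lambda>g. \<Prod>x<n. f x (g x))"
    unfolding rset_def integral_map_pmf by (intro Bochner_Integration.integral_cong refl prod.cong) auto
  also have "\<dots> = (\<Prod>x<n. ex (bernoulli_pmf p) (\<lambda>b. f x b))"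
    using f by (intro expectation_prod_Pi_pmf) (auto intro!: integrable_measure_pmf_finite)
  finally show ?thesis using p by simp
qed

lemma ex_rset_avoid:
  assumes p: "0 \<le> p" "p \<le> 1" and A: "A \<subseteq> {..<n}"
  shows "ex (rset n p) (\<lambda>R. of_bool (R \<inter> A = {})) = (1 - p) ^ card A"
proof -
  define f :: "nat \<Rightarrow> bool \<Rightarrow> real" where "f x b = (if x \<in> A \<and> b then 0 else 1)" for x b
  have "ex (rset n p) (\<lambda>R. of_bool (R \<inter> A = {})) = ex (rset n p) (\<lambda>R. \<Prod>x<n. f x (x \<in> R))"
  proof (rule ex_cong)
    fix R
    show "of_bool (R \<inter> A = {}) = (\<Prod>x<n. f x (x \<in> R))"
    proof (cases "R \<inter> A = {}")
      case True
      then have "(\<Prod>x<n. f x (x \<in> R)) = 1" by (intro prod.neutral) (auto simp: f_def)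
      then show ?thesis using True by simp
    next
      case False
      then obtain x where "x \<in> R" "x \<in> A" by auto
      then have "(\<Prod>x<n. f x (x \<in> R)) = 0" using A by (intro prod_zero) (auto simp: f_def)
      then show ?thesis using False by simp
    qed
  qed
  also have "\<dots> = (\<Prod>x<n. f x True * p + f x False * (1 - p))" using p by (intro rset_prod) (auto simp: f_def)
  also have "\<dots> = (\<Prod>x<n. if x \<in> A then 1 - p else 1)" by (intro prod.cong) (auto simp: f_def)
  also have "\<dots> = (1 - p) ^ card A" using A by (simp add: prod.If_cases Int_absorb1)
  finally show ?thesis .
qed

text \<open>For \<open>y\<close> in \<open>A\<close> the product vanishes; otherwise the two events
  are independent.\<close>

lemma ex_rset_avoid_mem:
  assumes p: "0 \<le> p" "p \<le> 1" and A: "A \<subseteq> {..<n}" and y: "y < n"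
  shows "ex (rset n p) (\<lambda>R. of_bool (R \<inter> A = {}) * of_bool (y \<in> R)) \<le> p * (1 - p) ^ card A"
proof (cases "y \<in> A")
  case True
  have "ex (rset n p) (\<lambda>R. of_bool (R \<inter> A = {}) * of_bool (y \<in> R)) = ex (rset n p) (\<lambda>R. 0)"
    using True by (intro ex_cong) auto
  then show ?thesis using p by simp
next
  case False
  have "ex (rset n p) (\<lambda>R. of_bool (R \<inter> A = {}) * of_bool (y \<in> R))
      = ex (rset n p) (\<lambda>R. of_bool (R \<inter> A = {}) + -1 * of_bool (R \<inter> insert y A = {}))"
    by (intro ex_cong) (auto simp: of_bool_def)
  also have "\<dots> = (1 - p) ^ card A + -1 * (1 - p) ^ card (insert y A)"
    by (subst ex_add[OF finite_rset], subst ex_cmult, subst (1 2) ex_rset_avoid) (use p A y in auto)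
  also have "\<dots> = p * (1 - p) ^ card A"
    using False A finite_subset[OF A] by (simp add: algebra_simps)
  finally show ?thesis by simp
qed

lemma ex_rset_mem:
  assumes p: "0 \<le> p" "p \<le> 1" and y: "y < n"
  shows "ex (rset n p) (\<lambda>R. of_bool (y \<in> R)) = p"
proof -
  have "ex (rset n p) (\<lambda>R. of_bool (y \<in> R)) = ex (rset n p) (\<lambda>R. 1 + -1 * of_bool (R \<inter> {y} = {}))"
    by (intro ex_cong) (auto simp: of_bool_def)
  also have "\<dots> = 1 + -1 * (1 - p) ^ card {y}"
    by (subst ex_add[OF finite_rset], subst ex_cmult, subst ex_rset_avoid) (use p y in auto)
  finally show ?thesis by simp
qed

lemma ex_rset_lin:
  assumes p: "0 \<le> p" "p \<le> 1"
  shows "ex (rset n p) (\<lambda>R. a + (\<Sum>y<n. b y * of_bool (y \<in> R))) = a + p * (\<Sum>y<n. b y)"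
proof -
  have "ex (rset n p) (\<lambda>R. a + (\<Sum>y<n. b y * of_bool (y \<in> R))) = a + (\<Sum>y<n. ex (rset n p) (\<lambda>R. b y * of_bool (y \<in> R)))"
    by (subst ex_add[OF finite_rset], subst ex_sum[OF finite_rset]) simp
  also have "(\<Sum>y<n. ex (rset n p) (\<lambda>R. b y * of_bool (y \<in> R))) = (\<Sum>y<n. b y * p)"
    by (intro sum.cong refl, subst ex_cmult, subst ex_rset_mem) (use p in auto)
  finally show ?thesis by (simp add: sum_distrib_left mult.commute)
qed

lemma ex_rset_avoid_lin:
  assumes p: "0 \<le> p" "p \<le> 1" and A: "A \<subseteq> {..<n}" and ab: "0 \<le> a" "\<And>y. 0 \<le> b y"
  shows "ex (rset n p) (\<lambda>R. of_bool (R \<inter> A = {}) * (a + (\<Sum>y<n. b y * of_bool (y \<in> R))))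
    \<le> (1 - p) ^ card A * (a + p * (\<Sum>y<n. b y))"
proof -
  have "ex (rset n p) (\<lambda>R. of_bool (R \<inter> A = {}) * (a + (\<Sum>y<n. b y * of_bool (y \<in> R))))
    = ex (rset n p) (\<lambda>R. a * of_bool (R \<inter> A = {}) + (\<Sum>y<n. b y * (of_bool (R \<inter> A = {}) * of_bool (y \<in> R))))"
    by (intro ex_cong) (simp add: algebra_simps sum_distrib_left)
  also have "\<dots> = a * ex (rset n p) (\<lambda>R. of_bool (R \<inter> A = {})) + (\<Sum>y<n. b y * ex (rset n p) (\<lambda>R. of_bool (R \<inter> A = {}) * of_bool (y \<in> R)))"
    unfolding ex_add[OF finite_rset] ex_sum[OF finite_rset] ex_cmult ..
  also have "\<dots> \<le> a * (1 - p) ^ card A + (\<Sum>y<n. b y * (p * (1 - p) ^ card A))"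
    using ab ex_rset_avoid_mem[OF p A] ex_rset_avoid[OF p A]
    by (intro add_mono sum_mono mult_left_mono) auto
  also have "\<dots> = (1 - p) ^ card A * (a + p * (\<Sum>y<n. b y))"
    by (simp add: algebra_simps sum_distrib_left)
  finally show ?thesis .
qed

lemma power_exp_le:
  fixes p :: real
  assumes "0 \<le> p" "p \<le> 1"
  shows "(1 - p) ^ d \<le> exp (- (p * real d))"
proof -
  have "(1 - p) ^ d \<le> exp (- p) ^ d"
    using assms exp_ge_add_one_self[of "- p"] by (intro power_mono) auto
  then show ?thesis by (simp add: exp_of_nat_mult[symmetric] mult.commute)
qed

text \<open>With \<open>t = p * d\<close> this is \<open>2 * t <= 1 + t + t^2 / 2 <= exp t\<close>.
  A degree multiplied by its survival probability is thus at most half the inverse rate, whatever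
  the degree.\<close>

lemma deg_survive_le:
  fixes p :: real
  assumes "0 < p" "p \<le> 1"
  shows "real d * (1 - p) ^ d \<le> 1 / (2 * p)"
proof -
  define t where "t = p * real d"
  have t0: "0 \<le> t" using assms by (simp add: t_def)
  have "2 * t \<le> 1 + t + t\<^sup>2 / 2" using sum_power2_ge_zero[of "t - 1" 0] zero_le_power2[of "t - 1"] by (simp add: power2_eq_square algebra_simps)
  also have "\<dots> \<le> exp t" by (rule exp_lower_Taylor_quadratic[OF t0])
  finally have "2 * t * exp (- t) \<le> 1" by (simp add: exp_minus field_simps)
  moreover have "t * (1 - p) ^ d \<le> t * exp (- t)"
    using power_exp_le[of p d] assms t0 by (intro mult_left_mono) (auto simp: t_def)
  ultimately have "2 * t * (1 - p) ^ d \<le> 1" by linarith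
  then show ?thesis using assms by (simp add: t_def field_simps)
qed

lemma survive_le:
  fixes p :: real
  assumes "0 \<le> p" "p \<le> 1"
  shows "(1 - p) ^ d \<le> 1 - min 1 (p * real d) / 2"
proof -
  define t where "t = p * real d"
  have t0: "0 \<le> t" using assms by (simp add: t_def)
  have "exp (- t) \<le> 1 - min 1 t / 2"
  proof (cases "t \<le> 1")
    case True
    \<comment> \<open>The product equals \<open>1 + t * (1 - t) / 2\<close>.\<close>
    have "(1 + t) * (1 - t / 2) \<ge> 1" using True t0 mult_nonneg_nonneg[of t "1 - t"] by (simp add: algebra_simps power2_eq_square)
    moreover have "(1 + t) * (1 - t / 2) \<le> exp t * (1 - t / 2)"
      using True exp_ge_add_one_self[of t] by (intro mult_right_mono) auto
    ultimately have "1 \<le> exp t * (1 - t / 2)" by linarith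
    then show ?thesis using True by (simp add: exp_minus field_simps)
  next
    case False
    then have "2 \<le> exp t" using exp_ge_add_one_self[of t] by linarith
    then show ?thesis using False by (simp add: exp_minus field_simps)
  qed
  then show ?thesis using power_exp_le[OF assms, of d] by (simp add: t_def)
qed

section \<open>The freezing process\<close>

definition nb :: "nat \<Rightarrow> (nat \<Rightarrow> nat \<Rightarrow> nat) \<Rightarrow> nat \<Rightarrow> nat set" where
  "nb n w v = {u. u < n \<and> w v u = 1}"

text \<open>The list of samples is stored with the latest round first.\<close>

fun act :: "nat \<Rightarrow> (nat \<Rightarrow> nat \<Rightarrow> nat) \<Rightarrow> nat set list \<Rightarrow> nat set" where
  "act n w [] = {..<n}"
| "act n w (R # Rs) = {v \<in> act n w Rs. R \<inter> (nb n w v \<inter> act n w Rs) = {}}"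

text \<open>Number of queries needed to determine recursively whether \<open>v\<close> is active, when the outcome
  of the first \<open>g\<close> rounds is known for all vertices.\<close>

fun cst :: "nat \<Rightarrow> (nat \<Rightarrow> nat \<Rightarrow> nat) \<Rightarrow> nat \<Rightarrow> nat set list \<Rightarrow> nat \<Rightarrow> nat" where
  "cst n w g [] v = 0"
| "cst n w g (R # Rs) v = cst n w g Rs v +
     (if g \<le> length Rs \<and> v \<in> act n w Rs then card R + (\<Sum>u\<in>nb n w v \<inter> R. cst n w g Rs u) else 0)"

lemma cst_0: "length Rs \<le> g \<Longrightarrow> cst n w g Rs v = 0"
  by (induction Rs) auto

fun rsets :: "nat \<Rightarrow> (nat \<Rightarrow> real) \<Rightarrow> nat \<Rightarrow> nat set list pmf" where
  "rsets n q 0 = return_pmf []"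
| "rsets n q (Suc i) = bind_pmf (rsets n q i) (\<lambda>Rs. map_pmf (\<lambda>R. R # Rs) (rset n (q i)))"

lemma finite_rsets: "finite (set_pmf (rsets n q i))"
  by (induction i) (auto simp: finite_rset)

lemma set_rsets: "Rs \<in> set_pmf (rsets n q i) \<Longrightarrow> length Rs = i \<and> set Rs \<subseteq> Pow {..<n}"
proof (induction i arbitrary: Rs)
  case (Suc i)
  then show ?case using set_rset by fastforce
qed simp

lemma ex_rsets_Suc: "ex (rsets n q (Suc i)) f = ex (rsets n q i) (\<lambda>Rs. ex (rset n (q i)) (\<lambda>R. f (R # Rs)))"
proof -
  have "ex (rsets n q (Suc i)) f = ex (rsets n q i) (\<lambda>Rs. ex (map_pmf (\<lambda>R. R # Rs) (rset n (q i))) f)"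
    unfolding rsets.simps by (rule ex_bind) (auto simp: finite_rsets finite_rset)
  then show ?thesis by simp
qed

section \<open>Expected cost of the recursive exploration\<close>

locale frz =
  fixes n :: nat and w :: "nat \<Rightarrow> nat \<Rightarrow> nat"
  assumes sym: "u < n \<Longrightarrow> v < n \<Longrightarrow> w u v = w v u"
begin

abbreviation "N \<equiv> nb n w"
abbreviation "Act \<equiv> act n w"

definition deg :: "nat set list \<Rightarrow> nat \<Rightarrow> nat" where
  "deg Rs u = card (N u \<inter> Act Rs)"

lemma N_sub: "N v \<subseteq> {..<n}"
  by (auto simp: nb_def)

lemma finite_N [simp]: "finite (N v)"
  using N_sub finite_subset by blast

lemma N_sym: "u < n \<Longrightarrow> v < n \<Longrightarrow> u \<in> N v \<longleftrightarrow> v \<in> N u"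
  using sym by (auto simp: nb_def)

lemma Act_sub: "Act Rs \<subseteq> {..<n}"
  by (induction Rs) auto

lemma finite_Act [simp]: "finite (Act Rs)"
  using Act_sub finite_subset by blast

lemma card_Act: "card (Act Rs) \<le> n"
  using card_mono[OF _ Act_sub[of Rs]] by simp

lemma Act_mono: "Act (R # Rs) \<subseteq> Act Rs"
  by auto

lemma deg_mono: "deg (R # Rs) u \<le> deg Rs u"
  unfolding deg_def using Act_mono by (intro card_mono) auto

lemma N_swap:
  fixes k :: "nat \<Rightarrow> nat \<Rightarrow> real"
  assumes "A \<subseteq> {..<n}" "B \<subseteq> {..<n}"
  shows "(\<Sum>v\<in>A. \<Sum>u\<in>N v \<inter> B. k v u) = (\<Sum>u\<in>B. \<Sum>v\<in>N u \<inter> A. k v u)"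
proof -
  have fin: "finite A" "finite B" using assms finite_subset by blast+
  have "(\<Sum>v\<in>A. \<Sum>u\<in>N v \<inter> B. k v u) = (\<Sum>v\<in>A. \<Sum>u\<in>B. if u \<in> N v then k v u else 0)"
    using fin by (intro sum.cong[OF refl[of A]]) (simp add: sum.If_cases Int_commute)
  also have "\<dots> = (\<Sum>u\<in>B. \<Sum>v\<in>A. if u \<in> N v then k v u else 0)" by (rule sum.swap)
  also have "\<dots> = (\<Sum>u\<in>B. \<Sum>v\<in>A. if v \<in> N u then k v u else 0)"
    using assms N_sym by (intro sum.cong refl if_cong) blast+
  also have "\<dots> = (\<Sum>u\<in>B. \<Sum>v\<in>N u \<inter> A. k v u)"
    using fin by (intro sum.cong[OF refl[of B]]) (simp add: sum.If_cases Int_commute)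
  finally show ?thesis .
qed

lemma N_swap_deg:
  assumes "B \<subseteq> {..<n}"
  shows "(\<Sum>v\<in>Act Rs. \<Sum>u\<in>N v \<inter> B. h u) = (\<Sum>u\<in>B. real (deg Rs u) * h u)"
  using N_swap[OF Act_sub assms, where k = "\<lambda>v u. h u"] by (simp add: deg_def)

lemma sum_Act: "(\<Sum>v<n. if v \<in> Act Rs then f v else 0) = (\<Sum>v\<in>Act Rs. f v :: real)"
  using Act_sub[of Rs] by (simp add: sum.If_cases Int_absorb1)

lemma sum_Act_Cons: "(\<Sum>u\<in>Act (R # Rs). f u) = (\<Sum>u\<in>Act Rs. if R \<inter> (N u \<inter> Act Rs) = {} then f u else 0 :: real)"
  unfolding act.simps by (rule sum.inter_filter[OF finite_Act])

text \<open>What an active \<open>v\<close> pays in the next round if \<open>y\<close> is sampled: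
  one query for the pair, and the recursion of \<open>y\<close> if \<open>y\<close> turns out to be
  a neighbour.\<close>

definition \<beta> :: "nat \<Rightarrow> nat set list \<Rightarrow> nat \<Rightarrow> nat \<Rightarrow> real" where
  "\<beta> g Rs v y = 1 + of_bool (y \<in> N v) * real (cst n w g Rs y)"

text \<open>The sum of \<open>\<beta>\<close> over all \<open>y\<close>: the expected next-round
  cost of an active \<open>v\<close> per unit of sampling rate.\<close>

definition \<kappa> :: "nat \<Rightarrow> nat set list \<Rightarrow> nat \<Rightarrow> real" where
  "\<kappa> g Rs v = real n + (\<Sum>x\<in>N v. real (cst n w g Rs x))"

text \<open>Three moments of the cost that close up under a round: \<open>Psi\<close> drives the
  growth of \<open>Phi\<close>, and \<open>Om\<close> that of \<open>Psi\<close>. The chain stops at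
  \<open>Om\<close>, where the survival probability absorbs the degree factor.\<close>

definition Phi :: "nat \<Rightarrow> nat set list \<Rightarrow> real" where
  "Phi g Rs = (\<Sum>v<n. real (cst n w g Rs v))"

definition Psi :: "nat \<Rightarrow> nat set list \<Rightarrow> real" where
  "Psi g Rs = (\<Sum>u<n. real (deg Rs u) * real (cst n w g Rs u))"

definition Om :: "nat \<Rightarrow> nat set list \<Rightarrow> real" where
  "Om g Rs = (\<Sum>u\<in>Act Rs. real (deg Rs u) * \<kappa> g Rs u)"

lemma sum_beta: "(\<Sum>y<n. \<beta> g Rs v y) = \<kappa> g Rs v"
proof -
  have "(\<Sum>y<n. of_bool (y \<in> N v) * real (cst n w g Rs y)) = (\<Sum>y<n. if y \<in> N v then real (cst n w g Rs y) else 0)"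
    by (intro sum.cong) auto
  also have "\<dots> = (\<Sum>x\<in>N v. real (cst n w g Rs x))"
    using N_sub[of v] by (simp add: sum.If_cases Int_absorb1)
  finally show ?thesis by (simp add: \<beta>_def \<kappa>_def sum.distrib)
qed

text \<open>The new cost is affine in the indicators of the new sample, so expectations can be taken
  termwise.\<close>

lemma cst_step:
  assumes "R \<subseteq> {..<n}" "g \<le> length Rs"
  shows "real (cst n w g (R # Rs) v) = real (cst n w g Rs v) + of_bool (v \<in> Act Rs) * (\<Sum>y<n. \<beta> g Rs v y * of_bool (y \<in> R))"
proof -
  have fR: "finite R" using assms finite_subset by blast
  have "(\<Sum>y<n. \<beta> g Rs v y * of_bool (y \<in> R)) = (\<Sum>y<n. if y \<in> R then 1 + of_bool (y \<in> N v) * real (cst n w g Rs y) else 0)"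
    by (intro sum.cong) (auto simp: \<beta>_def)
  also have "\<dots> = (\<Sum>y\<in>R. 1 + of_bool (y \<in> N v) * real (cst n w g Rs y))"
    using assms(1) by (simp add: sum.If_cases Int_absorb1)
  also have "\<dots> = real (card R) + (\<Sum>y\<in>R. if y \<in> N v then real (cst n w g Rs y) else 0)"
    by (simp add: sum.distrib if_distrib of_bool_def) (intro sum.cong, auto)
  also have "\<dots> = real (card R) + (\<Sum>u\<in>N v \<inter> R. real (cst n w g Rs u))"
    using fR by (simp add: sum.If_cases Int_commute)
  finally show ?thesis using assms(2) by simp
qed

context
  fixes p :: real and g :: nat and Rs :: "nat set list"
  assumes p: "0 < p" "p \<le> 1" and g: "g \<le> length Rs"
begin

private lemma p0: "0 \<le> p" using p by simp

lemma Phi_step: "ex (rset n p) (\<lambda>R. Phi g (R # Rs)) \<le> Phi g Rs + p * (real n ^ 2 + Psi g Rs)"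
proof -
  have "ex (rset n p) (\<lambda>R. Phi g (R # Rs))
    = ex (rset n p) (\<lambda>R. Phi g Rs + (\<Sum>y<n. (\<Sum>v\<in>Act Rs. \<beta> g Rs v y) * of_bool (y \<in> R)))"
  proof (rule ex_cong)
    fix R assume "R \<in> set_pmf (rset n p)"
    then have R: "R \<subseteq> {..<n}" using set_rset by blast
    have "Phi g (R # Rs) = Phi g Rs + (\<Sum>v<n. if v \<in> Act Rs then (\<Sum>y<n. \<beta> g Rs v y * of_bool (y \<in> R)) else 0)"
      unfolding Phi_def cst_step[OF R g] sum.distrib by (intro arg_cong2[of _ _ _ _ "(+)"] refl sum.cong) auto
    also have "(\<Sum>v<n. if v \<in> Act Rs then (\<Sum>y<n. \<beta> g Rs v y * of_bool (y \<in> R)) else 0) = (\<Sum>v\<in>Act Rs. \<Sum>y<n. \<beta> g Rs v y * of_bool (y \<in> R))"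
      by (rule sum_Act)
    also have "\<dots> = (\<Sum>y<n. \<Sum>v\<in>Act Rs. \<beta> g Rs v y * of_bool (y \<in> R))" by (rule sum.swap)
    finally show "Phi g (R # Rs) = Phi g Rs + (\<Sum>y<n. (\<Sum>v\<in>Act Rs. \<beta> g Rs v y) * of_bool (y \<in> R))"
      by (simp add: sum_distrib_right)
  qed
  also have "\<dots> = Phi g Rs + p * (\<Sum>y<n. \<Sum>v\<in>Act Rs. \<beta> g Rs v y)" by (rule ex_rset_lin[OF p0 p(2)])
  also have "(\<Sum>y<n. \<Sum>v\<in>Act Rs. \<beta> g Rs v y) = (\<Sum>v\<in>Act Rs. \<kappa> g Rs v)"
    by (subst sum.swap) (simp add: sum_beta)
  also have "\<dots> = real (card (Act Rs)) * real n + Psi g Rs"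
    using N_swap_deg[of "{..<n}" "\<lambda>u. real (cst n w g Rs u)" Rs] N_sub
    by (simp add: \<kappa>_def sum.distrib Psi_def Int_absorb2)
  also have "real (card (Act Rs)) * real n \<le> real n ^ 2"
    using card_Act[of Rs] by (simp add: power2_eq_square mult_right_mono)
  finally show ?thesis using p by (simp add: mult_left_mono)
qed

lemma Psi_step: "ex (rset n p) (\<lambda>R. Psi g (R # Rs)) \<le> Psi g Rs + p * Om g Rs"
proof -
  have "ex (rset n p) (\<lambda>R. Psi g (R # Rs))
    \<le> ex (rset n p) (\<lambda>R. Psi g Rs + (\<Sum>y<n. (\<Sum>v\<in>Act Rs. real (deg Rs v) * \<beta> g Rs v y) * of_bool (y \<in> R)))"
  proof (rule ex_mono[OF finite_rset])
    fix R assume "R \<in> set_pmf (rset n p)"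
    then have R: "R \<subseteq> {..<n}" using set_rset by blast
    have "Psi g (R # Rs) \<le> (\<Sum>v<n. real (deg Rs v) * real (cst n w g (R # Rs) v))"
      unfolding Psi_def using deg_mono by (intro sum_mono mult_right_mono) auto
    also have "\<dots> = Psi g Rs + (\<Sum>v<n. if v \<in> Act Rs then real (deg Rs v) * (\<Sum>y<n. \<beta> g Rs v y * of_bool (y \<in> R)) else 0)"
      unfolding Psi_def cst_step[OF R g] distrib_left sum.distrib by (intro arg_cong2[of _ _ _ _ "(+)"] refl sum.cong) auto
    also have "(\<Sum>v<n. if v \<in> Act Rs then real (deg Rs v) * (\<Sum>y<n. \<beta> g Rs v y * of_bool (y \<in> R)) else 0)
      = (\<Sum>v\<in>Act Rs. \<Sum>y<n. real (deg Rs v) * \<beta> g Rs v y * of_bool (y \<in> R))"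
      unfolding sum_Act sum_distrib_left mult.assoc ..
    also have "\<dots> = (\<Sum>y<n. \<Sum>v\<in>Act Rs. real (deg Rs v) * \<beta> g Rs v y * of_bool (y \<in> R))" by (rule sum.swap)
    finally show "Psi g (R # Rs) \<le> Psi g Rs + (\<Sum>y<n. (\<Sum>v\<in>Act Rs. real (deg Rs v) * \<beta> g Rs v y) * of_bool (y \<in> R))"
      by (simp add: sum_distrib_right)
  qed
  also have "\<dots> = Psi g Rs + p * (\<Sum>y<n. \<Sum>v\<in>Act Rs. real (deg Rs v) * \<beta> g Rs v y)" by (rule ex_rset_lin[OF p0 p(2)])
  also have "(\<Sum>y<n. \<Sum>v\<in>Act Rs. real (deg Rs v) * \<beta> g Rs v y) = Om g Rs"
    by (subst sum.swap) (simp add: sum_distrib_left[symmetric] sum_beta Om_def)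
  finally show ?thesis .
qed

text \<open>The event that \<open>u\<close> survives is negatively correlated with every vertex being sampled, and
  it has probability \<open>(1 - p) ^ deg u\<close>.\<close>

lemma Om_step: "ex (rset n p) (\<lambda>R. Om g (R # Rs)) \<le> 1 / (2 * p) * (real n ^ 2 + Psi g Rs + p * Om g Rs)"
proof -
  \<comment> \<open>The growth of \<open>\<kappa> g Rs u\<close> caused by sampling
    \<open>y\<close>, collected from the active neighbours of \<open>u\<close>.\<close>
  define \<gamma> where "\<gamma> u y = (\<Sum>x\<in>N u \<inter> Act Rs. \<beta> g Rs x y)" for u y
  have \<beta>0: "0 \<le> \<beta> g Rs x y" for x y by (simp add: \<beta>_def)
  have \<gamma>0: "0 \<le> \<gamma> u y" for u y unfolding \<gamma>_def by (intro sum_nonneg \<beta>0)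
  have \<kappa>0: "0 \<le> \<kappa> g Rs u" for u by (simp add: \<kappa>_def sum_nonneg)
  have "ex (rset n p) (\<lambda>R. Om g (R # Rs)) \<le> ex (rset n p) (\<lambda>R. \<Sum>u\<in>Act Rs. real (deg Rs u) *
      (of_bool (R \<inter> (N u \<inter> Act Rs) = {}) * (\<kappa> g Rs u + (\<Sum>y<n. \<gamma> u y * of_bool (y \<in> R)))))"
  proof (rule ex_mono[OF finite_rset])
    fix R assume "R \<in> set_pmf (rset n p)"
    then have R: "R \<subseteq> {..<n}" using set_rset by blast
    have k: "\<kappa> g (R # Rs) u = \<kappa> g Rs u + (\<Sum>y<n. \<gamma> u y * of_bool (y \<in> R))" for u
    proof -
      have "(\<Sum>x\<in>N u. real (cst n w g (R # Rs) x)) = (\<Sum>x\<in>N u. real (cst n w g Rs x)) +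
          (\<Sum>x\<in>N u. if x \<in> Act Rs then (\<Sum>y<n. \<beta> g Rs x y * of_bool (y \<in> R)) else 0)"
        unfolding cst_step[OF R g] sum.distrib by (intro arg_cong2[of _ _ _ _ "(+)"] refl sum.cong) auto
      also have "(\<Sum>x\<in>N u. if x \<in> Act Rs then (\<Sum>y<n. \<beta> g Rs x y * of_bool (y \<in> R)) else 0)
        = (\<Sum>x\<in>N u \<inter> Act Rs. \<Sum>y<n. \<beta> g Rs x y * of_bool (y \<in> R))"
        by (simp add: sum.If_cases)
      also have "\<dots> = (\<Sum>y<n. \<gamma> u y * of_bool (y \<in> R))"
        unfolding \<gamma>_def by (subst sum.swap) (simp add: sum_distrib_right)
      finally show ?thesis by (simp add: \<kappa>_def)
    qed
    have "Om g (R # Rs) = (\<Sum>u\<in>Act Rs. if R \<inter> (N u \<inter> Act Rs) = {} then real (deg (R # Rs) u) * \<kappa> g (R # Rs) u else 0)"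
      unfolding Om_def by (rule sum_Act_Cons)
    also have "\<dots> \<le> (\<Sum>u\<in>Act Rs. real (deg Rs u) *
      (of_bool (R \<inter> (N u \<inter> Act Rs) = {}) * (\<kappa> g Rs u + (\<Sum>y<n. \<gamma> u y * of_bool (y \<in> R)))))"
    proof (rule sum_mono)
      fix u
      have "real (deg (R # Rs) u) * \<kappa> g (R # Rs) u \<le> real (deg Rs u) * \<kappa> g (R # Rs) u"
        using deg_mono by (intro mult_right_mono) (auto simp: \<kappa>_def sum_nonneg)
      then show "(if R \<inter> (N u \<inter> Act Rs) = {} then real (deg (R # Rs) u) * \<kappa> g (R # Rs) u else 0)
         \<le> real (deg Rs u) * (of_bool (R \<inter> (N u \<inter> Act Rs) = {}) * (\<kappa> g Rs u + (\<Sum>y<n. \<gamma> u y * of_bool (y \<in> R))))"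
        unfolding k by simp
    qed
    finally show "Om g (R # Rs) \<le> (\<Sum>u\<in>Act Rs. real (deg Rs u) *
      (of_bool (R \<inter> (N u \<inter> Act Rs) = {}) * (\<kappa> g Rs u + (\<Sum>y<n. \<gamma> u y * of_bool (y \<in> R)))))" .
  qed
  also have "\<dots> = (\<Sum>u\<in>Act Rs. real (deg Rs u) *
      ex (rset n p) (\<lambda>R. of_bool (R \<inter> (N u \<inter> Act Rs) = {}) * (\<kappa> g Rs u + (\<Sum>y<n. \<gamma> u y * of_bool (y \<in> R)))))"
    unfolding ex_sum[OF finite_rset] ex_cmult ..
  also have "\<dots> \<le> (\<Sum>u\<in>Act Rs. real (deg Rs u) * ((1 - p) ^ deg Rs u * (\<kappa> g Rs u + p * (\<Sum>y<n. \<gamma> u y))))"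
    unfolding deg_def using N_sub \<gamma>0 \<kappa>0 p by (intro sum_mono mult_left_mono ex_rset_avoid_lin) auto
  \<comment> \<open>Here the degree factor disappears: \<open>deg_survive_le\<close> trades it for
    \<open>1 / (2 * p)\<close>.\<close>
  also have "\<dots> \<le> (\<Sum>u\<in>Act Rs. 1 / (2 * p) * (\<kappa> g Rs u + p * (\<Sum>y<n. \<gamma> u y)))"
  proof (rule sum_mono)
    fix u
    have "0 \<le> \<kappa> g Rs u + p * (\<Sum>y<n. \<gamma> u y)" using \<kappa>0 \<gamma>0 p by (simp add: sum_nonneg)
    then show "real (deg Rs u) * ((1 - p) ^ deg Rs u * (\<kappa> g Rs u + p * (\<Sum>y<n. \<gamma> u y))) \<le> 1 / (2 * p) * (\<kappa> g Rs u + p * (\<Sum>y<n. \<gamma> u y))"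
      using mult_right_mono[OF deg_survive_le[OF p, of "deg Rs u"]] by (simp only: mult.assoc)
  qed
  also have "\<dots> = 1 / (2 * p) * ((\<Sum>u\<in>Act Rs. \<kappa> g Rs u) + p * (\<Sum>u\<in>Act Rs. \<Sum>y<n. \<gamma> u y))"
    by (simp only: sum_distrib_left[symmetric] sum.distrib)
  also have "(\<Sum>u\<in>Act Rs. \<Sum>y<n. \<gamma> u y) = Om g Rs"
  proof -
    have "(\<Sum>u\<in>Act Rs. \<Sum>y<n. \<gamma> u y) = (\<Sum>u\<in>Act Rs. \<Sum>x\<in>N u \<inter> Act Rs. \<kappa> g Rs x)"
      unfolding \<gamma>_def by (rule sum.cong[OF refl], subst sum.swap, simp add: sum_beta)
    also have "\<dots> = Om g Rs" unfolding Om_def by (rule N_swap_deg[OF Act_sub])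
    finally show ?thesis .
  qed
  also have "(\<Sum>u\<in>Act Rs. \<kappa> g Rs u) = real (card (Act Rs)) * real n + Psi g Rs"
    using N_swap_deg[of "{..<n}" "\<lambda>u. real (cst n w g Rs u)" Rs] N_sub
    by (simp add: \<kappa>_def sum.distrib Psi_def Int_absorb2)
  also have "1 / (2 * p) * (real (card (Act Rs)) * real n + Psi g Rs + p * Om g Rs) \<le> 1 / (2 * p) * (real n ^ 2 + Psi g Rs + p * Om g Rs)"
    using card_Act[of Rs] p by (intro mult_left_mono) (auto simp: power2_eq_square mult_right_mono)
  finally show ?thesis .
qed

end

text \<open>Start of the recursion: up to round \<open>g\<close> all costs are 0, so
  \<open>\<kappa>\<close> is just n, and one round of freezing already tames the degrees.\<close>

lemma Om_first:
  assumes p: "0 < p" "p \<le> 1" and g: "length Rs < g"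
  shows "ex (rset n p) (\<lambda>R. Om g (R # Rs)) \<le> 1 / (2 * p) * real n ^ 2"
proof -
  have "ex (rset n p) (\<lambda>R. Om g (R # Rs)) \<le> ex (rset n p) (\<lambda>R. \<Sum>u\<in>Act Rs. (real (deg Rs u) * real n) * of_bool (R \<inter> (N u \<inter> Act Rs) = {}))"
  proof (rule ex_mono[OF finite_rset])
    fix R
    have "Om g (R # Rs) = (\<Sum>u\<in>Act Rs. if R \<inter> (N u \<inter> Act Rs) = {} then real (deg (R # Rs) u) * real n else 0)"
      unfolding Om_def \<kappa>_def sum_Act_Cons using g by (simp add: cst_0 del: cst.simps act.simps cong: if_cong)
    also have "\<dots> \<le> (\<Sum>u\<in>Act Rs. (real (deg Rs u) * real n) * of_bool (R \<inter> (N u \<inter> Act Rs) = {}))"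
      using deg_mono by (intro sum_mono) (auto intro!: mult_right_mono)
    finally show "Om g (R # Rs) \<le> (\<Sum>u\<in>Act Rs. (real (deg Rs u) * real n) * of_bool (R \<inter> (N u \<inter> Act Rs) = {}))" .
  qed
  also have "\<dots> = (\<Sum>u\<in>Act Rs. (real (deg Rs u) * real n) * (1 - p) ^ deg Rs u)"
    unfolding ex_sum[OF finite_rset] ex_cmult deg_def
    using p N_sub by (intro sum.cong refl, subst ex_rset_avoid) auto
  also have "\<dots> \<le> (\<Sum>u\<in>Act Rs. real n * (1 / (2 * p)))"
  proof (rule sum_mono)
    fix u
    show "(real (deg Rs u) * real n) * (1 - p) ^ deg Rs u \<le> real n * (1 / (2 * p))"
      using mult_left_mono[OF deg_survive_le[OF p, of "deg Rs u"], of "real n"] by (simp add: mult_ac)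
  qed
  also have "\<dots> = real (card (Act Rs)) * (real n * (1 / (2 * p)))" by simp
  also have "\<dots> \<le> real n * (real n * (1 / (2 * p)))" using card_Act[of Rs] p by (intro mult_right_mono) auto
  finally show ?thesis by (simp add: power2_eq_square)
qed

text \<open>The quantity \<open>n\<^sup>2 + Psi + q i * Om\<close> at most triples in a round, while \<open>q\<close> quadruples.\<close>

lemma expected_cost:
  assumes q: "\<And>i. i < L \<Longrightarrow> 0 < q i \<and> q i \<le> 1" and q4: "\<And>i. q (Suc i) = 4 * q i"
    and g: "0 < g" and "g + k \<le> L"
  shows "real n ^ 2 + ex (rsets n q (g + k)) (Psi g) + q (g + k) * ex (rsets n q (g + k)) (Om g) \<le> 3 * real n ^ 2 * 3 ^ k
    \<and> ex (rsets n q (g + k)) (Phi g) \<le> 3 * real n ^ 2 * 3 ^ k"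
  using assms(4)
proof (induction k)
  case 0
  \<comment> \<open>Since \<open>g > 0\<close> there is a previous round, whose freezing bounds
    \<open>Om\<close> through \<open>Om_first\<close>.\<close>
  obtain g' where g': "g = Suc g'" using g by (cases g) auto
  have a: "ex (rsets n q g) (Psi g) = ex (rsets n q g) (\<lambda>_. 0)"
    by (intro ex_cong) (use set_rsets in \<open>auto simp: Psi_def cst_0\<close>)
  have b: "ex (rsets n q g) (Phi g) = ex (rsets n q g) (\<lambda>_. 0)"
    by (intro ex_cong) (use set_rsets in \<open>auto simp: Phi_def cst_0\<close>)
  have qq: "0 < q g'" "q g' \<le> 1" using q[of g'] 0 g' by auto
  have "ex (rsets n q g) (Om g) \<le> ex (rsets n q g') (\<lambda>_. 1 / (2 * q g') * real n ^ 2)"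
    unfolding g' ex_rsets_Suc using qq set_rsets by (intro ex_mono finite_rsets Om_first) fastforce+
  then have "q g * ex (rsets n q g) (Om g) \<le> q g * (1 / (2 * q g') * real n ^ 2)"
    using qq q4[of g'] g' by (intro mult_left_mono) auto
  also have "\<dots> = 2 * real n ^ 2" using qq q4[of g'] g' by simp
  finally have "q g * ex (rsets n q g) (Om g) \<le> 2 * real n ^ 2" .
  with a b show ?case by simp
next
  case (Suc k)
  define i where "i = g + k"
  define G where "G = 3 * real n ^ 2 * 3 ^ k"
  have qi: "0 < q i" "q i \<le> 1" using q[of i] Suc by (auto simp: i_def)
  let ?E = "ex (rsets n q i)"
  have IH: "real n ^ 2 + ?E (Psi g) + q i * ?E (Om g) \<le> G" "?E (Phi g) \<le> G"
    using Suc by (auto simp: G_def i_def)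
  have len: "g \<le> length Rs" if "Rs \<in> set_pmf (rsets n q i)" for Rs using set_rsets[OF that] by (simp add: i_def)
  have E: "?E (\<lambda>Rs. f Rs + c * (real n ^ 2 + h Rs)) = ?E f + c * (real n ^ 2 + ?E h)" for f h c
    by (simp add: ex_add[OF finite_rsets] del: Bochner_Integration.integral_add)
  have "ex (rsets n q (Suc i)) (Phi g) \<le> ?E (\<lambda>Rs. Phi g Rs + q i * (real n ^ 2 + Psi g Rs))"
    unfolding ex_rsets_Suc using qi len by (intro ex_mono finite_rsets Phi_step)
  also have "\<dots> = ?E (Phi g) + q i * (real n ^ 2 + ?E (Psi g))" by (rule E)
  also have "\<dots> \<le> G + 1 * G"
  proof (intro add_mono mult_mono)
    have "0 \<le> ?E (Om g)"
      by (rule Bochner_Integration.integral_nonneg) (auto simp: Om_def \<kappa>_def intro!: sum_nonneg mult_nonneg_nonneg add_nonneg_nonneg)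
    then have "0 \<le> q i * ?E (Om g)" using qi by simp
    then show "real n ^ 2 + ?E (Psi g) \<le> G" using IH by linarith
    have "0 \<le> ?E (Psi g)"
      by (rule Bochner_Integration.integral_nonneg) (auto simp: Psi_def intro!: sum_nonneg)
    then show "0 \<le> real n ^ 2 + ?E (Psi g)" by simp
  qed (use IH qi in auto)
  finally have 3: "ex (rsets n q (Suc i)) (Phi g) \<le> 2 * G" by simp
  have "ex (rsets n q (Suc i)) (Psi g) \<le> ?E (\<lambda>Rs. Psi g Rs + q i * Om g Rs)"
    unfolding ex_rsets_Suc using qi len by (intro ex_mono finite_rsets Psi_step)
  also have "\<dots> = ?E (Psi g) + q i * ?E (Om g)" unfolding ex_add[OF finite_rsets] ex_cmult ..
  finally have 1: "ex (rsets n q (Suc i)) (Psi g) \<le> ?E (Psi g) + q i * ?E (Om g)" .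
  have "ex (rsets n q (Suc i)) (Om g) \<le> ?E (\<lambda>Rs. 1 / (2 * q i) * (real n ^ 2 + Psi g Rs + q i * Om g Rs))"
    unfolding ex_rsets_Suc using qi len by (intro ex_mono finite_rsets Om_step)
  also have "\<dots> = 1 / (2 * q i) * (real n ^ 2 + ?E (Psi g) + q i * ?E (Om g))"
    unfolding ex_cmult ex_add[OF finite_rsets] by simp
  finally have "q (Suc i) * ex (rsets n q (Suc i)) (Om g) \<le> q (Suc i) * (1 / (2 * q i) * (real n ^ 2 + ?E (Psi g) + q i * ?E (Om g)))"
    using qi q4[of i] by (intro mult_left_mono) auto
  also have "\<dots> = 2 * (real n ^ 2 + ?E (Psi g) + q i * ?E (Om g))" using qi q4[of i] by simp
  finally have 2: "q (Suc i) * ex (rsets n q (Suc i)) (Om g) \<le> 2 * (real n ^ 2 + ?E (Psi g) + q i * ?E (Om g))" .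
  have G0: "0 \<le> G" and G3: "3 * real n ^ 2 * 3 ^ Suc k = 3 * G" by (simp_all add: G_def)
  have gi: "g + Suc k = Suc i" by (simp add: i_def)
  show ?case unfolding gi G3
  proof (rule conjI)
    \<comment> \<open>By fact 1 the first two terms together are at most \<open>G\<close>, and by
      fact 2 the third is at most \<open>2 * G\<close>.\<close>
    show "real n ^ 2 + ex (rsets n q (Suc i)) (Psi g) + q (Suc i) * ex (rsets n q (Suc i)) (Om g) \<le> 3 * G"
      using 1 2 IH(1) by argo
    show "ex (rsets n q (Suc i)) (Phi g) \<le> 3 * G" using 3 G0 by argo
  qed
qed

lemma Om_nonneg: "0 \<le> Om g Rs"
  unfolding Om_def \<kappa>_def by (intro sum_nonneg mult_nonneg_nonneg add_nonneg_nonneg) auto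

text \<open>Sampling every vertex in an extra round tests whether a vertex is isolated among the
  active ones; this round involves no randomness.\<close>

lemma Phi_all:
  assumes "g \<le> length Rs"
  shows "Phi g ({..<n} # Rs) \<le> Phi g Rs + (real n ^ 2 + Psi g Rs)"
proof -
  let ?c = "\<lambda>v. real (cst n w g Rs v)"
  have "Phi g ({..<n} # Rs) = (\<Sum>v<n. ?c v + (if v \<in> Act Rs then real n + (\<Sum>u\<in>N v \<inter> {..<n}. ?c u) else 0))"
    unfolding Phi_def using assms by (intro sum.cong refl) simp
  also have "\<dots> = Phi g Rs + (\<Sum>v\<in>Act Rs. real n + (\<Sum>u\<in>N v \<inter> {..<n}. ?c u))"
    unfolding sum.distrib sum_Act Phi_def ..
  also have "(\<Sum>v\<in>Act Rs. real n + (\<Sum>u\<in>N v \<inter> {..<n}. ?c u)) = real (card (Act Rs)) * real n + Psi g Rs"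
    unfolding sum.distrib N_swap_deg[OF order_refl] Psi_def by simp
  also have "real (card (Act Rs)) * real n \<le> real n * real n"
    using card_Act by (intro mult_right_mono) auto
  finally show ?thesis by (simp add: power2_eq_square)
qed

lemma ex_rsets_const_step:
  assumes "\<And>Rs. Rs \<in> set_pmf (rsets n q i) \<Longrightarrow> ex (rset n (q i)) (\<lambda>R. f (R # Rs)) \<le> h Rs"
  shows "ex (rsets n q (Suc i)) f \<le> ex (rsets n q i) h"
  unfolding ex_rsets_Suc using assms by (intro ex_mono finite_rsets)

section \<open>Freezing in a graph that is sparse outside a small set\<close>

context
  fixes Wt :: "nat set"
  assumes Wt: "Wt \<subseteq> {..<n}" and sparse: "(\<Sum>v\<in>{..<n} - Wt. real (card (N v - Wt))) \<le> 2 * real n"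
begin

definition Xf :: "nat set list \<Rightarrow> real" where
  "Xf Rs = real (card ({..<n} - Wt - Act Rs))"

definition Mf :: "nat set list \<Rightarrow> real" where
  "Mf Rs = (\<Sum>z\<in>Wt \<inter> Act Rs. real (deg Rs z))"

definition Nf :: "nat set list \<Rightarrow> real" where
  "Nf Rs = (\<Sum>z\<in>Wt \<inter> Act Rs. 1)"

text \<open>Up to a factor of two, the expected number of vertices of \<open>Wt\<close> frozen in a
  round of rate \<open>p\<close>. It measures both what \<open>Nf\<close> loses and what
  \<open>Mf\<close> can retain.\<close>

definition ff :: "real \<Rightarrow> nat set list \<Rightarrow> real" where
  "ff p Rs = (\<Sum>z\<in>Wt \<inter> Act Rs. min 1 (p * real (deg Rs z)))"

lemma sum_Wt_Cons: "(\<Sum>z\<in>Wt \<inter> Act (R # Rs). f z) = (\<Sum>z\<in>Wt \<inter> Act Rs. if R \<inter> (N z \<inter> Act Rs) = {} then f z else 0 :: real)"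
proof -
  have "Wt \<inter> Act (R # Rs) = {z \<in> Wt \<inter> Act Rs. R \<inter> (N z \<inter> Act Rs) = {}}" by auto
  then show ?thesis by (simp only: sum.inter_filter[of "Wt \<inter> Act Rs"] finite_Int finite_Act simp_thms)
qed

text \<open>A vertex outside \<open>Wt\<close> freezes through a sampled active neighbour. The edges
  into \<open>Wt\<close> are counted by \<open>Mf\<close>, all others by
  \<open>sparse\<close>.\<close>

lemma X_step:
  assumes p: "0 \<le> p" "p \<le> 1"
  shows "ex (rset n p) (\<lambda>R. Xf (R # Rs)) \<le> Xf Rs + p * (Mf Rs + 2 * real n)"
proof -
  define b where "b y = (\<Sum>v\<in>Act Rs - Wt. of_bool (y \<in> N v \<inter> Act Rs) :: real)" for y
  have "ex (rset n p) (\<lambda>R. Xf (R # Rs)) \<le> ex (rset n p) (\<lambda>R. Xf Rs + (\<Sum>y<n. b y * of_bool (y \<in> R)))"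
  proof (rule ex_mono[OF finite_rset])
    fix R assume "R \<in> set_pmf (rset n p)"
    then have R: "R \<subseteq> {..<n}" using set_rset by blast
    let ?F = "{v \<in> Act Rs - Wt. R \<inter> (N v \<inter> Act Rs) \<noteq> {}}"
    have "{..<n} - Wt - Act (R # Rs) \<subseteq> ({..<n} - Wt - Act Rs) \<union> ?F" by auto
    then have "card ({..<n} - Wt - Act (R # Rs)) \<le> card (({..<n} - Wt - Act Rs) \<union> ?F)" by (intro card_mono) auto
    also have "\<dots> \<le> card ({..<n} - Wt - Act Rs) + card ?F" by (rule card_Un_le)
    finally have "Xf (R # Rs) \<le> Xf Rs + real (card ?F)" unfolding Xf_def by linarith
    also have "real (card ?F) = (\<Sum>v\<in>Act Rs - Wt. if R \<inter> (N v \<inter> Act Rs) \<noteq> {} then 1 else 0)"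
      by (subst sum.inter_filter[symmetric]) auto
    also have "\<dots> \<le> (\<Sum>v\<in>Act Rs - Wt. \<Sum>y<n. of_bool (y \<in> N v \<inter> Act Rs) * of_bool (y \<in> R))"
    proof (rule sum_mono)
      fix v
      show "(if R \<inter> (N v \<inter> Act Rs) \<noteq> {} then 1 else 0) \<le> (\<Sum>y<n. of_bool (y \<in> N v \<inter> Act Rs) * of_bool (y \<in> R) :: real)"
      proof (cases "R \<inter> (N v \<inter> Act Rs) = {}")
        case False
        then obtain y where y: "y \<in> R" "y \<in> N v \<inter> Act Rs" by auto
        then have "(1::real) = of_bool (y \<in> N v \<inter> Act Rs) * of_bool (y \<in> R)" by simp
        also have "\<dots> \<le> (\<Sum>y<n. of_bool (y \<in> N v \<inter> Act Rs) * of_bool (y \<in> R))"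
          using y R by (intro member_le_sum) auto
        finally show ?thesis using False by simp
      next
        case True
        then show ?thesis by (simp add: sum_nonneg del: sum_mult_of_bool_eq sum_of_bool_mult_eq)
      qed
    qed
    also have "\<dots> = (\<Sum>y<n. b y * of_bool (y \<in> R))"
      unfolding b_def sum_distrib_right by (rule sum.swap)
    finally show "Xf (R # Rs) \<le> Xf Rs + (\<Sum>y<n. b y * of_bool (y \<in> R))" by simp
  qed
  also have "\<dots> = Xf Rs + p * (\<Sum>y<n. b y)" by (rule ex_rset_lin[OF p])
  also have "(\<Sum>y<n. b y) \<le> Mf Rs + 2 * real n"
  proof -
    have "(\<Sum>y<n. b y) = (\<Sum>v\<in>Act Rs - Wt. \<Sum>y<n. of_bool (y \<in> N v \<inter> Act Rs))"
      unfolding b_def by (rule sum.swap)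
    also have "\<dots> = (\<Sum>v\<in>Act Rs - Wt. real (card (N v \<inter> Act Rs)))"
    proof (rule sum.cong[OF refl])
      fix v
      have "{..<n} \<inter> (N v \<inter> Act Rs) = N v \<inter> Act Rs" using N_sub by auto
      then show "(\<Sum>y<n. of_bool (y \<in> N v \<inter> Act Rs)) = real (card (N v \<inter> Act Rs))"
        by (simp only: sum_of_bool_eq[of "{..<n}"] finite_lessThan Collect_mem_eq)
    qed
    also have "\<dots> \<le> (\<Sum>v\<in>Act Rs - Wt. real (card (N v \<inter> (Wt \<inter> Act Rs))) + real (card (N v - Wt)))"
    proof (rule sum_mono)
      fix v
      have "N v \<inter> Act Rs \<subseteq> (N v \<inter> (Wt \<inter> Act Rs)) \<union> (N v - Wt)" by auto
      then have "card (N v \<inter> Act Rs) \<le> card ((N v \<inter> (Wt \<inter> Act Rs)) \<union> (N v - Wt))" by (intro card_mono) auto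
      also have "\<dots> \<le> card (N v \<inter> (Wt \<inter> Act Rs)) + card (N v - Wt)" by (rule card_Un_le)
      finally show "real (card (N v \<inter> Act Rs)) \<le> real (card (N v \<inter> (Wt \<inter> Act Rs))) + real (card (N v - Wt))" by linarith
    qed
    also have "\<dots> = (\<Sum>v\<in>Act Rs - Wt. real (card (N v \<inter> (Wt \<inter> Act Rs)))) + (\<Sum>v\<in>Act Rs - Wt. real (card (N v - Wt)))"
      by (rule sum.distrib)
    also have "(\<Sum>v\<in>Act Rs - Wt. real (card (N v \<inter> (Wt \<inter> Act Rs)))) \<le> (\<Sum>v\<in>Act Rs. real (card (N v \<inter> (Wt \<inter> Act Rs))))"
      by (intro sum_mono2) auto
    also have "\<dots> = Mf Rs"
      using N_swap_deg[of "Wt \<inter> Act Rs" "\<lambda>_. 1" Rs] Wt by (auto simp: Mf_def)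
    also have "(\<Sum>v\<in>Act Rs - Wt. real (card (N v - Wt))) \<le> (\<Sum>v\<in>{..<n} - Wt. real (card (N v - Wt)))"
      using Act_sub by (intro sum_mono2) auto
    also have "\<dots> \<le> 2 * real n" by (rule sparse)
    finally show ?thesis by simp
  qed
  finally show ?thesis using p by (simp add: mult_left_mono)
qed

text \<open>A vertex of active degree \<open>d\<close> contributes at most
  \<open>d * (1 - p) ^ d\<close>, which is below both \<open>1 / p\<close> and
  \<open>d\<close>.\<close>

lemma M_step:
  assumes p: "0 < p" "p \<le> 1"
  shows "ex (rset n p) (\<lambda>R. Mf (R # Rs)) \<le> 1 / p * ff p Rs"
proof -
  have "ex (rset n p) (\<lambda>R. Mf (R # Rs)) \<le> ex (rset n p) (\<lambda>R. \<Sum>z\<in>Wt \<inter> Act Rs. real (deg Rs z) * of_bool (R \<inter> (N z \<inter> Act Rs) = {}))"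
    unfolding Mf_def sum_Wt_Cons using deg_mono by (intro ex_mono finite_rset sum_mono) auto
  also have "\<dots> = (\<Sum>z\<in>Wt \<inter> Act Rs. real (deg Rs z) * (1 - p) ^ deg Rs z)"
    unfolding ex_sum[OF finite_rset] ex_cmult unfolding deg_def
    using p N_sub by (intro sum.cong refl, subst ex_rset_avoid) auto
  also have "\<dots> \<le> (\<Sum>z\<in>Wt \<inter> Act Rs. 1 / p * min 1 (p * real (deg Rs z)))"
  proof (rule sum_mono)
    fix z
    have "real (deg Rs z) * (1 - p) ^ deg Rs z \<le> 1 / p"
      using deg_survive_le[OF p, of "deg Rs z"] p by (simp add: field_simps)
    moreover have "real (deg Rs z) * (1 - p) ^ deg Rs z \<le> real (deg Rs z) * 1"
      using p by (intro mult_left_mono power_le_one) auto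
    ultimately show "real (deg Rs z) * (1 - p) ^ deg Rs z \<le> 1 / p * min 1 (p * real (deg Rs z))"
      using p by (auto simp: min_def)
  qed
  finally show ?thesis by (simp add: ff_def sum_distrib_left)
qed

lemma N_step:
  assumes p: "0 < p" "p \<le> 1"
  shows "ex (rset n p) (\<lambda>R. Nf (R # Rs)) \<le> Nf Rs - ff p Rs / 2"
proof -
  have "ex (rset n p) (\<lambda>R. Nf (R # Rs)) = ex (rset n p) (\<lambda>R. \<Sum>z\<in>Wt \<inter> Act Rs. of_bool (R \<inter> (N z \<inter> Act Rs) = {}))"
    unfolding Nf_def sum_Wt_Cons of_bool_def ..
  also have "\<dots> = (\<Sum>z\<in>Wt \<inter> Act Rs. (1 - p) ^ deg Rs z)"
    unfolding ex_sum[OF finite_rset] unfolding deg_def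
    using p N_sub by (intro sum.cong refl, subst ex_rset_avoid) auto
  also have "\<dots> \<le> (\<Sum>z\<in>Wt \<inter> Act Rs. 1 - min 1 (p * real (deg Rs z)) / 2)"
    using p by (intro sum_mono survive_le) auto
  also have "\<dots> = Nf Rs - ff p Rs / 2" by (simp add: Nf_def ff_def sum_subtractf sum_divide_distrib)
  finally show ?thesis .
qed

text \<open>In expectation a round adds at most \<open>q i * Mf + 2 * n * q i\<close> to
  \<open>Xf\<close>, and the first summand is the old second term of the potential. The new second
  term is at most \<open>4 * ff\<close>, as the rate quadruples, and \<open>8 * Nf\<close> drops by
  that much; this is the origin of the 8. Initially \<open>q 0 * n <= 1\<close> yields
  \<open>1 + 8\<close> per vertex of \<open>Wt\<close>.\<close>

lemma freeze_potential:
  assumes q: "\<And>i. i < L \<Longrightarrow> 0 < q i \<and> q i \<le> 1" and q4: "\<And>i. q (Suc i) = 4 * q i"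
    and q0: "0 \<le> q 0" "q 0 * real n \<le> 1" and "i \<le> L"
  shows "ex (rsets n q i) (\<lambda>Rs. Xf Rs + q i * Mf Rs + 8 * Nf Rs) \<le> 9 * real (card Wt) + 2 * real n * (\<Sum>j<i. q j)"
  using \<open>i \<le> L\<close>
proof (induction i)
  case 0
  have "{..<n} - Wt - {..<n} = {}" by auto
  then have "Xf [] = 0" by (simp add: Xf_def)
  moreover have "q 0 * Mf [] \<le> real (card Wt)"
  proof -
    have "q 0 * Mf [] \<le> q 0 * (\<Sum>z\<in>Wt. real n)"
    proof (intro mult_left_mono[OF _ q0(1)])
      have "deg [] z \<le> n" for z using card_mono[of "{..<n}" "N z \<inter> {..<n}"] by (simp add: deg_def)
      then show "Mf [] \<le> (\<Sum>z\<in>Wt. real n)"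
        unfolding Mf_def using Wt by (simp add: Int_absorb2 del: sum_constant) (intro sum_mono, simp)
    qed
    also have "\<dots> = real (card Wt) * (q 0 * real n)" by simp
    also have "\<dots> \<le> real (card Wt) * 1" using q0 by (intro mult_left_mono) auto
    finally show ?thesis by simp
  qed
  moreover have "Nf [] = real (card Wt)" using Wt by (simp add: Nf_def Int_absorb2)
  ultimately show ?case by simp
next
  case (Suc i)
  have qi: "0 < q i" "q i \<le> 1" using q[of i] Suc by auto
  have "ex (rsets n q (Suc i)) (\<lambda>Rs. Xf Rs + q (Suc i) * Mf Rs + 8 * Nf Rs)
    \<le> ex (rsets n q i) (\<lambda>Rs. (Xf Rs + q i * Mf Rs + 8 * Nf Rs) + 2 * real n * q i)"
  proof (rule ex_rsets_const_step)
    fix Rs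
    have "ex (rset n (q i)) (\<lambda>R. Xf (R # Rs) + q (Suc i) * Mf (R # Rs) + 8 * Nf (R # Rs))
      = ex (rset n (q i)) (\<lambda>R. Xf (R # Rs)) + q (Suc i) * ex (rset n (q i)) (\<lambda>R. Mf (R # Rs)) + 8 * ex (rset n (q i)) (\<lambda>R. Nf (R # Rs))"
      unfolding ex_add[OF finite_rset] ex_cmult ..
    also have "\<dots> \<le> (Xf Rs + q i * (Mf Rs + 2 * real n)) + q (Suc i) * (1 / q i * ff (q i) Rs) + 8 * (Nf Rs - ff (q i) Rs / 2)"
      using qi q4[of i] X_step[of "q i" Rs] M_step[of "q i" Rs] N_step[of "q i" Rs]
      by (intro add_mono mult_left_mono) auto
    also have "q (Suc i) * (1 / q i * ff (q i) Rs) = 4 * ff (q i) Rs" using qi q4[of i] by simp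
    finally show "ex (rset n (q i)) (\<lambda>R. Xf (R # Rs) + q (Suc i) * Mf (R # Rs) + 8 * Nf (R # Rs))
      \<le> (Xf Rs + q i * Mf Rs + 8 * Nf Rs) + 2 * real n * q i" by (simp add: algebra_simps)
  qed
  also have "\<dots> = ex (rsets n q i) (\<lambda>Rs. Xf Rs + q i * Mf Rs + 8 * Nf Rs) + 2 * real n * q i"
    by (subst ex_add[OF finite_rsets]) simp
  finally show ?case using Suc by (simp add: algebra_simps)
qed

lemma M_final:
  assumes "0 < q i" "q i \<le> 1"
  shows "ex (rsets n q (Suc i)) Mf \<le> real (card Wt) / q i"
proof -
  have "ex (rsets n q (Suc i)) Mf \<le> ex (rsets n q i) (\<lambda>_. real (card Wt) / q i)"
  proof (rule ex_rsets_const_step)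
    fix Rs
    have "ff (q i) Rs \<le> (\<Sum>z\<in>Wt \<inter> Act Rs. 1)" unfolding ff_def by (intro sum_mono) simp
    also have "\<dots> \<le> real (card Wt)" using Wt finite_subset[OF Wt] by (simp add: card_mono)
    finally have "1 / q i * ff (q i) Rs \<le> 1 / q i * real (card Wt)" using assms by (intro mult_left_mono) auto
    then show "ex (rset n (q i)) (\<lambda>R. Mf (R # Rs)) \<le> real (card Wt) / q i" using M_step[OF assms, of Rs] by simp
  qed
  then show ?thesis by simp
qed

end

end

section \<open>Query programs\<close>

type_synonym inst = "nat \<Rightarrow> nat \<Rightarrow> nat"

text \<open>Programs are written in continuation-passing style, so that intermediate results of
  arbitrary type can be passed on although decision trees only output reals.\<close>

definition qcomp :: "(inst \<Rightarrow> 'a) \<Rightarrow> (inst \<Rightarrow> nat) \<Rightarrow> bool" where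
  "qcomp f c \<longleftrightarrow> (\<exists>P. \<forall>k w. run_qtree (P k) w =
     (fst (run_qtree (k (f w)) w), c w + snd (run_qtree (k (f w)) w)))"

lemma qcomp_return: "qcomp (\<lambda>w. a) (\<lambda>w. 0)"
  unfolding qcomp_def by (rule exI[of _ "\<lambda>k. k a"]) simp

lemma qcomp_query: "qcomp (\<lambda>w. w u v) (\<lambda>w. 1)"
  unfolding qcomp_def by (rule exI[of _ "\<lambda>k. Query u v k"]) (simp add: split_beta)

lemma qcomp_bind:
  assumes "qcomp f c" "\<And>a. qcomp (g a) (d a)"
  shows "qcomp (\<lambda>w. g (f w) w) (\<lambda>w. c w + d (f w) w)"
proof -
  obtain P where P: "\<And>k w. run_qtree (P k) w = (fst (run_qtree (k (f w)) w), c w + snd (run_qtree (k (f w)) w))"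
    using assms(1) unfolding qcomp_def by blast
  obtain Q where Q: "\<And>a k w. run_qtree (Q a k) w = (fst (run_qtree (k (g a w)) w), d a w + snd (run_qtree (k (g a w)) w))"
    using assms(2) unfolding qcomp_def by metis
  show ?thesis unfolding qcomp_def by (rule exI[of _ "\<lambda>k. P (\<lambda>a. Q a k)"]) (simp add: P Q)
qed

lemma qcomp_map: "qcomp f c \<Longrightarrow> qcomp (\<lambda>w. h (f w)) c"
  using qcomp_bind[where f = f and c = c and g = "\<lambda>a w. h a" and d = "\<lambda>a w. 0", OF _ qcomp_return] by simp

lemma qcomp_cong: "qcomp f c \<Longrightarrow> (\<And>w. f' w = f w) \<Longrightarrow> (\<And>w. c' w = c w) \<Longrightarrow> qcomp f' c'"
  by (metis ext)

lemma qcomp_collect: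
  assumes "finite U" "\<And>u. qcomp (\<lambda>w. f u w) (c u)"
  shows "qcomp (\<lambda>w. {u \<in> U. f u w}) (\<lambda>w. \<Sum>u\<in>U. c u w)"
  using assms(1)
proof (induction U rule: finite_induct)
  case empty
  then show ?case using qcomp_return[of "{}"] by simp
next
  case (insert u U)
  have "qcomp (\<lambda>w. (if f u w then insert u {u \<in> U. f u w} else {u \<in> U. f u w})) (\<lambda>w. c u w + (\<Sum>u\<in>U. c u w))"
    by (rule qcomp_bind[OF assms(2), where g = "\<lambda>b w. if b then insert u {u \<in> U. f u w} else {u \<in> U. f u w}"
        and d = "\<lambda>b w. \<Sum>u\<in>U. c u w"]) (rule qcomp_map[OF insert.IH])
  then show ?case by (rule qcomp_cong) (use insert.hyps in auto)
qed

lemma qcomp_list: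
  assumes "\<And>x. qcomp (f x) (c x)"
  shows "qcomp (\<lambda>w. map (\<lambda>x. f x w) xs) (\<lambda>w. \<Sum>x\<leftarrow>xs. c x w)"
proof (induction xs)
  case Nil
  then show ?case using qcomp_return[of "[]"] by simp
next
  case (Cons x xs)
  have "qcomp (\<lambda>w. f x w # map (\<lambda>x. f x w) xs) (\<lambda>w. c x w + (\<Sum>x\<leftarrow>xs. c x w))"
    by (rule qcomp_bind[OF assms, where g = "\<lambda>b w. b # map (\<lambda>x. f x w) xs" and d = "\<lambda>b w. \<Sum>x\<leftarrow>xs. c x w"])
      (rule qcomp_map[OF Cons])
  then show ?case by simp
qed

lemma qcomp_pair:
  assumes "qcomp f c" "qcomp g d"
  shows "qcomp (\<lambda>w. (f w, g w)) (\<lambda>w. c w + d w)"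
  by (rule qcomp_bind[OF assms(1), where g = "\<lambda>a w. (a, g w)" and d = "\<lambda>a w. d w"]) (rule qcomp_map[OF assms(2)])

lemma qcomp_conj:
  assumes "qcomp f c" "qcomp g d"
  shows "qcomp (\<lambda>w. f w \<and> g w) (\<lambda>w. c w + d w)"
  using qcomp_map[OF qcomp_pair[OF assms], of "\<lambda>(a, b). a \<and> b"] by simp

text \<open>The part of the instance that has been queried, with default 0. A function that takes
  the same value on \<open>known A w\<close> as on \<open>w\<close> costs \<open>card A\<close>
  queries.\<close>

definition known :: "(nat \<times> nat) set \<Rightarrow> inst \<Rightarrow> inst" where
  "known A w = (\<lambda>u v. if (u, v) \<in> A then w u v else 0)"

lemma qcomp_known: "finite A \<Longrightarrow> qcomp (known A) (\<lambda>w. card A)"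
proof (induction A rule: finite_induct)
  case empty
  show ?case by (rule qcomp_cong[OF qcomp_return[of "known {} undefined"]]) (auto simp: known_def)
next
  case (insert uv A)
  obtain u v where uv: "uv = (u, v)" by (cases uv)
  have "qcomp (\<lambda>w. (\<lambda>x y. if (x, y) = (u, v) then w u v else known A w x y)) (\<lambda>w. 1 + card A)"
    by (rule qcomp_bind[OF qcomp_query, where g = "\<lambda>a w. (\<lambda>x y. if (x, y) = (u, v) then a else known A w x y)"
        and d = "\<lambda>a w. card A"]) (rule qcomp_map[OF insert.IH])
  then show ?case by (rule qcomp_cong) (use insert uv in \<open>auto simp: known_def fun_eq_iff\<close>)
qed

section \<open>Sequential composition and truncation of decision trees\<close>

primrec qbind :: "qtree \<Rightarrow> (real \<Rightarrow> qtree) \<Rightarrow> qtree" where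
  "qbind (Output x) k = k x"
| "qbind (Query u v f) k = Query u v (\<lambda>a. qbind (f a) k)"

lemma run_qbind: "run_qtree (qbind t k) w =
  (fst (run_qtree (k (qt_output t w)) w), qt_queries t w + snd (run_qtree (k (qt_output t w)) w))"
  by (induction t) (auto simp: qt_output_def qt_queries_def split_beta)

lemma qcomp_tree: "qcomp (qt_output t) (qt_queries t)"
  unfolding qcomp_def by (rule exI[of _ "qbind t"]) (simp add: run_qbind)

lemma qcomp_imp_tree:
  assumes "qcomp f c"
  obtains t where "\<And>w. qt_output t w = f w" "\<And>w. qt_queries t w = c w"
proof -
  obtain P where "\<And>k w. run_qtree (P k) w = (fst (run_qtree (k (f w)) w), c w + snd (run_qtree (k (f w)) w))"
    using assms unfolding qcomp_def by blast
  then show ?thesis using that[of "P Output"] by (simp add: qt_output_def qt_queries_def)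
qed

primrec truncate :: "qtree \<Rightarrow> nat \<Rightarrow> qtree" where
  "truncate (Output x) = (\<lambda>B. Output x)"
| "truncate (Query u v f) = (\<lambda>B. case B of 0 \<Rightarrow> Output 0 | Suc B' \<Rightarrow> Query u v (\<lambda>a. truncate (f a) B'))"

lemma truncate_queries: "qt_queries (truncate t B) w \<le> B"
  by (induction t arbitrary: B) (auto simp: qt_queries_def split_beta split: nat.splits)

lemma truncate_output: "qt_output (truncate t B) w = (if qt_queries t w \<le> B then qt_output t w else 0)"
  by (induction t arbitrary: B) (auto simp: qt_queries_def qt_output_def split_beta split: nat.splits)

text \<open>Booleans are coded as 0 and 1, so the default output 0 of a tree that exceeds its budget
  means \<open>False\<close>.\<close>

lemma qcomp_truncate:
  assumes "qcomp f c"
  obtains d where "qcomp (\<lambda>w. f w \<and> c w \<le> B) d" "\<And>w. d w \<le> B"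
proof -
  have "qcomp (\<lambda>w. of_bool (f w) :: real) c" using qcomp_map[OF assms, of of_bool] .
  then obtain t where t: "\<And>w. qt_output t w = of_bool (f w)" "\<And>w. qt_queries t w = c w"
    using qcomp_imp_tree by blast
  have "qcomp (\<lambda>w. qt_output (truncate t B) w = 1) (qt_queries (truncate t B))"
    using qcomp_map[OF qcomp_tree, of "\<lambda>x. x = 1"] .
  then have "qcomp (\<lambda>w. f w \<and> c w \<le> B) (qt_queries (truncate t B))"
    by (rule qcomp_cong) (auto simp: truncate_output t)
  then show ?thesis using that truncate_queries by blast
qed

section \<open>The tests as query programs\<close>

text \<open>Freezing resumed from a known active set \<open>A\<close>; \<open>act_append\<close> and
  \<open>cst_append\<close> identify it with the later rounds of the full process.\<close>

fun actf :: "nat \<Rightarrow> inst \<Rightarrow> nat set \<Rightarrow> nat set list \<Rightarrow> nat set" where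
  "actf n w A [] = A"
| "actf n w A (R # Rs) = {v \<in> actf n w A Rs. R \<inter> (nb n w v \<inter> actf n w A Rs) = {}}"

fun cstf :: "nat \<Rightarrow> inst \<Rightarrow> nat set \<Rightarrow> nat set list \<Rightarrow> nat \<Rightarrow> nat" where
  "cstf n w A [] v = 0"
| "cstf n w A (R # Rs) v = cstf n w A Rs v +
     (if v \<in> actf n w A Rs then card R + (\<Sum>u\<in>nb n w v \<inter> R. cstf n w A Rs u) else 0)"

lemma act_append: "act n w (Rs2 @ Rs1) = actf n w (act n w Rs1) Rs2"
  by (induction Rs2) auto

lemma cst_append: "cst n w (length Rs1) (Rs2 @ Rs1) v = cstf n w (act n w Rs1) Rs2 v"
proof (induction Rs2 arbitrary: v)
  case Nil
  then show ?case by (simp add: cst_0)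
next
  case (Cons R Rs2)
  then show ?case by (simp add: act_append)
qed

lemma qcomp_nb: "finite R \<Longrightarrow> R \<subseteq> {..<n} \<Longrightarrow> qcomp (\<lambda>w. nb n w v \<inter> R) (\<lambda>w. card R)"
proof -
  assume R: "finite R" "R \<subseteq> {..<n}"
  have "qcomp (\<lambda>w. {u \<in> R. w v u = 1}) (\<lambda>w. \<Sum>u\<in>R. 1)"
    by (rule qcomp_collect[OF R(1)]) (rule qcomp_map[OF qcomp_query, of "\<lambda>x. x = 1"])
  then show ?thesis by (rule qcomp_cong) (use R in \<open>auto simp: nb_def\<close>)
qed

lemma qcomp_actf:
  assumes "set Rs \<subseteq> Pow {..<n}"
  shows "qcomp (\<lambda>w. v \<in> actf n w A Rs) (\<lambda>w. cstf n w A Rs v)"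
  using assms
proof (induction Rs arbitrary: v)
  case Nil
  then show ?case using qcomp_return[of "v \<in> A"] by simp
next
  case (Cons R Rs)
  then have R: "finite R" "R \<subseteq> {..<n}" using finite_subset by auto
  have IH: "qcomp (\<lambda>w. v \<in> actf n w A Rs) (\<lambda>w. cstf n w A Rs v)" for v using Cons by simp
  have 1: "qcomp (\<lambda>w. {u \<in> U. u \<in> actf n w A Rs} = {}) (\<lambda>w. \<Sum>u\<in>U. cstf n w A Rs u)" if "finite U" for U
    using qcomp_map[OF qcomp_collect[OF that IH], of "\<lambda>S. S = {}"] .
  \<comment> \<open>\<open>qcomp_bind\<close> wants a continuation for every set, including infinite
    ones, which never arise here; the dummy branch answers \<open>False\<close> at cost 0.\<close>
  have 1: "qcomp (\<lambda>w. if finite U then {u \<in> U. u \<in> actf n w A Rs} = {} else False) (\<lambda>w. \<Sum>u\<in>U. cstf n w A Rs u)" for U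
    using 1[of U] qcomp_return[of False] by (cases "finite U") auto
  have 2: "qcomp (\<lambda>w. if finite (nb n w v \<inter> R) then {u \<in> nb n w v \<inter> R. u \<in> actf n w A Rs} = {} else False)
      (\<lambda>w. card R + (\<Sum>u\<in>nb n w v \<inter> R. cstf n w A Rs u))"
    by (rule qcomp_bind[OF qcomp_nb[OF R], where g = "\<lambda>U w. if finite U then {u \<in> U. u \<in> actf n w A Rs} = {} else False"
        and d = "\<lambda>U w. \<Sum>u\<in>U. cstf n w A Rs u"]) (rule 1)
  have 3: "qcomp (\<lambda>w. if b then (if finite (nb n w v \<inter> R) then {u \<in> nb n w v \<inter> R. u \<in> actf n w A Rs} = {} else False) else False)
      (\<lambda>w. if b then card R + (\<Sum>u\<in>nb n w v \<inter> R. cstf n w A Rs u) else 0)" for b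
    using 2 qcomp_return[of False] by (cases b) auto
  have "qcomp (\<lambda>w. if v \<in> actf n w A Rs then (if finite (nb n w v \<inter> R) then {u \<in> nb n w v \<inter> R. u \<in> actf n w A Rs} = {} else False) else False)
      (\<lambda>w. cstf n w A Rs v + (if v \<in> actf n w A Rs then card R + (\<Sum>u\<in>nb n w v \<inter> R. cstf n w A Rs u) else 0))"
    by (rule qcomp_bind[OF IH, where g = "\<lambda>b w. if b then (if finite (nb n w v \<inter> R) then {u \<in> nb n w v \<inter> R. u \<in> actf n w A Rs} = {} else False) else False"
        and d = "\<lambda>b w. if b then card R + (\<Sum>u\<in>nb n w v \<inter> R. cstf n w A Rs u) else 0"]) (rule 3)
  then show ?case by (rule qcomp_cong) (use R in auto)
qed

text \<open>A round inspects only pairs whose second entry is sampled.\<close>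

lemma act_known:
  assumes "\<And>R. R \<in> set Rs \<Longrightarrow> {..<n} \<times> R \<subseteq> A"
  shows "act n (known A w) Rs = act n w Rs"
  using assms
proof (induction Rs)
  case (Cons R Rs)
  have sub: "act n w Rs \<subseteq> {..<n}" by (induction Rs) auto
  have "R \<inter> (nb n (known A w) v \<inter> act n w Rs) = R \<inter> (nb n w v \<inter> act n w Rs)" if "v < n" for v
    using Cons.prems that by (fastforce simp: nb_def known_def)
  then have "R \<inter> (nb n (known A w) v \<inter> act n w Rs) = R \<inter> (nb n w v \<inter> act n w Rs)" if "v \<in> act n w Rs" for v
    using that sub by blast
  moreover have "act n (known A w) Rs = act n w Rs" using Cons by simp
  ultimately show ?case unfolding act.simps by (metis (no_types, lifting))
qed simp

lemma qcomp_act: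
  assumes "set Rs \<subseteq> Pow {..<n}"
  shows "qcomp (\<lambda>w. act n w Rs) (\<lambda>w. n * card (\<Union>(set Rs)))"
proof -
  have fin: "finite (\<Union>(set Rs))" using assms by (intro finite_Union) (auto intro: finite_subset)
  then have "qcomp (known ({..<n} \<times> \<Union>(set Rs))) (\<lambda>w. card ({..<n} \<times> \<Union>(set Rs)))"
    by (intro qcomp_known) simp
  from qcomp_map[OF this, of "\<lambda>w. act n w Rs"] show ?thesis
    by (rule qcomp_cong) (auto simp: card_cartesian_product intro!: act_known[symmetric])
qed

section \<open>Local search for dead ends\<close>

definition grow :: "nat \<Rightarrow> inst \<Rightarrow> nat \<Rightarrow> nat \<Rightarrow> nat set \<Rightarrow> nat set" where
  "grow n w v u X = X \<union> {z. z < n \<and> (\<exists>x\<in>X. w x z = 1 \<and> \<not> (x = v \<and> z = u))}"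

definition cross :: "nat \<Rightarrow> nat set \<Rightarrow> (nat \<times> nat) set" where
  "cross n X = X \<times> {..<n} \<union> {..<n} \<times> X"

lemma grow_mono: "X \<subseteq> Y \<Longrightarrow> grow n w v u X \<subseteq> grow n w v u Y"
  by (auto simp: grow_def)

text \<open>A side is the component of \<open>v\<close> after deleting its bridge, hence determined
  by \<open>v\<close> and \<open>u\<close>. As it has at most \<open>\<sigma>\<close> vertices and
  every step before stabilisation adds one, \<open>\<sigma>\<close> steps reach all of it.\<close>

lemma dead_side_unique:
  assumes d: "dead_side n w \<sigma> v u X"
  shows "X = (grow n w v u ^^ \<sigma>) {v}"
proof -
  let ?g = "grow n w v u"
  have clo: "?g X = X" using d by (auto simp: grow_def dead_side_def)
  have sub: "(?g ^^ k) {v} \<subseteq> X" for k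
  proof (induction k)
    case 0
    then show ?case using d by (simp add: dead_side_def)
  next
    case (Suc k)
    then show ?case using grow_mono[OF Suc, of n w v u] clo by simp
  qed
  have finX: "finite X" using d by (auto simp: dead_side_def intro: finite_subset)
  have inc: "(?g ^^ k) {v} \<subseteq> (?g ^^ Suc k) {v}" for k by (auto simp: grow_def)
  have stable: "\<exists>k\<le>\<sigma>. (?g ^^ Suc k) {v} = (?g ^^ k) {v}"
  proof (rule ccontr)
    assume neg: "\<not> ?thesis"
    have "Suc k \<le> card ((?g ^^ k) {v})" if "k \<le> Suc \<sigma>" for k
      using that
    proof (induction k)
      case (Suc k)
      have "(?g ^^ k) {v} \<subset> (?g ^^ Suc k) {v}" using neg inc[of k] Suc by auto
      then have "card ((?g ^^ k) {v}) < card ((?g ^^ Suc k) {v})"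
        using sub finX finite_subset by (intro psubset_card_mono) blast+
      then show ?case using Suc by simp
    qed simp
    from this[of "Suc \<sigma>"] have "\<sigma> < card ((?g ^^ Suc \<sigma>) {v})" by simp
    moreover have "card ((?g ^^ Suc \<sigma>) {v}) \<le> card X" using sub finX by (intro card_mono) blast+
    ultimately show False using d by (simp add: dead_side_def)
  qed
  then obtain k where k: "k \<le> \<sigma>" "?g ((?g ^^ k) {v}) = (?g ^^ k) {v}" by auto
  have st: "(?g ^^ (k + j)) {v} = (?g ^^ k) {v}" for j
    by (induction j) (use k in auto)
  then have e: "(?g ^^ \<sigma>) {v} = (?g ^^ k) {v}" using k by (metis le_add_diff_inverse)
  have "X \<subseteq> (?g ^^ k) {v}"
  proof
    fix x assume "x \<in> X"
    then have "(v, x) \<in> {(a, b). a \<in> X \<and> b \<in> X \<and> w a b = 1}\<^sup>*" using d by (simp add: dead_side_def)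
    then show "x \<in> (?g ^^ k) {v}"
    proof (induction rule: rtrancl_induct)
      case base
      have "v \<in> (?g ^^ k) {v}" for k by (induction k) (auto simp: grow_def)
      then show ?case .
    next
      case (step a b)
      then have "b \<noteq> u" "b < n" using d by (auto simp: dead_side_def)
      then have "b \<in> ?g ((?g ^^ k) {v})"
        unfolding grow_def[of n w v u "(?g ^^ k) {v}"] using step by auto
      then show ?case using k by simp
    qed
  qed
  then show ?thesis using sub e by auto
qed

text \<open>All unit neighbours of \<open>v\<close> other than \<open>u\<close> lie on the side,
  hence the degree bound, which in turn limits the number of candidates for
  \<open>u\<close>.\<close>

lemma dead_iff:
  "dead n w \<sigma> v \<longleftrightarrow> card (nb n w v) \<le> Suc \<sigma> \<and> (\<exists>u\<in>nb n w v. dead_side n w \<sigma> v u ((grow n w v u ^^ \<sigma>) {v}))"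
proof
  assume "dead n w \<sigma> v"
  then obtain u X where d: "dead_side n w \<sigma> v u X" by (auto simp: dead_def)
  have "nb n w v \<subseteq> insert u X" using d by (auto simp: nb_def dead_side_def)
  moreover have "finite X" using d by (auto simp: dead_side_def intro: finite_subset)
  ultimately have "card (nb n w v) \<le> card (insert u X)" by (intro card_mono) auto
  also have "\<dots> \<le> Suc (card X)" by (simp add: card_insert_le_m1 card_insert_if \<open>finite X\<close>)
  also have "\<dots> \<le> Suc \<sigma>" using d by (simp add: dead_side_def)
  finally have "card (nb n w v) \<le> Suc \<sigma>" .
  moreover have "u \<in> nb n w v" using d by (auto simp: nb_def dead_side_def)
  ultimately show "card (nb n w v) \<le> Suc \<sigma> \<and> (\<exists>u\<in>nb n w v. dead_side n w \<sigma> v u ((grow n w v u ^^ \<sigma>) {v}))"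
    using d dead_side_unique[OF d] by auto
qed (auto simp: dead_def)

lemma known_cross: "x \<in> X \<Longrightarrow> z < n \<Longrightarrow> known (cross n X) w x z = w x z"
  "x \<in> X \<Longrightarrow> z < n \<Longrightarrow> known (cross n X) w z x = w z x"
  by (auto simp: known_def cross_def)

lemma tshare_known:
  assumes "p permutes {..<n}"
  shows "tshare n (known (cross n X) w) p X = tshare n w p X"
  unfolding tshare_def
proof (intro sum.cong refl)
  fix i assume "i \<in> {..<n}"
  then have "p i < n" "p (cnext n i) < n" using perm_lt[OF assms] cnext_lt by auto
  then show "(of_bool (p i \<in> X) + of_bool (p (cnext n i) \<in> X)) * known (cross n X) w (p i) (p (cnext n i))
    = (of_bool (p i \<in> X) + of_bool (p (cnext n i) \<in> X)) * w (p i) (p (cnext n i))"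
    using known_cross by auto
qed

text \<open>The definition speaks about all tours, but a tour step disjoint from \<open>X\<close>
  has coefficient 0 in \<open>tshare\<close>, so only pairs that touch \<open>X\<close>
  matter.\<close>

lemma dead_side_known: "dead_side n (known (cross n X) w) \<sigma> v u X \<longleftrightarrow> dead_side n w \<sigma> v u X"
proof (cases "v \<in> X \<and> X \<subseteq> {..<n} \<and> u < n")
  case True
  have 1: "known (cross n X) w v u = w v u" using True by (simp add: known_cross)
  have 2: "{(a, b). a \<in> X \<and> b \<in> X \<and> known (cross n X) w a b = 1} = {(a, b). a \<in> X \<and> b \<in> X \<and> w a b = 1}"
    using True by (auto simp: known_cross subset_iff)
  have 3: "(\<forall>x\<in>X. \<forall>z<n. z \<notin> X \<longrightarrow> known (cross n X) w x z = 1 \<longrightarrow> x = v \<and> z = u) \<longleftrightarrow> (\<forall>x\<in>X. \<forall>z<n. z \<notin> X \<longrightarrow> w x z = 1 \<longrightarrow> x = v \<and> z = u)"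
    by (auto simp: known_cross)
  have 4: "(\<forall>p. p permutes {..<n} \<longrightarrow> 21 * card X \<le> 10 * tshare n (known (cross n X) w) p X) \<longleftrightarrow> (\<forall>p. p permutes {..<n} \<longrightarrow> 21 * card X \<le> 10 * tshare n w p X)"
    using tshare_known by auto
  show ?thesis unfolding dead_side_def 1 2 3 4 ..
next
  case False
  then show ?thesis by (auto simp: dead_side_def)
qed

lemma grow_known: "grow n (known (cross n X) w) v u X = grow n w v u X"
  by (auto simp: grow_def known_cross)

lemma known_merge: "A \<subseteq> B \<Longrightarrow> (\<lambda>a b. if (a, b) \<in> A then known A w a b else known (B - A) w a b) = known B w"
  by (auto simp: known_def fun_eq_iff)

lemma finite_grow: "finite X \<Longrightarrow> finite (grow n w v u X)"
  by (simp add: grow_def)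

lemma card_cross: "finite X \<Longrightarrow> card (cross n X) \<le> 2 * (card X * n)"
  using card_Un_le[of "X \<times> {..<n}" "{..<n} \<times> X"] by (simp add: cross_def card_cartesian_product mult.commute)

lemma finite_cross: "finite X \<Longrightarrow> finite (cross n X)"
  by (simp add: cross_def)

text \<open>The search gives up once it has found more than \<open>\<sigma>\<close> vertices. The
  exact cost is part of the claim because it telescopes: a step queries only the pairs not seen
  before. The summand \<open>2 * n\<close> covers the start \<open>{v}\<close> when
  \<open>\<sigma> = 0\<close>.\<close>

lemma qcomp_grow:
  "\<exists>c. qcomp (\<lambda>w. let X = (grow n w v u ^^ k) {v} in if card X \<le> \<sigma> then Some (X, known (cross n X) w) else None) c \<and>
     (\<forall>w. c w \<le> 2 * (\<sigma> * n) + 2 * n \<and> (let X = (grow n w v u ^^ k) {v} in card X \<le> \<sigma> \<longrightarrow> c w = card (cross n X)))"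
proof (induction k)
  case 0
  define c where "c w = card (cross n {v})" for w :: inst
  have m: "qcomp (known (cross n {v})) c" unfolding c_def by (intro qcomp_known finite_cross) simp
  have "qcomp (\<lambda>w. let X = (grow n w v u ^^ 0) {v} in if card X \<le> \<sigma> then Some (X, known (cross n X) w) else None) c"
    using qcomp_map[OF m, of "\<lambda>M. if card {v} \<le> \<sigma> then Some ({v}, M) else None"] by (simp add: Let_def)
  moreover have "c w \<le> 2 * (\<sigma> * n) + 2 * n" for w using card_cross[of "{v}" n] by (simp add: c_def)
  moreover have "let X = (grow n w v u ^^ 0) {v} in card X \<le> \<sigma> \<longrightarrow> c w = card (cross n X)" for w
    by (simp add: c_def)
  ultimately show ?case by blast
next
  case (Suc k)
  let ?X = "\<lambda>w. (grow n w v u ^^ k) {v}"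
  let ?st = "\<lambda>w. if card (?X w) \<le> \<sigma> then Some (?X w, known (cross n (?X w)) w) else None"
  obtain c where c: "qcomp ?st c" "\<And>w. c w \<le> 2 * (\<sigma> * n) + 2 * n" "\<And>w. card (?X w) \<le> \<sigma> \<Longrightarrow> c w = card (cross n (?X w))"
    using Suc by (auto simp: Let_def)
  define nx where "nx s w = (case s of None \<Rightarrow> None | Some (X, M) \<Rightarrow>
     (let X' = grow n M v u X in if card X' \<le> \<sigma> \<and> finite X'
       then Some (X', \<lambda>a b. if (a, b) \<in> cross n X then M a b else known (cross n X' - cross n X) w a b) else None))"
    for s :: "(nat set \<times> inst) option" and w :: inst
  define d where "d s w = (case s of None \<Rightarrow> 0 | Some (X, M) \<Rightarrow>
     (let X' = grow n M v u X in if card X' \<le> \<sigma> \<and> finite X' then card (cross n X' - cross n X) else 0))"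
    for s :: "(nat set \<times> inst) option" and w :: inst
  have nx: "qcomp (nx s) (d s)" for s
  proof (cases s)
    case None
    then show ?thesis using qcomp_return[of None] by (simp add: nx_def[abs_def] d_def[abs_def])
  next
    case (Some XM)
    obtain X M where XM: "XM = (X, M)" by (cases XM)
    let ?X' = "grow n M v u X"
    show ?thesis
    proof (cases "card ?X' \<le> \<sigma> \<and> finite ?X'")
      case True
      have "qcomp (known (cross n ?X' - cross n X)) (\<lambda>w. card (cross n ?X' - cross n X))"
        using True by (intro qcomp_known finite_Diff finite_cross) simp
      from qcomp_map[OF this, of "\<lambda>m. Some (?X', \<lambda>a b. if (a, b) \<in> cross n X then M a b else m a b)"]
      show ?thesis using True Some XM by (simp add: nx_def[abs_def] d_def[abs_def] Let_def)
    next
      case False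
      then show ?thesis using qcomp_return[of None] Some XM by (auto simp add: nx_def[abs_def] d_def[abs_def] Let_def)
    qed
  qed
  have finX: "finite ((grow n w v u ^^ k) {v})" for k w by (induction k) (auto intro: finite_grow)
  have sub: "cross n (?X w) \<subseteq> cross n (grow n w v u (?X w))" for w by (auto simp: cross_def grow_def)
  have cm: "card (?X w) \<le> card (grow n w v u (?X w))" for w
    using finX finite_grow by (intro card_mono) (auto simp: grow_def)
  have val: "(let X = (grow n w v u ^^ Suc k) {v} in if card X \<le> \<sigma> then Some (X, known (cross n X) w) else None) = nx (?st w) w" for w
  proof (cases "card (?X w) \<le> \<sigma>")
    case True
    then show ?thesis using finite_grow[OF finX[of k w], of n w v u]
      by (simp add: nx_def Let_def grow_known known_merge[OF sub] cong del: if_weak_cong)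
  next
    case False
    then show ?thesis using cm[of w] by (auto simp: nx_def Let_def)
  qed
  have cost: "c w + d (?st w) w \<le> 2 * (\<sigma> * n) + 2 * n \<and>
      (card (grow n w v u (?X w)) \<le> \<sigma> \<longrightarrow> c w + d (?st w) w = card (cross n (grow n w v u (?X w))))" for w
  proof (cases "card (grow n w v u (?X w)) \<le> \<sigma>")
    case True
    let ?X' = "grow n w v u (?X w)"
    have "card (?X w) \<le> \<sigma>" using True cm[of w] by simp
    then have "c w + d (?st w) w = card (cross n (?X w)) + card (cross n ?X' - cross n (?X w))"
      using True c(3) finite_grow[OF finX] by (auto simp: d_def Let_def grow_known)
    also have "\<dots> = card (cross n ?X')"
    proof -
      have f: "finite (cross n ?X')" by (intro finite_cross finite_grow finX)
      then show ?thesis using sub[of w] card_mono[OF f sub[of w]] finite_subset[OF sub[of w] f] by (simp add: card_Diff_subset)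
    qed
    finally have e: "c w + d (?st w) w = card (cross n ?X')" .
    have "card (cross n ?X') \<le> 2 * (card ?X' * n)" by (intro card_cross finite_grow finX)
    also have "\<dots> \<le> 2 * (\<sigma> * n)" using True by (intro mult_le_mono) auto
    finally show ?thesis using e by simp
  next
    case False
    then have "d (?st w) w = 0" using finite_grow[OF finX] by (auto simp: d_def Let_def grow_known)
    then show ?thesis using False c(2)[of w] by simp
  qed
  have "qcomp (\<lambda>w. nx (?st w) w) (\<lambda>w. c w + d (?st w) w)" by (rule qcomp_bind[OF c(1) nx])
  then have "qcomp (\<lambda>w. let X = (grow n w v u ^^ Suc k) {v} in if card X \<le> \<sigma> then Some (X, known (cross n X) w) else None) (\<lambda>w. c w + d (?st w) w)"
    by (rule qcomp_cong) (rule val, rule refl)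
  then show ?case using cost by (intro exI[of _ "\<lambda>w. c w + d (?st w) w"]) (auto simp: Let_def)
qed

lemma qcomp_dead:
  obtains c where "qcomp (\<lambda>w. dead n w \<sigma> v) c" "\<And>w. c w \<le> n + Suc \<sigma> * (2 * (\<sigma> * n) + 2 * n)"
proof -
  let ?D = "\<lambda>u w. dead_side n w \<sigma> v u ((grow n w v u ^^ \<sigma>) {v})"
  let ?B = "2 * (\<sigma> * n) + 2 * n"
  have "\<exists>c. qcomp (?D u) c \<and> (\<forall>w. c w \<le> ?B)" for u
  proof -
    obtain c where c: "qcomp (\<lambda>w. let X = (grow n w v u ^^ \<sigma>) {v} in if card X \<le> \<sigma> then Some (X, known (cross n X) w) else None) c"
      "\<And>w. c w \<le> ?B" using qcomp_grow[where n = n and v = v and u = u and k = \<sigma> and \<sigma> = \<sigma>] by auto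
    have "qcomp (?D u) c"
    proof (rule qcomp_cong[OF qcomp_map[OF c(1), of "\<lambda>s. case s of None \<Rightarrow> False | Some (X, M) \<Rightarrow> dead_side n M \<sigma> v u X"]])
      fix w
      let ?X = "(grow n w v u ^^ \<sigma>) {v}"
      have c: "\<not> ?D u w" if "\<not> card ?X \<le> \<sigma>"
      proof
        assume "?D u w"
        then have "card ?X \<le> \<sigma>" unfolding dead_side_def by blast
        then show False using that by blast
      qed
      show "?D u w = (case let X = ?X in if card X \<le> \<sigma> then Some (X, known (cross n X) w) else None of
          None \<Rightarrow> False | Some (X, M) \<Rightarrow> dead_side n M \<sigma> v u X)"
      proof (cases "card ?X \<le> \<sigma>")
        case True
        then show ?thesis by (simp only: Let_def if_True option.case prod.case dead_side_known)
      next
        case False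
        then show ?thesis using c[OF False] by (simp only: Let_def if_False option.case)
      qed
    qed (rule refl)
    then show ?thesis using c(2) by auto
  qed
  then have "\<forall>u. \<exists>c. qcomp (?D u) c \<and> (\<forall>w. c w \<le> ?B)" by blast
  from choice[OF this] obtain c where c: "\<And>u. qcomp (?D u) (c u)" "\<And>u w. c u w \<le> ?B" by blast
  define g where "g U w = (if card U \<le> Suc \<sigma> \<and> finite U then {u \<in> U. ?D u w} \<noteq> {} else False)" for U w
  define d where "d U w = (if card U \<le> Suc \<sigma> \<and> finite U then (\<Sum>u\<in>U. c u w) else 0)" for U w
  have gd: "qcomp (g U) (d U)" for U
  proof (cases "card U \<le> Suc \<sigma> \<and> finite U")
    case True
    then have "qcomp (\<lambda>w. {u \<in> U. ?D u w}) (\<lambda>w. \<Sum>u\<in>U. c u w)" by (intro qcomp_collect c(1)) simp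
    from qcomp_map[OF this, of "\<lambda>S. S \<noteq> {}"] show ?thesis using True by (simp add: g_def[abs_def] d_def[abs_def])
  next
    case False
    then have "g U = (\<lambda>w. False)" "d U = (\<lambda>w. 0)" by (auto simp: g_def d_def fun_eq_iff)
    then show ?thesis using qcomp_return[of False] by simp
  qed
  have "qcomp (\<lambda>w. nb n w v) (\<lambda>w. n)"
    using qcomp_nb[of "{..<n}" n v] by (rule qcomp_cong) (auto simp: nb_def)
  from qcomp_bind[OF this gd] have "qcomp (\<lambda>w. dead n w \<sigma> v) (\<lambda>w. n + d (nb n w v) w)"
  proof (rule qcomp_cong)
    fix w
    have "finite (nb n w v)" by (simp add: nb_def)
    then show "dead n w \<sigma> v = g (nb n w v) w" unfolding dead_iff g_def by auto
  qed simp
  moreover have "n + d (nb n w v) w \<le> n + Suc \<sigma> * ?B" for w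
  proof -
    have "d U w \<le> Suc \<sigma> * ?B" for U
    proof (cases "card U \<le> Suc \<sigma> \<and> finite U")
      case True
      have "(\<Sum>u\<in>U. c u w) \<le> card U * ?B" using sum_bounded_above[of U "\<lambda>u. c u w" ?B] c(2) by simp
      also have "\<dots> \<le> Suc \<sigma> * ?B" using True by (intro mult_le_mono1) simp
      finally show ?thesis using True by (simp add: d_def)
    qed (auto simp: d_def)
    then show ?thesis by (intro add_left_mono)
  qed
  ultimately show ?thesis using that by blast
qed

text \<open>Only queries are charged, so the tours through the sample may be searched
  exhaustively.\<close>

definition short_tour :: "inst \<Rightarrow> nat set \<Rightarrow> real \<Rightarrow> bool" where
  "short_tour w S t \<longleftrightarrow> (\<exists>xs. distinct xs \<and> set xs = S - {0} \<and> real (wcost w (0 # xs @ [0])) \<le> t)"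

lemma qcomp_short_tour:
  assumes "finite S"
  shows "qcomp (\<lambda>w. short_tour w S t) (\<lambda>w. card (insert 0 S) ^ 2)"
proof -
  let ?A = "insert 0 S \<times> insert 0 S"
  have m: "wcost (known ?A w) l = wcost w l" if "set l \<subseteq> insert 0 S" for l w
    using that by (induction l rule: wedges.induct) (auto simp: known_def)
  have "short_tour (known ?A w) S t = short_tour w S t" for w
  proof -
    have "wcost (known ?A w) (0 # xs @ [0]) = wcost w (0 # xs @ [0])" if "set xs = S - {0}" for xs
      using that by (intro m) auto
    then show ?thesis unfolding short_tour_def by metis
  qed
  moreover have "qcomp (known ?A) (\<lambda>w. card ?A)" by (rule qcomp_known) (use assms in simp)
  moreover have "card ?A = card (insert 0 S) ^ 2"
    by (simp only: card_cartesian_product power2_eq_square)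
  ultimately show ?thesis
    using qcomp_map[of "known ?A" "\<lambda>w. card ?A" "\<lambda>w. short_tour w S t"] by (simp only:)
qed

section \<open>Independent repetitions\<close>

lemma ex_pair:
  assumes "finite (set_pmf A)" "finite (set_pmf B)"
  shows "ex (pair_pmf A B) f = ex A (\<lambda>a. ex B (\<lambda>b. f (a, b)))"
  unfolding pair_pmf_def using assms by (simp add: ex_bind)

lemma finite_replicate_pmf:
  assumes "finite (set_pmf D)"
  shows "finite (set_pmf (replicate_pmf m D))"
  unfolding set_replicate_pmf using finite_lists_length_eq[OF assms, of m]
  by (rule rev_finite_subset) auto

lemma ex_replicate_Suc:
  assumes "finite (set_pmf D)"
  shows "ex (replicate_pmf (Suc m) D) f = ex D (\<lambda>x. ex (replicate_pmf m D) (\<lambda>xs. f (x # xs)))"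
  using assms by (simp add: ex_bind finite_replicate_pmf)

lemma ex_replicate_prod:
  assumes "finite (set_pmf D)"
  shows "ex (replicate_pmf m D) (\<lambda>xs. \<Prod>x\<leftarrow>xs. f x) = ex D f ^ m"
proof (induction m)
  case (Suc m)
  then show ?case unfolding ex_replicate_Suc[OF assms] by simp
qed simp

lemma ex_replicate_sum:
  assumes "finite (set_pmf D)"
  shows "ex (replicate_pmf m D) (\<lambda>xs. \<Sum>x\<leftarrow>xs. f x) = real m * ex D f"
proof (induction m)
  case (Suc m)
  have "ex (replicate_pmf (Suc m) D) (\<lambda>xs. \<Sum>x\<leftarrow>xs. f x) = ex D (\<lambda>x. f x + real m * ex D f)"
    unfolding ex_replicate_Suc[OF assms] list.map sum_list.Cons ex_add[OF finite_replicate_pmf[OF assms]]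
    using Suc by simp
  also have "\<dots> = ex D f + real m * ex D f" unfolding ex_add[OF assms] by simp
  finally show ?case by (simp add: algebra_simps)
qed simp

lemma of_bool_all_list: "of_bool (\<forall>x\<in>set xs. P x) = (\<Prod>x\<leftarrow>xs. of_bool (P x) :: real)"
proof (induction xs)
  case (Cons a xs)
  then show ?case by (cases "P a") simp_all
qed simp

lemma of_bool_ex_list: "of_bool (\<exists>x\<in>set xs. P x) \<le> (\<Sum>x\<leftarrow>xs. of_bool (P x) :: real)"
proof (induction xs)
  case (Cons a xs)
  have "0 \<le> (\<Sum>x\<leftarrow>xs. of_bool (P x) :: real)" by (intro sum_list_nonneg) auto
  then show ?case using Cons by (cases "P a") simp_all
qed simp

text \<open>Markov's inequality for \<open>16 ^ r\<close>, where \<open>r\<close> counts the bad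
  runs: the expectation is at most \<open>(1 + 15/16) ^ m <= 2 ^ m\<close>, and
  \<open>m <= 2 * r\<close> makes the variable at least \<open>4 ^ m\<close>.\<close>

lemma majority_error:
  assumes "finite (set_pmf D)" "measure_pmf.prob D {x. P x} \<le> 1/16"
  shows "measure_pmf.prob (replicate_pmf m D) {xs. m \<le> 2 * length (filter P xs)} \<le> 1 / 2 ^ m"
proof -
  have "measure_pmf.prob (replicate_pmf m D) {xs. m \<le> 2 * length (filter P xs)}
      \<le> ex (replicate_pmf m D) (\<lambda>xs. \<Prod>x\<leftarrow>xs. if P x then 16 else 1) / 4 ^ m"
  proof (rule prob_markov[OF finite_replicate_pmf[OF assms(1)]])
    fix xs :: "'a list"
    have e: "(\<Prod>x\<leftarrow>xs. if P x then 16 else 1 :: real) = 4 ^ (2 * length (filter P xs))"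
      by (induction xs) (auto simp: power_mult)
    show "0 \<le> (\<Prod>x\<leftarrow>xs. if P x then 16 else 1 :: real)" unfolding e by simp
    show "4 ^ m \<le> (\<Prod>x\<leftarrow>xs. if P x then 16 else 1 :: real)" if "m \<le> 2 * length (filter P xs)"
      unfolding e using that by (intro power_increasing) auto
  qed simp
  also have "ex (replicate_pmf m D) (\<lambda>xs. \<Prod>x\<leftarrow>xs. if P x then 16 else 1 :: real) = ex D (\<lambda>x. if P x then 16 else 1) ^ m"
    by (rule ex_replicate_prod[OF assms(1)])
  also have "ex D (\<lambda>x. if P x then 16 else 1 :: real) = ex D (\<lambda>x. 1 + 15 * of_bool (P x))"
    by (intro ex_cong) auto
  also have "\<dots> = 1 + 15 * measure_pmf.prob D {x. P x}"
    unfolding ex_add[OF assms(1)] ex_cmult prob_ex by simp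
  also have "(1 + 15 * measure_pmf.prob D {x. P x}) ^ m / 4 ^ m \<le> 2 ^ m / 4 ^ m"
    using assms(2) by (intro divide_right_mono power_mono) auto
  also have "(2 ^ m / 4 ^ m :: real) = 1 / 2 ^ m"
    using power_mult_distrib[of "2::real" 2 m] by simp
  finally show ?thesis .
qed

section \<open>Uniform samples with replacement\<close>

definition smp :: "nat \<Rightarrow> nat \<Rightarrow> nat list pmf" where
  "smp n m = replicate_pmf m (pmf_of_set {..<n})"

context
  fixes n :: nat
  assumes n: "0 < n"
begin

lemma finite_unif: "finite (set_pmf (pmf_of_set {..<n}))"
  using n by (subst set_pmf_of_set) auto

lemma set_smp: "us \<in> set_pmf (smp n m) \<Longrightarrow> set us \<subseteq> {..<n} \<and> length us = m"
  using n set_pmf_of_set[of "{..<n}"] by (auto simp: smp_def set_replicate_pmf lessThan_empty_iff)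

lemma finite_smp: "finite (set_pmf (smp n m))"
  unfolding smp_def by (rule finite_replicate_pmf[OF finite_unif])

lemma ex_unif: "ex (pmf_of_set {..<n}) f = (\<Sum>v<n. f v) / real n"
  using n by (subst integral_pmf_of_set) auto

lemma ex_unif_mem:
  assumes "A \<subseteq> {..<n}"
  shows "ex (pmf_of_set {..<n}) (\<lambda>v. of_bool (v \<in> A)) = real (card A) / real n"
proof -
  have "(\<Sum>v<n. of_bool (v \<in> A) :: real) = real (card A)"
    using assms by (simp add: of_bool_def sum.If_cases Int_absorb1)
  then show ?thesis by (simp add: ex_unif)
qed

lemma ex_smp_sum: "ex (smp n m) (\<lambda>us. \<Sum>v\<leftarrow>us. f v) = real m * ((\<Sum>v<n. f v) / real n)"
  unfolding smp_def ex_replicate_sum[OF finite_unif] ex_unif ..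

lemma ex_smp_all:
  assumes "A \<subseteq> {..<n}"
  shows "ex (smp n m) (\<lambda>us. of_bool (\<forall>v\<in>set us. v \<in> A)) = (real (card A) / real n) ^ m"
  unfolding of_bool_all_list smp_def ex_replicate_prod[OF finite_unif] ex_unif_mem[OF assms] ..

lemma ex_smp_none:
  assumes "A \<subseteq> {..<n}"
  shows "ex (smp n m) (\<lambda>us. of_bool (\<forall>v\<in>set us. v \<notin> A)) = (1 - real (card A) / real n) ^ m"
proof -
  have "ex (smp n m) (\<lambda>us. of_bool (\<forall>v\<in>set us. v \<notin> A)) = ex (smp n m) (\<lambda>us. of_bool (\<forall>v\<in>set us. v \<in> {..<n} - A))"
    by (intro ex_cong) (use set_smp in \<open>auto simp: of_bool_def\<close>)
  also have "\<dots> = (real (card ({..<n} - A)) / real n) ^ m" by (rule ex_smp_all) auto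
  also have "real (card ({..<n} - A)) = real n - real (card A)"
    using assms card_mono[OF _ assms] by (simp add: card_Diff_subset finite_subset[OF assms] of_nat_diff)
  finally show ?thesis using n by (simp add: diff_divide_distrib)
qed

lemma ex_smp_some:
  assumes "A \<subseteq> {..<n}"
  shows "ex (smp n m) (\<lambda>us. of_bool (\<exists>v\<in>set us. v \<in> A)) \<le> real m * (real (card A) / real n)"
proof -
  have "ex (smp n m) (\<lambda>us. of_bool (\<exists>v\<in>set us. v \<in> A)) \<le> ex (smp n m) (\<lambda>us. \<Sum>v\<leftarrow>us. of_bool (v \<in> A))"
    by (intro ex_mono[OF finite_smp] of_bool_ex_list)
  also have "\<dots> = real m * (real (card A) / real n)"
    unfolding smp_def ex_replicate_sum[OF finite_unif] ex_unif_mem[OF assms] ..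
  finally show ?thesis .
qed

end

text \<open>The latest round is at the head, so dropping \<open>j\<close> entries leaves the first
  \<open>g\<close> rounds.\<close>

lemma ex_rsets_drop: "ex (rsets n q (g + j)) (\<lambda>Rs. f (drop j Rs)) = ex (rsets n q g) f"
proof (induction j)
  case (Suc j)
  then show ?case unfolding add_Suc_right ex_rsets_Suc by simp
qed simp

lemma ex_rsets_Union:
  assumes "\<And>i. i < g \<Longrightarrow> 0 \<le> q i \<and> q i \<le> 1"
  shows "ex (rsets n q g) (\<lambda>Rs. real (card (\<Union>(set Rs)))) \<le> real n * (\<Sum>i<g. q i)"
  using assms
proof (induction g)
  case (Suc g)
  have "ex (rsets n q (Suc g)) (\<lambda>Rs. real (card (\<Union>(set Rs))))
      \<le> ex (rsets n q g) (\<lambda>Rs. real n * q g + real (card (\<Union>(set Rs))))"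
    unfolding ex_rsets_Suc
  proof (rule ex_mono[OF finite_rsets])
    fix Rs
    have "ex (rset n (q g)) (\<lambda>R. real (card (\<Union>(set (R # Rs)))))
        \<le> ex (rset n (q g)) (\<lambda>R. real (card (\<Union>(set Rs))) + (\<Sum>y<n. 1 * of_bool (y \<in> R)))"
    proof (rule ex_mono[OF finite_rset])
      fix R assume "R \<in> set_pmf (rset n (q g))"
      then have R: "R \<subseteq> {..<n}" using set_rset by auto
      then have "(\<Sum>y<n. 1 * of_bool (y \<in> R) :: real) = real (card R)"
        by (simp add: of_bool_def sum.If_cases Int_absorb1)
      moreover have "card (\<Union>(set (R # Rs))) \<le> card R + card (\<Union>(set Rs))" by (simp add: card_Un_le)
      ultimately show "real (card (\<Union>(set (R # Rs)))) \<le> real (card (\<Union>(set Rs))) + (\<Sum>y<n. 1 * of_bool (y \<in> R))"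
        by linarith
    qed
    also have "\<dots> = real (card (\<Union>(set Rs))) + q g * (\<Sum>y<n. 1)"
      by (rule ex_rset_lin) (use Suc.prems[of g] in auto)
    finally show "ex (rset n (q g)) (\<lambda>R. real (card (\<Union>(set (R # Rs))))) \<le> real n * q g + real (card (\<Union>(set Rs)))"
      by (simp add: mult.commute)
  qed
  also have "\<dots> = real n * q g + ex (rsets n q g) (\<lambda>Rs. real (card (\<Union>(set Rs))))"
    unfolding ex_add[OF finite_rsets] by simp
  finally show ?case using Suc by (simp add: algebra_simps)
qed simp

section \<open>A single run of the tests\<close>

lemma qcomp_any:
  assumes "\<And>x. qcomp (\<lambda>w. f x w) (c x)"
  shows "qcomp (\<lambda>w. \<exists>x\<in>set xs. f x w) (\<lambda>w. \<Sum>x\<leftarrow>xs. c x w)"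
  using qcomp_map[OF qcomp_list[where xs = xs, OF assms], of "\<lambda>bs. True \<in> set bs"]
  by (rule qcomp_cong) (auto simp: image_iff)

lemma qcomp_all:
  assumes "\<And>x. qcomp (\<lambda>w. f x w) (c x)"
  shows "qcomp (\<lambda>w. \<forall>x\<in>set xs. f x w) (\<lambda>w. \<Sum>x\<leftarrow>xs. c x w)"
  using qcomp_map[OF qcomp_list[where xs = xs, OF assms], of "\<lambda>bs. False \<notin> set bs"]
  by (rule qcomp_cong) (auto simp: image_iff)

lemma qcomp_not: "qcomp f c \<Longrightarrow> qcomp (\<lambda>w. \<not> f w) c"
  by (rule qcomp_map)

lemma real_sum_list: "real (\<Sum>x\<leftarrow>xs. f x) = (\<Sum>x\<leftarrow>xs. real (f x))"
  by (induction xs) auto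

lemma frz_metric: "pos_int_metric n w \<Longrightarrow> frz n w"
  by unfold_locales (simp add: pos_int_metric_def)

lemma exp_3_ge: "16 \<le> exp (3 :: real)"
proof -
  have "(13/8 :: real) \<le> exp (1/2)" using exp_lower_Taylor_quadratic[of "1/2"] by (simp add: power2_eq_square)
  then have "(13/8 :: real) ^ 6 \<le> exp (1/2) ^ 6" by (intro power_mono) auto
  also have "exp (1/2 :: real) ^ 6 = exp 3" by (simp add: exp_of_nat_mult[symmetric])
  finally show ?thesis by (simp add: power_divide)
qed

text \<open>The 46 cancels the one in \<open>tree_metric_contraction\<close>, so that
  \<open>card Z\<close> is at most \<open>n / 10 ^ 13\<close>. The power of ten keeps
  \<open>card W\<close> negligible against n even after division by the last sampling rate
  \<open>1 / 10 ^ 8\<close>.\<close>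

definition \<epsilon>0 :: real where
  "\<epsilon>0 = 1 / (46 * 10 ^ 13)"

text \<open>Here \<open>4 ^ k\<close> is of the order of \<open>sqrt n\<close>. The sampling rates \<open>q i\<close> grow from below \<open>1 / n\<close> to
  \<open>10 powr -8\<close>. The first \<open>k + 3\<close> rounds of the freezing process are cheap enough to be simulated for
  all vertices; the remaining \<open>k\<close> rounds are only explored recursively from sampled vertices.\<close>

locale run =
  fixes n k :: nat
  assumes k2: "2 \<le> k" and n_lower: "16 ^ k \<le> n" and n_upper: "n < 16 ^ (k + 1)"
begin

text \<open>The last rate has to be far below \<open>1 / 125000\<close>: away from \<open>W\<close>
  the process freezes a fraction of the vertices of about this size, and the sample
  \<open>us2\<close> should meet none of them.\<close>

definition q :: "nat \<Rightarrow> real" where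
  "q i = 4 ^ i / (10 ^ 8 * 4 ^ (2 * k + 2))"

text \<open>A subtree with more than \<open>2 ^ k\<close> vertices receives at least
  \<open>3 * k + 8\<close> sample points in expectation, enough for a union bound over all such
  subtrees.\<close>

definition s :: nat where
  "s = (n div 2 ^ k + 1) * (3 * k + 8)"

definition coins where
  "coins = pair_pmf (rsets n q (2 * k + 3)) (pair_pmf (smp n 250) (pair_pmf (smp n 125000) (pair_pmf (smp n 40) (smp n s))))"

text \<open>The extra round with sample \<open>{..<n}\<close> keeps exactly the isolated active
  vertices. A small sample that meets one of them, next to a large sample without any frozen vertex,
  is evidence that isolated vertices outnumber frozen ones.\<close>

definition freeze_reject :: "inst \<Rightarrow> nat set list \<Rightarrow> nat list \<Rightarrow> nat list \<Rightarrow> bool" where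
  "freeze_reject w Rs us1 us2 \<longleftrightarrow> (\<exists>v\<in>set us1. v \<in> act n w ({..<n} # Rs)) \<and> (\<forall>v\<in>set us2. v \<in> act n w Rs)"

definition accept where
  "accept w x = (case x of (Rs, us1, us2, us3, us) \<Rightarrow>
     \<not> freeze_reject w Rs us1 us2 \<and> \<not> (\<exists>v\<in>set us3. dead n w (2 ^ k) v) \<and> short_tour w (set us) ((1 + \<epsilon>0) * real n))"

definition cost_dead :: nat where
  "cost_dead = n + Suc (2 ^ k) * (2 * (2 ^ k * n) + 2 * n)"

definition cost where
  "cost w x = (case x of (Rs, us1, us2, us3, us) \<Rightarrow>
     n * card (\<Union>(set (drop k Rs))) + (\<Sum>v\<leftarrow>us1. cst n w (k + 3) ({..<n} # Rs) v) + (\<Sum>v\<leftarrow>us2. cst n w (k + 3) Rs v)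
       + 40 * cost_dead + (s + 1) ^ 2)"

text \<open>\<open>12800000 = 32 * 400000\<close>: 32 times the bound of \<open>ex_cost_le\<close>,
  for Markov's inequality.\<close>

definition budget :: nat where
  "budget = 12800000 * n * 4 ^ k * (3 * k + 8) ^ 2"

lemma n_pos: "0 < n"
  using n_lower by (metis gr0I le_zero_eq power_not_zero zero_neq_numeral)

lemma n_ge: "256 \<le> n"
  using n_lower power_increasing[OF k2, of "16::nat"] by simp

lemma q4: "q (Suc i) = 4 * q i"
  by (simp add: q_def)

lemma q_pos: "0 < q i"
  by (simp add: q_def)

lemma q_last: "q (2 * k + 2) = 1 / 10 ^ 8"
  by (simp add: q_def)

lemma q_mono: "i \<le> j \<Longrightarrow> q i \<le> q j"
  unfolding q_def by (intro divide_right_mono power_increasing) auto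

lemma q_le: "i < 2 * k + 3 \<Longrightarrow> 0 < q i \<and> q i \<le> 1"
  using q_mono[of i "2 * k + 2"] q_last q_pos by simp

lemma q_sum: "(\<Sum>i<m. q i) \<le> q m / 3"
  by (induction m) (use q4 q_pos[of 0] in auto)

lemma real_n_upper: "real n \<le> 16 * 4 ^ k * 4 ^ k"
proof -
  have "real n \<le> real (16 ^ (k + 1))" using n_upper by (intro of_nat_mono) simp
  also have "\<dots> = 16 * 4 ^ k * 4 ^ k" by (simp add: power_mult_distrib[symmetric])
  finally show ?thesis .
qed

lemma q_0: "q 0 * real n \<le> 1"
proof -
  have "q 0 * real n \<le> q 0 * (16 * 4 ^ k * 4 ^ k)" using real_n_upper q_pos[of 0] by (intro mult_left_mono) auto
  also have "\<dots> \<le> 1" by (simp add: q_def power_add power_mult mult_2)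
  finally show ?thesis .
qed

lemma finite_coins: "finite (set_pmf coins)"
  by (simp add: coins_def finite_rsets finite_smp[OF n_pos])

lemma ex_coins: "ex coins f = ex (rsets n q (2 * k + 3)) (\<lambda>Rs. ex (smp n 250) (\<lambda>us1. ex (smp n 125000) (\<lambda>us2.
    ex (smp n 40) (\<lambda>us3. ex (smp n s) (\<lambda>us. f (Rs, us1, us2, us3, us))))))"
  by (simp add: coins_def ex_pair finite_rsets finite_smp[OF n_pos])

lemma set_coins:
  assumes "(Rs, us1, us2, us3, us) \<in> set_pmf coins"
  shows "length Rs = 2 * k + 3" "set Rs \<subseteq> Pow {..<n}" "length us3 = 40" "set us \<subseteq> {..<n}" "length us = s"
  using assms set_rsets set_smp[OF n_pos] by (fastforce simp: coins_def)+

lemma qcomp_freeze_reject: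
  assumes "set (Rs2 @ Rs1) \<subseteq> Pow {..<n}" "length Rs1 = g"
  shows "qcomp (\<lambda>w. freeze_reject w (Rs2 @ Rs1) us1 us2) (\<lambda>w. n * card (\<Union>(set Rs1)) +
     ((\<Sum>v\<leftarrow>us1. cst n w g ({..<n} # Rs2 @ Rs1) v) + (\<Sum>v\<leftarrow>us2. cst n w g (Rs2 @ Rs1) v)))"
proof -
  let ?g = "\<lambda>A w. (\<exists>v\<in>set us1. v \<in> actf n w A ({..<n} # Rs2)) \<and> (\<forall>v\<in>set us2. v \<in> actf n w A Rs2)"
  let ?d = "\<lambda>A w. (\<Sum>v\<leftarrow>us1. cstf n w A ({..<n} # Rs2) v) + (\<Sum>v\<leftarrow>us2. cstf n w A Rs2 v)"
  have "qcomp (\<lambda>w. act n w Rs1) (\<lambda>w. n * card (\<Union>(set Rs1)))" by (rule qcomp_act) (use assms in auto)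
  moreover have "qcomp (?g A) (?d A)" for A
    by (intro qcomp_conj qcomp_any qcomp_all qcomp_actf) (use assms in auto)
  ultimately have "qcomp (\<lambda>w. ?g (act n w Rs1) w) (\<lambda>w. n * card (\<Union>(set Rs1)) + ?d (act n w Rs1) w)"
    by (rule qcomp_bind)
  then show ?thesis
    unfolding freeze_reject_def act_append[symmetric] cst_append[symmetric] assms(2) append_Cons .
qed

lemma qcomp_accept:
  assumes "x \<in> set_pmf coins"
  obtains c where "qcomp (\<lambda>w. accept w x) c" "\<And>w. c w \<le> cost w x"
proof -
  obtain Rs us1 us2 us3 us where x: "x = (Rs, us1, us2, us3, us)" by (cases x)
  note c = set_coins[OF assms[unfolded x]]
  have "qcomp (\<lambda>w. freeze_reject w (take k Rs @ drop k Rs) us1 us2) (\<lambda>w. n * card (\<Union>(set (drop k Rs))) +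
     ((\<Sum>v\<leftarrow>us1. cst n w (k + 3) ({..<n} # take k Rs @ drop k Rs) v) + (\<Sum>v\<leftarrow>us2. cst n w (k + 3) (take k Rs @ drop k Rs) v)))"
    by (rule qcomp_freeze_reject) (use c in auto)
  then have f: "qcomp (\<lambda>w. freeze_reject w Rs us1 us2) (\<lambda>w. n * card (\<Union>(set (drop k Rs))) +
     ((\<Sum>v\<leftarrow>us1. cst n w (k + 3) ({..<n} # Rs) v) + (\<Sum>v\<leftarrow>us2. cst n w (k + 3) Rs v)))"
    unfolding append_take_drop_id .
  have "\<forall>v. \<exists>d. qcomp (\<lambda>w. dead n w (2 ^ k) v) d \<and> (\<forall>w. d w \<le> cost_dead)"
    unfolding cost_dead_def using qcomp_dead by metis
  from choice[OF this] obtain d where d: "\<And>v. qcomp (\<lambda>w. dead n w (2 ^ k) v) (d v)" "\<And>v w. d v w \<le> cost_dead"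
    by blast
  have "qcomp (\<lambda>w. accept w x) (\<lambda>w. (n * card (\<Union>(set (drop k Rs))) +
     ((\<Sum>v\<leftarrow>us1. cst n w (k + 3) ({..<n} # Rs) v) + (\<Sum>v\<leftarrow>us2. cst n w (k + 3) Rs v)))
     + ((\<Sum>v\<leftarrow>us3. d v w) + card (insert 0 (set us)) ^ 2))"
    unfolding accept_def x prod.case
    by (intro qcomp_conj qcomp_not f qcomp_any d(1) qcomp_short_tour) simp
  moreover have "(\<Sum>v\<leftarrow>us3. d v w) \<le> 40 * cost_dead" for w
  proof -
    have "(\<Sum>v\<leftarrow>us3. d v w) \<le> length us3 * cost_dead" using d(2) by (induction us3) (auto intro: add_mono)
    then show ?thesis using c by simp
  qed
  moreover have "card (insert 0 (set us)) ^ 2 \<le> (s + 1) ^ 2"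
    using card_length[of us] c(5) card_insert_le_m1[of "s + 1" "set us" 0] by (intro power_mono) auto
  ultimately show ?thesis
    using that unfolding cost_def x prod.case
    by (metis (no_types, lifting) add_mono order_refl add.assoc)
qed

text \<open>Cutting a run off turns it into a rejection, so only the completeness side depends on
  the cost.\<close>

lemma bit_exists:
  assumes "x \<in> set_pmf coins"
  shows "\<exists>b. (\<exists>d. qcomp b d \<and> (\<forall>w. d w \<le> budget)) \<and> (\<forall>w. b w \<longrightarrow> accept w x) \<and>
     (\<forall>w. accept w x \<longrightarrow> cost w x \<le> budget \<longrightarrow> b w)"
proof -
  obtain c where c: "qcomp (\<lambda>w. accept w x) c" "\<And>w. c w \<le> cost w x" using qcomp_accept[OF assms] by blast
  obtain d where "qcomp (\<lambda>w. accept w x \<and> c w \<le> budget) d" "\<And>w. d w \<le> budget" using qcomp_truncate[OF c(1), of budget] by blast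
  then show ?thesis using c(2) by (intro exI[of _ "\<lambda>w. accept w x \<and> c w \<le> budget"]) (auto intro: order_trans)
qed

lemma pow_facts: "(2::real) ^ k * 2 ^ k = 4 ^ k" "(16::real) \<le> 4 ^ k" "(3::real) ^ k \<le> 4 ^ k" "(4::real) ^ k * 4 ^ k \<le> real n"
proof -
  show "(2::real) ^ k * 2 ^ k = 4 ^ k" by (simp add: power_mult_distrib[symmetric])
  show "(16::real) \<le> 4 ^ k" using power_increasing[OF k2, of "4::real"] by simp
  show "(3::real) ^ k \<le> 4 ^ k" by (intro power_mono) auto
  have "(4::real) ^ k * 4 ^ k = real (16 ^ k)" by (simp add: power_mult_distrib[symmetric])
  then show "(4::real) ^ k * 4 ^ k \<le> real n" using n_lower by (simp only: of_nat_le_iff)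
qed

section \<open>Expected number of queries of one run\<close>

lemma cost_dead_le: "real cost_dead \<le> 9 * (real n * 4 ^ k)"
proof -
  have e: "real cost_dead = real n + 2 * real n * (1 + 2 ^ k)\<^sup>2"
    by (simp add: cost_dead_def power2_eq_square algebra_simps)
  have "(1 + 2 ^ k :: real)\<^sup>2 \<le> (2 * 2 ^ k)\<^sup>2" by (intro power_mono) auto
  also have "\<dots> = 4 * 4 ^ k" using pow_facts(1) by (simp add: power2_eq_square)
  finally have "2 * real n * (1 + 2 ^ k)\<^sup>2 \<le> 2 * real n * (4 * 4 ^ k)" by (intro mult_left_mono) auto
  moreover have "real n * 1 \<le> real n * 4 ^ k" using pow_facts(2) by (intro mult_left_mono) auto
  ultimately show ?thesis unfolding e by linarith
qed

lemma s_ge: "real n \<le> 2 ^ k * real (n div 2 ^ k + 1)"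
proof -
  have "n \<le> 2 ^ k * (n div 2 ^ k + 1)"
    using dividend_less_times_div[of "2 ^ k" n] by (simp add: algebra_simps)
  from of_nat_mono[OF this, where ?'a = real] show ?thesis by (simp add: algebra_simps)
qed

lemma sample_cost_le: "(real s + 1)\<^sup>2 \<le> 144 * (real n * 4 ^ k) * (3 * real k + 8)\<^sup>2"
proof -
  let ?l = "3 * real k + 8" and ?r = "real n / 2 ^ k"
  have "real (n div 2 ^ k) \<le> real n / real (2 ^ k)" by (rule of_nat_div_le_of_nat)
  then have d: "real (n div 2 ^ k) \<le> ?r" by simp
  have "(2::real) ^ k * 1 \<le> 2 ^ k * 2 ^ k" by (intro mult_left_mono) auto
  also have "\<dots> \<le> 4 ^ k * 4 ^ k" using pow_facts(1,2) by simp
  also have "\<dots> \<le> real n" by (rule pow_facts(4))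
  finally have r1: "1 \<le> ?r" by (simp add: field_simps)
  have "real s + 1 = real (n div 2 ^ k + 1) * ?l + 1" by (simp add: s_def algebra_simps)
  also have "\<dots> \<le> (2 * ?r) * ?l + ?r * ?l"
  proof (rule add_mono)
    have "real (n div 2 ^ k + 1) \<le> 2 * ?r" using add_mono[OF d r1] by simp
    then show "real (n div 2 ^ k + 1) * ?l \<le> (2 * ?r) * ?l" by (intro mult_right_mono) auto
    show "1 \<le> ?r * ?l" using mult_mono[OF r1, of 1 ?l] r1 by simp
  qed
  also have "\<dots> = 3 * ?r * ?l" by simp
  finally have "(real s + 1)\<^sup>2 \<le> (3 * ?r * ?l)\<^sup>2" by (intro power_mono) auto
  also have "\<dots> = 9 * (real n * real n / 4 ^ k) * ?l\<^sup>2"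
    using pow_facts(1) by (simp add: power2_eq_square)
  also have "\<dots> \<le> 9 * (16 * (real n * 4 ^ k)) * ?l\<^sup>2"
  proof -
    have "real n * real n \<le> real n * (16 * 4 ^ k * 4 ^ k)" using real_n_upper by (intro mult_left_mono) auto
    then have "real n * real n / 4 ^ k \<le> 16 * (real n * 4 ^ k)" by (simp add: field_simps)
    then show ?thesis by (intro mult_right_mono mult_left_mono) auto
  qed
  finally show ?thesis by simp
qed

text \<open>Four sources, as multiples of \<open>n * 4 ^ k\<close>: the dead-end searches and the
  sampled tour (504, with the squared logarithmic factor), the rows of the vertices sampled in the
  first \<open>k + 3\<close> rounds (1), and the recursions started from \<open>us1\<close> (1500)
  and from \<open>us2\<close> (375000).\<close>

lemma ex_cost_le:
  assumes "frz n w"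
  shows "ex coins (\<lambda>x. real (cost w x)) \<le> 400000 * (real n * 4 ^ k) * (3 * real k + 8)\<^sup>2"
proof -
  interpret frz n w by fact
  let ?g = "k + 3" and ?M = "rsets n q (2 * k + 3)"
  define K where "K = 40 * real cost_dead + (real s + 1)\<^sup>2"
  define U where "U Rs = real n * real (card (\<Union>(set (drop k Rs))))" for Rs :: "nat set list"
  have c: "real (cost w (Rs, us1, us2, us3, us)) = K + U Rs
      + (\<Sum>v\<leftarrow>us1. real (cst n w ?g ({..<n} # Rs) v)) + (\<Sum>v\<leftarrow>us2. real (cst n w ?g Rs v))" for Rs us1 us2 us3 us
    unfolding cost_def prod.case of_nat_add real_sum_list K_def U_def by simp
  have "ex coins (\<lambda>x. real (cost w x))
      = ex ?M (\<lambda>Rs. K + U Rs + 250 * (Phi ?g ({..<n} # Rs) / real n) + 125000 * (Phi ?g Rs / real n))"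
    unfolding ex_coins c ex_add[OF finite_smp[OF n_pos]]
    by (simp add: ex_smp_sum[OF n_pos] Phi_def del: cst.simps)
  also have "\<dots> \<le> ex ?M (\<lambda>Rs. K + U Rs + 250 / real n * (Phi ?g Rs + (real n ^ 2 + Psi ?g Rs)) + 125000 / real n * Phi ?g Rs)"
  proof (rule ex_mono[OF finite_rsets])
    fix Rs assume "Rs \<in> set_pmf ?M"
    then have "length Rs = 2 * k + 3" using set_rsets by blast
    then have "250 / real n * Phi ?g ({..<n} # Rs) \<le> 250 / real n * (Phi ?g Rs + (real n ^ 2 + Psi ?g Rs))"
      by (intro mult_left_mono Phi_all) auto
    then show "K + U Rs + 250 * (Phi ?g ({..<n} # Rs) / real n) + 125000 * (Phi ?g Rs / real n)
      \<le> K + U Rs + 250 / real n * (Phi ?g Rs + (real n ^ 2 + Psi ?g Rs)) + 125000 / real n * Phi ?g Rs" by simp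
  qed
  also have "\<dots> = K + ex ?M U + 250 / real n * (ex ?M (Phi ?g) + (real n ^ 2 + ex ?M (Psi ?g))) + 125000 / real n * ex ?M (Phi ?g)"
    unfolding ex_add[OF finite_rsets] ex_cmult by simp
  also have "\<dots> \<le> 504 * (real n * 4 ^ k) * (3 * real k + 8)\<^sup>2 + real n * 4 ^ k + 1500 * (real n * 4 ^ k) + 375000 * (real n * 4 ^ k)"
  proof (intro add_mono)
    have l: "1 \<le> (3 * real k + 8)\<^sup>2" using power_mono[of 1 "3 * real k + 8" 2] by simp
    have "360 * (real n * 4 ^ k) * 1 \<le> 360 * (real n * 4 ^ k) * (3 * real k + 8)\<^sup>2"
      using l by (intro mult_left_mono) auto
    then show "K \<le> 504 * (real n * 4 ^ k) * (3 * real k + 8)\<^sup>2"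
      unfolding K_def using cost_dead_le sample_cost_le by (simp add: algebra_simps)
    have L: "2 * k + 3 = ?g + k" by simp
    have ec: "real n ^ 2 + ex ?M (Psi ?g) + q (2 * k + 3) * ex ?M (Om ?g) \<le> 3 * real n ^ 2 * 3 ^ k
        \<and> ex ?M (Phi ?g) \<le> 3 * real n ^ 2 * 3 ^ k"
      unfolding L by (rule expected_cost[where L = "2 * k + 3"]) (use q_le q4 in auto)
    have b: "3 * real n ^ 2 * 3 ^ k \<le> 3 * real n ^ 2 * 4 ^ k" using pow_facts(3) by (intro mult_left_mono) auto
    have "0 \<le> ex ?M (Om ?g)" by (intro Bochner_Integration.integral_nonneg Om_nonneg)
    then have "0 \<le> q (2 * k + 3) * ex ?M (Om ?g)" using q_pos[of "2 * k + 3"] by simp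
    then have P: "real n ^ 2 + ex ?M (Psi ?g) \<le> 3 * real n ^ 2 * 4 ^ k" and F: "ex ?M (Phi ?g) \<le> 3 * real n ^ 2 * 4 ^ k"
      using ec b by linarith+
    have "250 / real n * (ex ?M (Phi ?g) + (real n ^ 2 + ex ?M (Psi ?g))) \<le> 250 / real n * (6 * real n ^ 2 * 4 ^ k)"
      using P F by (intro mult_left_mono) auto
    also have "\<dots> = 1500 * (real n * 4 ^ k)" using n_pos by (simp add: power2_eq_square)
    finally show "250 / real n * (ex ?M (Phi ?g) + (real n ^ 2 + ex ?M (Psi ?g))) \<le> 1500 * (real n * 4 ^ k)" .
    have "125000 / real n * ex ?M (Phi ?g) \<le> 125000 / real n * (3 * real n ^ 2 * 4 ^ k)"
      using F by (intro mult_left_mono) auto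
    also have "\<dots> = 375000 * (real n * 4 ^ k)" using n_pos by (simp add: power2_eq_square)
    finally show "125000 / real n * ex ?M (Phi ?g) \<le> 375000 * (real n * 4 ^ k)" .
    have "ex ?M U = real n * ex (rsets n q ?g) (\<lambda>Rs. real (card (\<Union>(set Rs))))"
      unfolding L U_def ex_cmult ex_rsets_drop[where f = "\<lambda>Rs. real (card (\<Union>(set Rs)))"] ..
    also have "\<dots> \<le> real n * (real n * (\<Sum>i<?g. q i))"
      using q_le by (intro mult_left_mono ex_rsets_Union) (auto intro: less_imp_le)
    \<comment> \<open>By the middle round at most \<open>n / (16 * 4 ^ k) <= 4 ^ k\<close> vertices
      have been sampled in expectation, so their rows fit into \<open>n * 4 ^ k\<close>
      queries.\<close>
    also have "\<dots> \<le> real n * (real n * (1 / 16 / 4 ^ k))"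
    proof -
      have "(\<Sum>i<?g. q i) \<le> q ?g / 3" by (rule q_sum)
      also have "\<dots> \<le> 1 / 16 / 4 ^ k" by (simp add: q_def power_add power_mult mult_2 power2_eq_square field_simps)
      finally show ?thesis by (intro mult_left_mono) auto
    qed
    also have "\<dots> \<le> real n * 4 ^ k"
    proof -
      have "real n * (1 / 16 / 4 ^ k) \<le> 4 ^ k" using real_n_upper by (simp add: field_simps)
      then show ?thesis by (intro mult_left_mono) auto
    qed
    finally show "ex ?M U \<le> real n * 4 ^ k" .
  qed
  also have "\<dots> \<le> 400000 * (real n * 4 ^ k) * (3 * real k + 8)\<^sup>2"
  proof -
    have "1 \<le> (3 * real k + 8)\<^sup>2" using power_mono[of 1 "3 * real k + 8" 2] by simp
    then have "(real n * 4 ^ k) * 1 \<le> (real n * 4 ^ k) * (3 * real k + 8)\<^sup>2"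
      by (intro mult_left_mono) auto
    moreover have "0 \<le> (real n * 4 ^ k) * (3 * real k + 8)\<^sup>2" by simp
    ultimately show ?thesis by (simp only: mult.assoc mult_1_right)
  qed
  finally show ?thesis .
qed

lemma prob_over_budget:
  assumes "frz n w"
  shows "ex coins (\<lambda>x. of_bool (budget < cost w x)) \<le> 1/32"
proof -
  have B: "real budget = 32 * (400000 * (real n * 4 ^ k) * (3 * real k + 8)\<^sup>2)"
    by (simp add: budget_def)
  have B0: "0 < real budget" using n_pos by (simp add: budget_def)
  have "ex coins (\<lambda>x. of_bool (budget < cost w x)) = measure_pmf.prob coins {x. budget < cost w x}"
    by (rule prob_ex[symmetric])
  also have "\<dots> \<le> ex coins (\<lambda>x. real (cost w x)) / real budget"
    by (rule prob_markov[OF finite_coins]) (use B0 in auto)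
  also have "\<dots> \<le> (real budget / 32) / real budget"
    using ex_cost_le[OF assms] B B0 by (intro divide_right_mono) auto
  finally show ?thesis using B0 by simp
qed

section \<open>Error probabilities of one run\<close>

lemma ex_freeze_reject:
  "ex coins (\<lambda>x. of_bool (case x of (Rs, us1, us2, us3, us) \<Rightarrow> freeze_reject w Rs us1 us2)) =
   ex (rsets n q (2 * k + 3)) (\<lambda>Rs. ex (smp n 250) (\<lambda>us1. of_bool (\<exists>v\<in>set us1. v \<in> act n w ({..<n} # Rs))) *
     ex (smp n 125000) (\<lambda>us2. of_bool (\<forall>v\<in>set us2. v \<in> act n w Rs)))"
  unfolding ex_coins prod.case freeze_reject_def of_bool_conj by simp

text \<open>A union bound over three failures: the freezing test, a sampled dead vertex
  (\<open>40 * 20 * \<epsilon>0\<close>) and an exceeded budget (\<open>1/32\<close>). The sampled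
  tour never fails, since shortcutting an optimal tour keeps it cheap.\<close>

lemma short_instance_accepted:
  assumes pr: "promise n w" and short: "real (TSP n w) < (1 + \<epsilon>0) * real n"
  shows "ex coins (\<lambda>x. of_bool (\<not> (accept w x \<and> cost w x \<le> budget))) \<le> 1/16"
proof -
  have met: "pos_int_metric n w" using pr by (simp add: promise_def)
  interpret frz n w by (rule frz_metric[OF met])
  obtain par lev where "utree n par lev w" using promise_imp_utree[OF pr n_pos] .
  then interpret utree n par lev w .
  obtain p where pp: "p permutes {..<n}" "tour_cost n w p = TSP n w" using TSP_attained by metis
  interpret good_tour n par lev w p by unfold_locales (use pp n_ge in auto)
  have slack: "real (tour_cost n w p - n) \<le> \<epsilon>0 * real n"
    using short pp(2) tour_cost_ge by (simp add: of_nat_diff algebra_simps)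
  have st: "short_tour w S ((1 + \<epsilon>0) * real n)" if S: "S \<subseteq> {..<n}" for S
  proof -
    obtain xs where "distinct xs" "set xs = S - {0}" "wcost w (0 # xs @ [0]) \<le> tour_cost n w p"
      using tour_on_subset[OF S] .
    then show ?thesis unfolding short_tour_def using short pp(2) by (intro exI[of _ xs]) auto
  qed
  let ?D = "{v. v < n \<and> dead n w (2 ^ k) v}"
  have "ex coins (\<lambda>x. of_bool (\<not> (accept w x \<and> cost w x \<le> budget)))
     \<le> ex coins (\<lambda>x. of_bool (case x of (Rs, us1, us2, us3, us) \<Rightarrow> freeze_reject w Rs us1 us2)
       + of_bool (case x of (Rs, us1, us2, us3, us) \<Rightarrow> \<exists>v\<in>set us3. v \<in> ?D) + of_bool (budget < cost w x))"
  proof (rule ex_mono[OF finite_coins])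
    fix x assume x: "x \<in> set_pmf coins"
    obtain Rs us1 us2 us3 us where e: "x = (Rs, us1, us2, us3, us)" by (cases x)
    have "set us \<subseteq> {..<n}" "set us3 \<subseteq> {..<n}"
      using x set_smp[OF n_pos] unfolding e coins_def by auto
    then have "freeze_reject w Rs us1 us2 \<or> (\<exists>v\<in>set us3. v \<in> ?D) \<or> budget < cost w x" if "\<not> (accept w x \<and> cost w x \<le> budget)"
      using that st[of "set us"] unfolding accept_def e by auto
    then show "of_bool (\<not> (accept w x \<and> cost w x \<le> budget)) \<le> of_bool (case x of (Rs, us1, us2, us3, us) \<Rightarrow> freeze_reject w Rs us1 us2)
       + of_bool (case x of (Rs, us1, us2, us3, us) \<Rightarrow> \<exists>v\<in>set us3. v \<in> ?D) + (of_bool (budget < cost w x) :: real)"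
      unfolding e prod.case by (auto simp: of_bool_def)
  qed
  also have "\<dots> = ex coins (\<lambda>x. of_bool (case x of (Rs, us1, us2, us3, us) \<Rightarrow> freeze_reject w Rs us1 us2))
      + ex (smp n 40) (\<lambda>us3. of_bool (\<exists>v\<in>set us3. v \<in> ?D)) + ex coins (\<lambda>x. of_bool (budget < cost w x))"
    unfolding ex_add[OF finite_coins] by (simp add: ex_coins)
  also have "\<dots> \<le> (1/1000 + 250 * \<epsilon>0) + 800 * \<epsilon>0 + 1/32"
  proof (intro add_mono prob_over_budget frz_metric[OF met])
    have "2 * 2 ^ k < n" using n_lower k2
    proof -
      have "(2::nat) * 2 ^ k < 16 ^ k" using k2
      proof (induction k rule: dec_induct)
        case (step m)
        then show ?case by simp
      qed simp
      then show ?thesis using n_lower by simp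
    qed
    then have "real (card ?D) \<le> real (20 * (tour_cost n w p - n))" using card_dead_le by (intro of_nat_mono) blast
    then have D: "real (card ?D) \<le> 20 * (\<epsilon>0 * real n)" using slack by simp
    have "ex (smp n 40) (\<lambda>us3. of_bool (\<exists>v\<in>set us3. v \<in> ?D)) \<le> real 40 * (real (card ?D) / real n)"
      by (rule ex_smp_some[OF n_pos]) auto
    also have "\<dots> \<le> real 40 * (20 * (\<epsilon>0 * real n) / real n)" using D by (intro mult_left_mono divide_right_mono) auto
    finally show "ex (smp n 40) (\<lambda>us3. of_bool (\<exists>v\<in>set us3. v \<in> ?D)) \<le> 800 * \<epsilon>0" using n_pos by simp
  next
    have "ex coins (\<lambda>x. of_bool (case x of (Rs, us1, us2, us3, us) \<Rightarrow> freeze_reject w Rs us1 us2))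
      \<le> ex (rsets n q (2 * k + 3)) (\<lambda>Rs. 1/1000 + 250 * \<epsilon>0)"
      unfolding ex_freeze_reject
    proof (rule ex_mono[OF finite_rsets])
      fix Rs
      define I where "I = act n w ({..<n} # Rs)"
      define f where "f = real (card ({..<n} - Act Rs)) / real n"
      have f0: "0 \<le> f" "f \<le> 1" using n_pos card_mono[of "{..<n}" "{..<n} - Act Rs"] by (auto simp: f_def)
      have "I = {v \<in> Act Rs. \<forall>u\<in>Act Rs. w v u \<noteq> 1}"
        unfolding I_def act.simps nb_def using Act_sub[of Rs] by auto
      then have "real (card I) \<le> real (card ({..<n} - Act Rs)) + \<epsilon>0 * real n"
        using isolated_le[OF Act_sub, of Rs] slack by (simp flip: of_nat_add)
      then have I: "real (card I) / real n \<le> f + \<epsilon>0"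
        using n_pos by (simp add: f_def field_simps)
      have "I \<subseteq> {..<n}" unfolding I_def by (rule Act_sub)
      then have 1: "ex (smp n 250) (\<lambda>us1. of_bool (\<exists>v\<in>set us1. v \<in> I)) \<le> 250 * (f + \<epsilon>0)"
        using ex_smp_some[OF n_pos, of I 250] I by simp
      have "real (card ({..<n} - Act Rs)) = real n - real (card (Act Rs))"
        using card_Act[of Rs] by (simp add: card_Diff_subset Act_sub of_nat_diff)
      then have "real (card (Act Rs)) / real n = 1 - f" using n_pos by (simp add: f_def field_simps)
      then have 2: "ex (smp n 125000) (\<lambda>us2. of_bool (\<forall>v\<in>set us2. v \<in> Act Rs)) = (1 - f) ^ 125000"
        using ex_smp_all[OF n_pos Act_sub, of 125000 Rs] by simp
      have 3: "f * (1 - f) ^ 125000 \<le> 1/250000"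
      proof (cases "f = 0")
        case False
        then show ?thesis using deg_survive_le[of f 125000] f0 by (simp add: field_simps)
      qed simp
      have 4: "\<epsilon>0 * (1 - f) ^ 125000 \<le> \<epsilon>0 * 1" using f0
        by (intro mult_left_mono power_le_one) (auto simp: \<epsilon>0_def)
      have "ex (smp n 250) (\<lambda>us1. of_bool (\<exists>v\<in>set us1. v \<in> I)) * ex (smp n 125000) (\<lambda>us2. of_bool (\<forall>v\<in>set us2. v \<in> Act Rs))
        \<le> 250 * (f + \<epsilon>0) * (1 - f) ^ 125000"
        unfolding 2 using 1 f0 by (intro mult_right_mono) auto
      also have "\<dots> = 250 * (f * (1 - f) ^ 125000) + 250 * (\<epsilon>0 * (1 - f) ^ 125000)" by (simp add: algebra_simps)
      also have "\<dots> \<le> 1/1000 + 250 * \<epsilon>0" using 3 4 by linarith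
      finally show "ex (smp n 250) (\<lambda>us1. of_bool (\<exists>v\<in>set us1. v \<in> act n w ({..<n} # Rs))) *
          ex (smp n 125000) (\<lambda>us2. of_bool (\<forall>v\<in>set us2. v \<in> Act Rs)) \<le> 1/1000 + 250 * \<epsilon>0"
        unfolding I_def .
    qed
    then show "ex coins (\<lambda>x. of_bool (case x of (Rs, us1, us2, us3, us) \<Rightarrow> freeze_reject w Rs us1 us2)) \<le> 1/1000 + 250 * \<epsilon>0"
      by simp
  qed
  also have "\<dots> \<le> 1/16" by (simp add: \<epsilon>0_def)
  finally show ?thesis .
qed

text \<open>A leaf in \<open>hub\<close> is isolated, frozen (counted by \<open>Xf\<close>) or has
  an active neighbour in \<open>W\<close> (counted by \<open>Mf\<close>). Both counts are tiny in
  expectation, so many isolated vertices remain while hardly any vertex is frozen.\<close>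

lemma hubs_rejected:
  assumes c: "ctree n par lev w Z" and W: "real (card (ctree.W par Z)) \<le> 2 / 10 ^ 13 * real n"
    and hub: "real n / 25 \<le> real (card (ctree.hub n par Z))"
  shows "ex coins (\<lambda>x. of_bool (\<not> (case x of (Rs, us1, us2, us3, us) \<Rightarrow> freeze_reject w Rs us1 us2))) \<le> 1/16"
proof -
  interpret ctree n par lev w Z by fact
  interpret frz n w by (rule frz_metric[OF met])
  let ?M = "rsets n q (2 * k + 3)"
  \<comment> \<open>Outside \<open>W\<close> unit edges are tree edges, so \<open>v\<close> sees at
    most its parent and its children; each of the two kinds sums to at most n.\<close>
  have sparse: "(\<Sum>v\<in>{..<n} - W. real (card (N v - W))) \<le> 2 * real n"
  proof -
    define ch where "ch v = {y. 0 < y \<and> y < n \<and> par y = v}" for v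
    have fin: "finite (ch v)" for v unfolding ch_def by simp
    have "real (card (N v - W)) \<le> 1 + real (card (ch v))" if "v \<in> {..<n} - W" for v
    proof -
      have "N v - W \<subseteq> insert (par v) (ch v)"
      proof
        fix y assume y: "y \<in> N v - W"
        then have yn: "y < n" "w v y = 1" by (auto simp: nb_def)
        moreover have "y \<noteq> v" using yn w_refl[OF met, of v] by auto
        ultimately have "par v = y \<or> par y = v" using unit_not_W[of v y] that y by auto
        then show "y \<in> insert (par v) (ch v)" using yn \<open>y \<noteq> v\<close> unfolding ch_def by (cases "y = 0") auto
      qed
      then have "card (N v - W) \<le> card (insert (par v) (ch v))" using fin by (intro card_mono) auto
      also have "\<dots> \<le> Suc (card (ch v))" by (simp add: card_insert_if fin)
      finally show ?thesis by simp
    qed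
    then have "(\<Sum>v\<in>{..<n} - W. real (card (N v - W))) \<le> (\<Sum>v\<in>{..<n} - W. 1 + real (card (ch v)))" by (rule sum_mono)
    also have "\<dots> \<le> (\<Sum>v<n. 1 + real (card (ch v)))" by (rule sum_mono2) auto
    also have "\<dots> = real n + real (\<Sum>v<n. card (ch v))" by (simp add: sum.distrib)
    also have "(\<Sum>v<n. card (ch v)) = card (\<Union>v<n. ch v)"
      using fin by (subst card_UN_disjoint) (auto simp: ch_def)
    also have "\<dots> \<le> card {..<n}" by (intro card_mono) (auto simp: ch_def)
    finally show ?thesis by simp
  qed
  have qs: "\<And>i. i < 2 * k + 3 \<Longrightarrow> 0 < q i \<and> q i \<le> 1" by (rule q_le)
  have pot: "ex ?M (\<lambda>Rs. Xf W Rs + q (2 * k + 3) * Mf W Rs + 8 * Nf W Rs) \<le> 9 * real (card W) + 2 * real n * (\<Sum>j<2 * k + 3. q j)"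
    by (rule freeze_potential[where L = "2 * k + 3" and q = q, OF W_lt sparse qs q4]) (use q_pos[of 0] q_0 in auto)
  have M0: "0 \<le> Mf W Rs" for Rs unfolding Mf_def[OF W_lt sparse] by (intro sum_nonneg) auto
  have N0: "0 \<le> Nf W Rs" for Rs unfolding Nf_def[OF W_lt sparse] by (intro sum_nonneg) auto
  have X0: "0 \<le> Xf W Rs" for Rs unfolding Xf_def[OF W_lt sparse] by simp
  have q3: "q (2 * k + 3) = 4 / 10 ^ 8" using q4[of "2 * k + 2"] q_last by (simp add: eval_nat_numeral)
  have EX: "ex ?M (Xf W) \<le> 29 / 10 ^ 9 * real n"
  proof -
    have "ex ?M (Xf W) \<le> ex ?M (\<lambda>Rs. Xf W Rs + q (2 * k + 3) * Mf W Rs + 8 * Nf W Rs)"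
      using M0 N0 q_pos[of "2 * k + 3"] by (intro ex_mono[OF finite_rsets]) (simp add: add_increasing2)
    also note pot
    also have "2 * real n * (\<Sum>j<2 * k + 3. q j) \<le> 2 * real n * (4 / 10 ^ 8 / 3)"
      using q_sum[of "2 * k + 3"] unfolding q3 by (intro mult_left_mono) auto
    finally show ?thesis using W by simp
  qed
  have EM: "ex ?M (Mf W) \<le> 2 / 10 ^ 5 * real n"
  proof -
    have "ex ?M (Mf W) \<le> real (card W) / q (2 * k + 2)"
      using M_final[OF W_lt sparse, of q "2 * k + 2"] qs by (simp add: eval_nat_numeral)
    then show ?thesis using W unfolding q_last by simp
  qed
  have frozen: "real (card ({..<n} - Act Rs)) \<le> Xf W Rs + real (card W)" for Rs
  proof -
    have "card ({..<n} - Act Rs) \<le> card (({..<n} - W - Act Rs) \<union> W)" using finite_W by (intro card_mono) auto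
    also have "\<dots> \<le> card ({..<n} - W - Act Rs) + card W" by (rule card_Un_le)
    finally show ?thesis unfolding Xf_def[OF W_lt sparse] by simp
  qed
  define I where "I Rs = act n w ({..<n} # Rs)" for Rs
  have Isub: "I Rs \<subseteq> {..<n}" for Rs unfolding I_def by (rule Act_sub)
  have hubs: "real (card hub) \<le> real (card (I Rs)) + Xf W Rs + Mf W Rs" for Rs
  proof -
    have "hub \<subseteq> I Rs \<union> ({..<n} - W - Act Rs) \<union> (\<Union>z\<in>W \<inter> Act Rs. N z \<inter> Act Rs)"
    proof
      fix v assume v: "v \<in> hub"
      then have vn: "v < n" "v \<notin> W" by (auto simp: hub_def)
      show "v \<in> I Rs \<union> ({..<n} - W - Act Rs) \<union> (\<Union>z\<in>W \<inter> Act Rs. N z \<inter> Act Rs)"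
      proof (cases "v \<in> Act Rs \<and> v \<notin> I Rs")
        case True
        then obtain y where y: "y \<in> N v" "y \<in> Act Rs" by (auto simp: I_def)
        then have yn: "y < n" "w v y = 1" by (auto simp: nb_def)
        moreover have "y \<noteq> v" using yn w_refl[OF met, of v] by auto
        ultimately have "y \<in> W" using hub_nbrs[OF v] by blast
        moreover have "v \<in> N y" using N_sym[of y v] y yn vn by blast
        ultimately show ?thesis using True y by blast
      qed (use vn in auto)
    qed
    then have "card hub \<le> card (I Rs \<union> ({..<n} - W - Act Rs) \<union> (\<Union>z\<in>W \<inter> Act Rs. N z \<inter> Act Rs))"
      using finite_W finite_subset[OF Isub] by (intro card_mono) auto
    also have "\<dots> \<le> card (I Rs) + card ({..<n} - W - Act Rs) + card (\<Union>z\<in>W \<inter> Act Rs. N z \<inter> Act Rs)"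
      by (meson card_Un_le add_right_mono order_trans)
    also have "card (\<Union>z\<in>W \<inter> Act Rs. N z \<inter> Act Rs) \<le> (\<Sum>z\<in>W \<inter> Act Rs. deg Rs z)"
      unfolding deg_def using finite_W by (intro card_UN_le) auto
    finally have "real (card hub) \<le> real (card (I Rs) + card ({..<n} - W - Act Rs) + (\<Sum>z\<in>W \<inter> Act Rs. deg Rs z))"
      by (intro of_nat_mono) simp
    then show ?thesis unfolding Xf_def[OF W_lt sparse] Mf_def[OF W_lt sparse] by simp
  qed
  \<comment> \<open>If fewer than \<open>n / 50\<close> vertices are isolated, then
    \<open>hub\<close> and \<open>hubs\<close> give \<open>Xf + Mf >= n / 50\<close>, and the
    right-hand side is at least 1.\<close>
  have miss: "ex (smp n 250) (\<lambda>us1. of_bool (\<forall>v\<in>set us1. v \<notin> I Rs)) \<le> 1/50 + 50 / real n * (Xf W Rs + Mf W Rs)" for Rs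
  proof (cases "real n / 50 \<le> real (card (I Rs))")
    case True
    then have "1/50 \<le> real (card (I Rs)) / real n" using n_pos by (simp add: field_simps)
    moreover have "real (card (I Rs)) / real n \<le> 1" using n_pos card_mono[OF _ Isub[of Rs]] by simp
    ultimately have "(1 - real (card (I Rs)) / real n) ^ 250 \<le> (49/50) ^ 250" by (intro power_mono) auto
    also have "(49/50 :: real) ^ 250 \<le> 1/50"
    proof -
      have "(49/50 :: real) ^ 50 \<le> 2/5" by (simp add: power_divide)
      then have "((49/50 :: real) ^ 50) ^ 5 \<le> (2/5) ^ 5" by (intro power_mono) auto
      also have "((49/50 :: real) ^ 50) ^ 5 = (49/50) ^ 250" by (subst power_mult[symmetric]) simp
      also have "(2/5 :: real) ^ 5 \<le> 1/50" by (simp add: power_divide)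
      finally show ?thesis .
    qed
    finally show ?thesis unfolding ex_smp_none[OF n_pos Isub] using X0[of Rs] M0[of Rs] by (simp add: add_increasing2)
  next
    case False
    then have "real n / 50 \<le> Xf W Rs + Mf W Rs" using hub hubs[of Rs] by linarith
    then have "1 \<le> 50 / real n * (Xf W Rs + Mf W Rs)" using n_pos by (simp add: field_simps)
    moreover have "ex (smp n 250) (\<lambda>us1. of_bool (\<forall>v\<in>set us1. v \<notin> I Rs)) \<le> ex (smp n 250) (\<lambda>us1. 1)"
      by (intro ex_mono[OF finite_smp[OF n_pos]]) auto
    ultimately show ?thesis by simp
  qed
  have hit: "ex (smp n 125000) (\<lambda>us2. of_bool (\<exists>v\<in>set us2. v \<in> {..<n} - Act Rs)) \<le> 125000 / real n * (Xf W Rs + real (card W))" for Rs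
  proof -
    have "ex (smp n 125000) (\<lambda>us2. of_bool (\<exists>v\<in>set us2. v \<in> {..<n} - Act Rs)) \<le> real 125000 * (real (card ({..<n} - Act Rs)) / real n)"
      by (rule ex_smp_some[OF n_pos]) auto
    also have "\<dots> \<le> real 125000 * ((Xf W Rs + real (card W)) / real n)"
      using frozen[of Rs] by (intro mult_left_mono divide_right_mono) auto
    finally show ?thesis by simp
  qed
  have "ex coins (\<lambda>x. of_bool (\<not> (case x of (Rs, us1, us2, us3, us) \<Rightarrow> freeze_reject w Rs us1 us2)))
     \<le> ex coins (\<lambda>x. case x of (Rs, us1, us2, us3, us) \<Rightarrow> of_bool (\<forall>v\<in>set us1. v \<notin> I Rs) + of_bool (\<exists>v\<in>set us2. v \<in> {..<n} - Act Rs))"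
  proof (rule ex_mono[OF finite_coins])
    fix x assume x: "x \<in> set_pmf coins"
    obtain Rs us1 us2 us3 us where e: "x = (Rs, us1, us2, us3, us)" by (cases x)
    have "set us2 \<subseteq> {..<n}" using x set_smp[OF n_pos] unfolding e coins_def by auto
    then have "(\<forall>v\<in>set us1. v \<notin> I Rs) \<or> (\<exists>v\<in>set us2. v \<in> {..<n} - Act Rs)" if "\<not> freeze_reject w Rs us1 us2"
      using that unfolding freeze_reject_def I_def by blast
    then show "(of_bool (\<not> (case x of (Rs, us1, us2, us3, us) \<Rightarrow> freeze_reject w Rs us1 us2)) :: real) \<le> (case x of (Rs, us1, us2, us3, us) \<Rightarrow>
        of_bool (\<forall>v\<in>set us1. v \<notin> I Rs) + of_bool (\<exists>v\<in>set us2. v \<in> {..<n} - Act Rs))"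
      unfolding e prod.case by (auto simp: of_bool_def)
  qed
  also have "\<dots> = ex ?M (\<lambda>Rs. ex (smp n 250) (\<lambda>us1. of_bool (\<forall>v\<in>set us1. v \<notin> I Rs))
      + ex (smp n 125000) (\<lambda>us2. of_bool (\<exists>v\<in>set us2. v \<in> {..<n} - Act Rs)))"
    unfolding ex_coins prod.case ex_add[OF finite_smp[OF n_pos]] by simp
  also have "\<dots> \<le> ex ?M (\<lambda>Rs. (1/50 + 50 / real n * (Xf W Rs + Mf W Rs)) + 125000 / real n * (Xf W Rs + real (card W)))"
    by (intro ex_mono[OF finite_rsets] add_mono miss hit)
  also have "\<dots> = (1/50 + 50 / real n * (ex ?M (Xf W) + ex ?M (Mf W))) + 125000 / real n * (ex ?M (Xf W) + real (card W))"
    unfolding ex_add[OF finite_rsets] ex_cmult by simp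
  also have "\<dots> \<le> (1/50 + 50 / real n * (29 / 10 ^ 9 * real n + 2 / 10 ^ 5 * real n))
      + 125000 / real n * (29 / 10 ^ 9 * real n + 2 / 10 ^ 13 * real n)"
    using EX EM W by (intro add_mono mult_left_mono order_refl) auto
  also have "\<dots> \<le> 1/16" using n_pos by (simp add: field_simps)
  finally show ?thesis .
qed

text \<open>The exponent splits as \<open>3 * (k + 1) + 5\<close>: the powers of
  \<open>exp 3 >= 16\<close> dominate n, and \<open>exp 5\<close> supplies the 16.\<close>

lemma subtree_missed:
  assumes "X \<subseteq> {..<n}" "2 ^ k < card X"
  shows "ex (smp n s) (\<lambda>us. of_bool (\<forall>v\<in>set us. v \<notin> X)) \<le> 1 / (16 * real n)"
proof -
  have c: "real (card X) / real n \<le> 1" using n_pos card_mono[OF _ assms(1)] by simp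
  have "3 * real k + 8 \<le> real (card X) / real n * real s"
  proof -
    have "real n * (3 * real k + 8) \<le> 2 ^ k * real (n div 2 ^ k + 1) * (3 * real k + 8)"
      using s_ge by (intro mult_right_mono) auto
    also have "\<dots> = real (2 ^ k) * real s" by (simp add: s_def algebra_simps)
    also have "\<dots> \<le> real (card X) * real s" using assms(2) by (intro mult_right_mono of_nat_mono) auto
    finally show ?thesis using n_pos by (simp add: field_simps)
  qed
  then have "exp (- (real (card X) / real n * real s)) \<le> exp (- (3 * real k + 8))" by simp
  also have "\<dots> = 1 / (exp (3 * real (k + 1)) * exp 5)" by (simp add: exp_add[symmetric] exp_minus field_simps)
  also have "\<dots> \<le> 1 / (real n * 16)"
  proof -
    have "real n \<le> real (16 ^ (k + 1))" using n_upper by (intro of_nat_mono) simp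
    also have "\<dots> = 16 ^ (k + 1)" by simp
    also have "\<dots> \<le> exp 3 ^ (k + 1)" using exp_3_ge by (intro power_mono) auto
    also have "\<dots> = exp (3 * real (k + 1))" unfolding exp_of_nat_mult[symmetric] by (simp only: mult.commute)
    finally have "real n \<le> exp (3 * real (k + 1))" .
    moreover have "16 \<le> exp (5 :: real)" using exp_lower_Taylor_quadratic[of "5 :: real"] by simp
    ultimately have "real n * 16 \<le> exp (3 * real (k + 1)) * exp 5" by (intro mult_mono) auto
    then show ?thesis using n_pos by (intro divide_left_mono) auto
  qed
  finally have "exp (- (real (card X) / real n * real s)) \<le> 1 / (real n * 16)" .
  moreover have "(1 - real (card X) / real n) ^ s \<le> exp (- (real (card X) / real n * real s))"
    by (rule power_exp_le) (use c in auto)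
  ultimately show ?thesis unfolding ex_smp_none[OF n_pos assms(1)] by (simp add: mult.commute)
qed

text \<open>By \<open>vertex_count\<close> one of three kinds of vertices abounds:
  \<open>5/25 + 2/10 + 11/20 = 19/20\<close>, and the missing \<open>n / 20\<close> exceeds
  \<open>26 * card W\<close>.\<close>

lemma long_instance_rejected:
  assumes pr: "promise n w" and long: "(2 - \<epsilon>0) * real n < real (TSP n w)"
  shows "ex coins (\<lambda>x. of_bool (accept w x)) \<le> 1/16"
proof -
  obtain par lev where "utree n par lev w" using promise_imp_utree[OF pr n_pos] .
  then interpret utree n par lev w .
  obtain Z where Zc: "Z \<subseteq> {1..<n}" "real (card Z) \<le> 46 * \<epsilon>0 * real n"
    "\<And>x y. x < n \<Longrightarrow> y < n \<Longrightarrow> real (card (pth x y - Z)) \<le> 23/22 * real (w x y)"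
    using tree_metric_contraction[OF long] by blast
  interpret ctree n par lev w Z by unfold_locales (use Zc in auto)
  have cZ: "real (card Z) \<le> 1 / 10 ^ 13 * real n" using Zc(2) by (simp add: \<epsilon>0_def)
  have cW: "real (card W) \<le> 2 / 10 ^ 13 * real n" using card_W of_nat_mono[OF card_W, where ?'a = real] cZ by simp
  let ?D = "{v. v < n \<and> dead n w (2 ^ k) v}"
  have "real n \<le> real (card (big (2 ^ k)) + 26 * card W + 2 * card ?D + 5 * card hub)"
    by (rule of_nat_mono[OF vertex_count]) (use n_ge in simp)
  then have "real n \<le> real (card (big (2 ^ k))) + 26 * real (card W) + 2 * real (card ?D) + 5 * real (card hub)" by simp
  then consider "real n / 25 \<le> real (card hub)" | "real n / 10 \<le> real (card ?D)" | "11/20 * real n \<le> real (card (big (2 ^ k)))"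
    using cW n_ge by fastforce
  then show ?thesis
  proof cases
    case 1
    have "ex coins (\<lambda>x. of_bool (accept w x)) \<le> ex coins (\<lambda>x. of_bool (\<not> (case x of (Rs, us1, us2, us3, us) \<Rightarrow> freeze_reject w Rs us1 us2)))"
      by (rule ex_mono[OF finite_coins]) (auto simp: accept_def of_bool_def)
    also have "\<dots> \<le> 1/16" by (rule hubs_rejected[OF _ cW 1]) unfold_locales
    finally show ?thesis .
  next
    case 2
    have D: "?D \<subseteq> {..<n}" by auto
    have "ex coins (\<lambda>x. of_bool (accept w x)) \<le> ex coins (\<lambda>x. of_bool (case x of (Rs, us1, us2, us3, us) \<Rightarrow> \<forall>v\<in>set us3. v \<notin> ?D))"
    proof (rule ex_mono[OF finite_coins])
      fix x :: "nat set list \<times> nat list \<times> nat list \<times> nat list \<times> nat list"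
      have "accept w x \<Longrightarrow> case x of (Rs, us1, us2, us3, us) \<Rightarrow> \<forall>v\<in>set us3. v \<notin> ?D"
        unfolding accept_def by (cases x) auto
      then show "(of_bool (accept w x) :: real) \<le> of_bool (case x of (Rs, us1, us2, us3, us) \<Rightarrow> \<forall>v\<in>set us3. v \<notin> ?D)"
        by (cases "accept w x") simp_all
    qed
    also have "\<dots> = ex (smp n 40) (\<lambda>us3. of_bool (\<forall>v\<in>set us3. v \<notin> ?D))" unfolding ex_coins prod.case by simp
    also have "\<dots> = (1 - real (card ?D) / real n) ^ 40" by (rule ex_smp_none[OF n_pos D])
    also have "\<dots> \<le> (9/10) ^ 40"
    proof (rule power_mono)
      show "1 - real (card ?D) / real n \<le> 9/10" using 2 n_pos by (simp add: field_simps)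
      show "0 \<le> 1 - real (card ?D) / real n" using n_pos card_mono[OF _ D] by simp
    qed
    also have "(9/10 :: real) ^ 40 \<le> 1/16" by (simp add: power_divide)
    finally show ?thesis .
  next
    case 3
    let ?B = "big (2 ^ k) - {0}"
    have subn: "sub v \<subseteq> {..<n}" for v by (auto simp: sub_def)
    have sub0: "0 \<notin> sub v" for v by (auto simp: sub_def anc_def)
    have fB: "finite ?B" "?B \<subseteq> {..<n}" by (auto simp: big_def)
    have "ex coins (\<lambda>x. of_bool (accept w x)) \<le> ex coins (\<lambda>x. case x of (Rs, us1, us2, us3, us) \<Rightarrow>
        \<Sum>v\<in>?B. of_bool (\<forall>u\<in>set us. u \<notin> sub v))"
    proof (rule ex_mono[OF finite_coins])
      fix x assume x: "x \<in> set_pmf coins"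
      obtain Rs us1 us2 us3 us where e: "x = (Rs, us1, us2, us3, us)" by (cases x)
      have us: "set us \<subseteq> {..<n}" using set_coins[OF x[unfolded e]] by simp
      have "\<exists>v\<in>?B. \<forall>u\<in>set us. u \<notin> sub v" if "accept w x"
      proof (rule ccontr)
        assume neg: "\<not> ?thesis"
        obtain xs where xs: "set xs = set us - {0}" "real (wcost w (0 # xs @ [0])) \<le> (1 + \<epsilon>0) * real n"
          using \<open>accept w x\<close> unfolding accept_def e prod.case short_tour_def by blast
        have lower: "44 * (real (card (big (2 ^ k))) - 1 - real (card Z)) \<le> 23 * real (wcost w (0 # xs @ [0]))"
        proof (rule tour_S_lower)
          show "set xs \<subseteq> {..<n}" using xs us by auto
          fix v assume "v \<in> ?B"
          then obtain u where "u \<in> set us" "u \<in> sub v" using neg by blast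
          then show "sub v \<inter> set xs \<noteq> {}" using sub0[of v] xs(1) by (cases "u = 0") auto
        qed
        \<comment> \<open>Since \<open>44 * 11/20 = 24.2\<close> exceeds 23, a sample that meets
          every big subtree has no short tour.\<close>
        have "44 * (11/20 * real n - 1 - 1 / 10 ^ 13 * real n) \<le> 44 * (real (card (big (2 ^ k))) - 1 - real (card Z))"
          using 3 cZ by (intro mult_left_mono diff_mono) auto
        also note lower
        also have "23 * real (wcost w (0 # xs @ [0])) \<le> 23 * ((1 + \<epsilon>0) * real n)"
          using xs(2) by (intro mult_left_mono) auto
        finally have "44 * (11/20 * real n - 1 - 1 / 10 ^ 13 * real n) \<le> 23 * ((1 + \<epsilon>0) * real n)" .
        then show False using n_ge by (simp add: \<epsilon>0_def algebra_simps)
      qed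
      then have "accept w x \<Longrightarrow> 1 \<le> (\<Sum>v\<in>?B. of_bool (\<forall>u\<in>set us. u \<notin> sub v) :: real)"
      proof -
        assume "accept w x"
        then obtain v where v: "v \<in> ?B" "\<forall>u\<in>set us. u \<notin> sub v" using \<open>accept w x \<Longrightarrow> \<exists>v\<in>?B. \<forall>u\<in>set us. u \<notin> sub v\<close> by blast
        then have "1 = (of_bool (\<forall>u\<in>set us. u \<notin> sub v) :: real)" by simp
        also have "\<dots> \<le> (\<Sum>v\<in>?B. of_bool (\<forall>u\<in>set us. u \<notin> sub v))"
          by (rule member_le_sum[OF v(1) _ fB(1)]) simp
        finally show ?thesis .
      qed
      moreover have "0 \<le> (\<Sum>v\<in>?B. of_bool (\<forall>u\<in>set us. u \<notin> sub v) :: real)" by (intro sum_nonneg) simp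
      ultimately show "(of_bool (accept w x) :: real) \<le> (case x of (Rs, us1, us2, us3, us) \<Rightarrow>
          \<Sum>v\<in>?B. of_bool (\<forall>u\<in>set us. u \<notin> sub v))"
        unfolding e prod.case by (cases "accept w (Rs, us1, us2, us3, us)") simp_all
    qed
    also have "\<dots> = (\<Sum>v\<in>?B. ex (smp n s) (\<lambda>us. of_bool (\<forall>u\<in>set us. u \<notin> sub v)))"
      unfolding ex_coins prod.case ex_sum[OF finite_smp[OF n_pos]] by simp
    also have "\<dots> \<le> (\<Sum>v\<in>?B. 1 / (16 * real n))"
      using subn by (intro sum_mono subtree_missed) (auto simp: big_def)
    also have "\<dots> = real (card ?B) * (1 / (16 * real n))" by simp
    also have "\<dots> \<le> real n * (1 / (16 * real n))"
      using card_mono[OF _ fB(2)] by (intro mult_right_mono) auto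
    finally show ?thesis using n_pos by simp
  qed
qed

text \<open>For \<open>TSP\<close> between \<open>(1 + \<epsilon>0) * n\<close> and
  \<open>(2 - \<epsilon>0) * n\<close> both outputs are valid, because
  \<open>(2 - \<epsilon>0) * (1 + \<epsilon>0) >= 2\<close>. Hence the vote has to be reliable only
  in the two extreme ranges.\<close>

lemma algorithm_exists:
  "\<exists>A. \<forall>w. (\<forall>t\<in>set_pmf A. qt_queries t w \<le> 4 * (k + 1) * budget) \<and>
    (promise n w \<longrightarrow> measure_pmf.prob A
       {t. real (TSP n w) \<le> qt_output t w \<and> qt_output t w \<le> (2 - \<epsilon>0) * real (TSP n w)} \<ge> 1 - 1 / real n)"
proof -
  let ?good = "\<lambda>x b d. qcomp b d \<and> (\<forall>w. d w \<le> budget) \<and>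
     (x \<in> set_pmf coins \<longrightarrow> (\<forall>w. b w \<longrightarrow> accept w x) \<and> (\<forall>w. accept w x \<longrightarrow> cost w x \<le> budget \<longrightarrow> b w))"
  have "\<exists>b d. ?good x b d" for x
  proof (cases "x \<in> set_pmf coins")
    case True
    then show ?thesis using bit_exists[OF True] by blast
  next
    case False
    then show ?thesis using qcomp_return[of False] by (intro exI[of _ "\<lambda>_. False"] exI[of _ "\<lambda>_. 0"]) simp
  qed
  then have "\<forall>x. \<exists>b d. ?good x b d" by blast
  then have "\<exists>b. \<forall>x. \<exists>d. ?good x (b x) d" by (rule choice)
  then obtain b where "\<forall>x. \<exists>d. ?good x (b x) d" by blast
  then have "\<exists>d. \<forall>x. ?good x (b x) (d x)" by (rule choice)
  then obtain d where bd: "\<And>x. ?good x (b x) (d x)" by blast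
  have sound: "accept w x" if "x \<in> set_pmf coins" "b x w" for x w using bd that by blast
  have complete: "b x w" if "x \<in> set_pmf coins" "accept w x" "cost w x \<le> budget" for x w using bd that by blast
  \<comment> \<open>\<open>2 ^ m = 16 ^ (k + 1)\<close> exceeds n, which turns the majority error
    into \<open>1 / n\<close>.\<close>
  define m where "m = 4 * (k + 1)"
  define out where "out xs w = (if m < 2 * length (filter (\<lambda>x. b x w) xs) then (2 - \<epsilon>0) * real n else 2 * real n)" for xs w
  have "\<exists>t. \<forall>w. qt_output t w = out xs w \<and> qt_queries t w \<le> length xs * budget" for xs
  proof -
    have "qcomp (\<lambda>w. map (\<lambda>x. b x w) xs) (\<lambda>w. \<Sum>x\<leftarrow>xs. d x w)" by (rule qcomp_list) (use bd in blast)
    from qcomp_map[OF this, of "\<lambda>bs. if m < 2 * length (filter id bs) then (2 - \<epsilon>0) * real n else 2 * real n"]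
    have "qcomp (out xs) (\<lambda>w. \<Sum>x\<leftarrow>xs. d x w)"
      by (rule qcomp_cong) (simp_all add: out_def filter_map comp_def)
    then obtain t where t: "\<And>w. qt_output t w = out xs w" "\<And>w. qt_queries t w = (\<Sum>x\<leftarrow>xs. d x w)"
      using qcomp_imp_tree by blast
    have "(\<Sum>x\<leftarrow>xs. d x w) \<le> length xs * budget" for w
    proof (induction xs)
      case (Cons x xs)
      have "d x w \<le> budget" using bd by blast
      then show ?case using Cons by simp
    qed simp
    then show ?thesis using t by (intro exI[of _ t]) simp
  qed
  then have "\<forall>xs. \<exists>t. \<forall>w. qt_output t w = out xs w \<and> qt_queries t w \<le> length xs * budget" by blast
  from choice[OF this] obtain t where t: "\<And>xs w. qt_output (t xs) w = out xs w" "\<And>xs w. qt_queries (t xs) w \<le> length xs * budget"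
    by blast
  let ?A = "map_pmf t (replicate_pmf m coins)"
  have len: "length xs = m" if "xs \<in> set_pmf (replicate_pmf m coins)" for xs using that by (simp add: set_replicate_pmf)
  have "qt_queries u w \<le> 4 * (k + 1) * budget" if u: "u \<in> set_pmf ?A" for u w
  proof -
    obtain xs where "xs \<in> set_pmf (replicate_pmf m coins)" "u = t xs" using u by auto
    then show ?thesis using t(2)[of xs w] len by (simp add: m_def)
  qed
  moreover have "measure_pmf.prob ?A {u. real (TSP n w) \<le> qt_output u w \<and> qt_output u w \<le> (2 - \<epsilon>0) * real (TSP n w)} \<ge> 1 - 1 / real n"
    if pr: "promise n w" for w
  proof -
    let ?T = "real (TSP n w)"
    let ?ok = "\<lambda>xs. ?T \<le> out xs w \<and> out xs w \<le> (2 - \<epsilon>0) * ?T"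
    have met: "pos_int_metric n w" using pr by (simp add: promise_def)
    obtain par lev where "utree n par lev w" using promise_imp_utree[OF pr n_pos] .
    then interpret utree n par lev w .
    have T1: "real n \<le> ?T" using TSP_ge[OF met _ pr] n_ge by simp
    have T2: "?T \<le> 2 * real n" using TSP_le_cover_advantage[of "{}"] by simp
    have e0: "0 < \<epsilon>0" "\<epsilon>0 \<le> 1" by (auto simp: \<epsilon>0_def)
    have "(2 - \<epsilon>0) * real n \<le> (2 - \<epsilon>0) * ?T" using T1 e0 by (intro mult_left_mono) auto
    have m2: "1 / 2 ^ m \<le> 1 / real n"
    proof -
      have "real n \<le> real (16 ^ (k + 1))" using n_upper by (intro of_nat_mono) simp
      also have "\<dots> = 2 ^ m" unfolding m_def power_mult by simp
      finally show ?thesis using n_pos by (intro divide_left_mono) auto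
    qed
    have err: "measure_pmf.prob (replicate_pmf m coins) {xs. m \<le> 2 * length (filter P xs)} \<le> 1 / real n"
      if "ex coins (\<lambda>x. of_bool (P x)) \<le> 1/16" for P
    proof -
      have "measure_pmf.prob coins {x. P x} \<le> 1/16" using that unfolding prob_ex .
      from majority_error[OF finite_coins this, of m] m2 show ?thesis by linarith
    qed
    \<comment> \<open>\<open>P\<close> marks the runs that err on this instance; a wrong output
      needs at least half of the runs to err.\<close>
    have "\<exists>P. ex coins (\<lambda>x. of_bool (P x)) \<le> 1/16 \<and> (\<forall>xs\<in>set_pmf (replicate_pmf m coins). \<not> ?ok xs \<longrightarrow> m \<le> 2 * length (filter P xs))"
    proof -
      consider "?T < (1 + \<epsilon>0) * real n" | "(2 - \<epsilon>0) * real n < ?T"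
        | "(1 + \<epsilon>0) * real n \<le> ?T" "?T \<le> (2 - \<epsilon>0) * real n" by linarith
      then show ?thesis
      proof cases
        case 1
        have "ex coins (\<lambda>x. of_bool (\<not> b x w)) \<le> ex coins (\<lambda>x. of_bool (\<not> (accept w x \<and> cost w x \<le> budget)))"
          using complete by (intro ex_mono[OF finite_coins]) (auto simp: of_bool_def)
        also have "\<dots> \<le> 1/16" by (rule short_instance_accepted[OF pr 1])
        finally have e: "ex coins (\<lambda>x. of_bool (\<not> b x w)) \<le> 1/16" .
        have "m \<le> 2 * length (filter (\<lambda>x. \<not> b x w) xs)" if xs: "xs \<in> set_pmf (replicate_pmf m coins)" "\<not> ?ok xs" for xs
        proof -
          have "(1 + \<epsilon>0) * real n \<le> (2 - \<epsilon>0) * real n" using e0 by (intro mult_right_mono) (auto simp: \<epsilon>0_def)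
          then have "out xs w \<noteq> (2 - \<epsilon>0) * real n" using xs(2) 1 \<open>(2 - \<epsilon>0) * real n \<le> (2 - \<epsilon>0) * ?T\<close> by auto
          then have "\<not> m < 2 * length (filter (\<lambda>x. b x w) xs)" by (auto simp: out_def)
          then show ?thesis using sum_length_filter_compl[of "\<lambda>x. b x w" xs] len[OF xs(1)] by linarith
        qed
        then show ?thesis using e by (intro exI[of _ "\<lambda>x. \<not> b x w"] conjI ballI impI)
      next
        case 2
        have "ex coins (\<lambda>x. of_bool (b x w)) \<le> ex coins (\<lambda>x. of_bool (accept w x))"
          using sound by (intro ex_mono[OF finite_coins]) (auto simp: of_bool_def)
        also have "\<dots> \<le> 1/16" by (rule long_instance_rejected[OF pr 2])
        finally have e: "ex coins (\<lambda>x. of_bool (b x w)) \<le> 1/16" .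
        have "m \<le> 2 * length (filter (\<lambda>x. b x w) xs)" if xs: "\<not> ?ok xs" for xs
        proof -
          have "2 * real n \<le> (2 - \<epsilon>0) * ?T"
          proof -
            have "2 * real n \<le> (2 - \<epsilon>0) * ((2 - \<epsilon>0) * real n)" by (simp add: \<epsilon>0_def)
            also have "\<dots> \<le> (2 - \<epsilon>0) * ?T" using 2 e0 by (intro mult_left_mono) auto
            finally show ?thesis .
          qed
          then have "out xs w \<noteq> 2 * real n" using xs T2 by auto
          then show ?thesis by (auto simp: out_def split: if_splits)
        qed
        then show ?thesis using e by (intro exI[of _ "\<lambda>x. b x w"] conjI ballI impI)
      next
        case 3
        have "?ok xs" for xs
        proof -
          have "2 * real n \<le> (2 - \<epsilon>0) * ((1 + \<epsilon>0) * real n)" by (simp add: \<epsilon>0_def)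
          also have "\<dots> \<le> (2 - \<epsilon>0) * ?T" using 3 e0 by (intro mult_left_mono) auto
          finally show ?thesis using 3 T2 \<open>(2 - \<epsilon>0) * real n \<le> (2 - \<epsilon>0) * ?T\<close> by (simp add: out_def)
        qed
        then show ?thesis by (intro exI[of _ "\<lambda>_. False"]) simp
      qed
    qed
    then obtain P where P: "ex coins (\<lambda>x. of_bool (P x)) \<le> 1/16"
      "\<And>xs. xs \<in> set_pmf (replicate_pmf m coins) \<Longrightarrow> \<not> ?ok xs \<Longrightarrow> m \<le> 2 * length (filter P xs)" by blast
    have "1 - measure_pmf.prob (replicate_pmf m coins) {xs. ?ok xs} = measure_pmf.prob (replicate_pmf m coins) {xs. \<not> ?ok xs}"
      using measure_pmf.prob_compl[of "{xs. ?ok xs}" "replicate_pmf m coins"] by (simp add: Compl_eq_Diff_UNIV[symmetric] Collect_neg_eq[symmetric])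
    also have "\<dots> \<le> measure_pmf.prob (replicate_pmf m coins) {xs. m \<le> 2 * length (filter P xs)}"
      unfolding prob_ex using P(2) by (intro ex_mono[OF finite_replicate_pmf[OF finite_coins]]) (auto simp: of_bool_def)
    also have "\<dots> \<le> 1 / real n" by (rule err[OF P(1)])
    finally have "1 - 1 / real n \<le> measure_pmf.prob (replicate_pmf m coins) {xs. ?ok xs}" by simp
    then show ?thesis by (simp add: t(1) vimage_def)
  qed
  ultimately show ?thesis by blast
qed

text \<open>One logarithm comes from the number of repetitions and two from the squared sample size;
  \<open>4 ^ k <= sqrt n\<close> supplies the exponent 3/2.\<close>

lemma queries_le: "real (4 * (k + 1) * budget) \<le> 10 ^ 12 * (real n + 2) powr (3/2) * ln (real n + 2) ^ 3"
proof -
  have kl: "real k \<le> ln (real n + 2)"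
  proof -
    have "exp (real k) = exp 1 ^ k" by (simp add: exp_of_nat_mult[symmetric])
    also have "\<dots> \<le> 16 ^ k" using exp_le by (intro power_mono) auto
    also have "\<dots> = real (16 ^ k)" by simp
    also have "\<dots> \<le> real n + 2" using of_nat_mono[OF n_lower, where ?'a = real] by linarith
    finally have "ln (exp (real k)) \<le> ln (real n + 2)" by (intro ln_mono) auto
    then show ?thesis by simp
  qed
  have "4 ^ k \<le> sqrt (real n + 2)" using pow_facts(4) by (intro real_le_rsqrt) (simp add: power2_eq_square)
  then have "real n * 4 ^ k \<le> (real n + 2) * sqrt (real n + 2)" by (intro mult_mono) auto
  also have "\<dots> = (real n + 2) powr 1 * (real n + 2) powr (1/2)" by (simp add: powr_half_sqrt)
  also have "\<dots> = (real n + 2) powr (3/2)" by (subst powr_add[symmetric]) simp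
  finally have p: "real n * 4 ^ k \<le> (real n + 2) powr (3/2)" .
  have k1: "real k + 1 \<le> 2 * real k" "3 * real k + 8 \<le> 11 * real k" using k2 by auto
  have "real (4 * (k + 1) * budget) = 51200000 * (real k + 1) * (3 * real k + 8)\<^sup>2 * (real n * 4 ^ k)"
    by (simp add: budget_def)
  also have "\<dots> \<le> 51200000 * (2 * real k) * (11 * real k)\<^sup>2 * (real n + 2) powr (3/2)"
    using p k1 by (intro mult_mono power_mono) auto
  also have "\<dots> = 12390400000 * (real n + 2) powr (3/2) * real k ^ 3" by (simp add: power2_eq_square power3_eq_cube)
  also have "\<dots> \<le> 10 ^ 12 * (real n + 2) powr (3/2) * ln (real n + 2) ^ 3"
    using kl by (intro mult_mono power_mono) auto
  finally show ?thesis .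
qed

end

lemma brute_force:
  obtains t where "\<And>w. qt_output t w = real (TSP n w)" "\<And>w. qt_queries t w = n * n"
proof -
  let ?A = "{..<n} \<times> {..<n}"
  have "TSP n (known ?A w) = TSP n w" for w
  proof -
    have "tour_cost n (known ?A w) p = tour_cost n w p" if p: "p permutes {..<n}" for p
      unfolding tour_cost_def using perm_lt[OF p] by (intro sum.cong refl) (auto simp: known_def)
    then show ?thesis unfolding TSP_def by (intro arg_cong[of _ _ Min] image_cong) auto
  qed
  moreover have "qcomp (known ?A) (\<lambda>w. card ?A)" by (rule qcomp_known) simp
  ultimately have "qcomp (\<lambda>w. real (TSP n w)) (\<lambda>w. n * n)"
    using qcomp_map[of "known ?A" "\<lambda>w. card ?A" "\<lambda>w. real (TSP n w)"] by (simp add: card_cartesian_product)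
  then show ?thesis using qcomp_imp_tree that by blast
qed

text \<open>Below 256 points the whole matrix is queried; from \<open>16 ^ 2\<close> points on, a
  suitable \<open>k >= 2\<close> exists.\<close>

lemma algorithm_for_n:
  "\<exists>A. \<forall>w. promise n w \<longrightarrow>
        (\<forall>t\<in>set_pmf A. real (qt_queries t w) \<le> 10 ^ 12 * (real n + 2) powr (3/2) * ln (real n + 2) ^ 3) \<and>
        measure_pmf.prob A
          {t. real (TSP n w) \<le> qt_output t w \<and> qt_output t w \<le> (2 - \<epsilon>0) * real (TSP n w)}
          \<ge> 1 - 1 / real n"
proof (cases "n < 256")
  case True
  obtain t where t: "\<And>w. qt_output t w = real (TSP n w)" "\<And>w. qt_queries t w = n * n" using brute_force[of n] by blast
  have "real n * real n \<le> 10 ^ 12 * (real n + 2) powr (3/2) * ln (real n + 2) ^ 3"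
  proof -
    have "(1/2 :: real) \<le> ln 2" using ln2_ge_two_thirds by simp
    also have "\<dots> \<le> ln (real n + 2)" by (intro ln_mono) auto
    finally have l: "(1/2) ^ 3 \<le> ln (real n + 2) ^ 3" by (intro power_mono) auto
    have p: "1 \<le> (real n + 2) powr (3/2)" by (intro ge_one_powr_ge_zero) auto
    have "real n * real n \<le> 256 * 256" using True by (intro mult_mono) auto
    also have "\<dots> \<le> 10 ^ 12 * 1 * (1/2) ^ 3" by (simp add: power_divide)
    also have "\<dots> \<le> 10 ^ 12 * (real n + 2) powr (3/2) * ln (real n + 2) ^ 3"
      using l p by (intro mult_mono) auto
    finally show ?thesis .
  qed
  moreover have "real (TSP n w) \<le> (2 - \<epsilon>0) * real (TSP n w)" for w
    using mult_right_mono[of 1 "2 - \<epsilon>0" "real (TSP n w)"] by (simp add: \<epsilon>0_def)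
  ultimately show ?thesis by (intro exI[of _ "return_pmf t"]) (simp add: t)
next
  case False
  obtain k where k: "16 ^ k \<le> n" "n < 16 ^ (k + 1)" using ex_power_ivl1[of 16 n] False by auto
  have "2 \<le> k"
  proof (rule ccontr)
    assume "\<not> 2 \<le> k"
    then have "(16::nat) ^ (k + 1) \<le> 16 ^ 2" by (intro power_increasing) auto
    then show False using k False by simp
  qed
  then interpret run n k by unfold_locales (use k in auto)
  obtain A where A: "\<And>w t. t \<in> set_pmf A \<Longrightarrow> qt_queries t w \<le> 4 * (k + 1) * budget"
    "\<And>w. promise n w \<Longrightarrow> measure_pmf.prob A
       {t. real (TSP n w) \<le> qt_output t w \<and> qt_output t w \<le> (2 - \<epsilon>0) * real (TSP n w)} \<ge> 1 - 1 / real n"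
    using algorithm_exists by blast
  have "real (qt_queries t w) \<le> 10 ^ 12 * (real n + 2) powr (3/2) * ln (real n + 2) ^ 3" if "t \<in> set_pmf A" for t w
    using of_nat_mono[OF A(1)[OF that], of w, where ?'a = real] queries_le by linarith
  then show ?thesis using A(2) by blast
qed

theorem theorem1p7:
  shows "\<exists>(\<epsilon>0::real) (A::rand_query_alg) (c::real) (k::nat). \<epsilon>0 > 0 \<and>
     (\<forall>n w. promise n w \<longrightarrow>
        (\<forall>t\<in>set_pmf (A n).
           real (qt_queries t w) \<le> c * (real n + 2) powr (3/2) * ln (real n + 2) ^ k) \<and>
        measure_pmf.prob (A n)
          {t. real (TSP n w) \<le> qt_output t w \<and> qt_output t w \<le> (2 - \<epsilon>0) * real (TSP n w)}
          \<ge> 1 - 1 / real n)"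
proof -
  have "\<exists>A :: rand_query_alg. \<forall>n w. promise n w \<longrightarrow>
        (\<forall>t\<in>set_pmf (A n). real (qt_queries t w) \<le> 10 ^ 12 * (real n + 2) powr (3/2) * ln (real n + 2) ^ 3) \<and>
        measure_pmf.prob (A n)
          {t. real (TSP n w) \<le> qt_output t w \<and> qt_output t w \<le> (2 - \<epsilon>0) * real (TSP n w)}
          \<ge> 1 - 1 / real n"
    by (intro choice allI algorithm_for_n)
  moreover have "0 < \<epsilon>0" by (simp add: \<epsilon>0_def)
  ultimately show ?thesis by blast
qed

end
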